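(* Let $L(f,s)$ be an $L$-function of degree $d\ge 1$ in the sense of the context, with analytic conductor $C$, such that $\Lambda(f,s)$ has no zero or pole on the line $\Re s=1$. Assume the Generalized Riemann Hypothesis (as described in the context), and assume that $L(f,s)$ satisfies Ramanujan's conjecture, i.e. $|\alpha_i(p)|\le 1$ for all primes $p$ and all $1\le i\le d$. If $\log\log C\ge 10$, then $$\log|L(f,\tfrac12)|\le \frac{23d}{25}\,\frac{\log C}{(\log\log C)^2}+\frac38\,\frac{\log C}{\log\log C}.$$
   Context: An $L$-function $L(f,s)$ of degree $d\ge1$ is a Dirichlet series with Euler product $$L(f,s)=\sum_{n\ge1}\lambda_f(n)n^{-s}=\prod_p\prod_{i=1}^d(1-\alpha_i(p)p^{-s})^{-1},$$ with $\lambda_f(1)=1$ and $|\alpha_i(p)|<p$, the series and product converging absolutely for $\Re s>1$, together with the following data. There are complex numbers $k_1,\dots,k_d$ with $\Re k_j\ge0$ and an integer $q(f)\ge1$ (the conductor), with $\alpha_i(p)\ne0$ for $p\nmid q(f)$, such that, putting $$\gamma(f,s)=\pi^{-ds/2}\prod_{j=1}^d\Gamma\Big(\frac{s+k_j}{2}\Big),\qquad \Lambda(f,s)=q(f)^{s/2}\gamma(f,s)L(f,s),$$ the function $\Lambda(f,s)$ continues meromorphically to $\mathbb C$, of order 1 and with at most poles at $s=0,1$, and satisfies $\Lambda(f,s)=\epsilon(f)\overline{\Lambda(f,1-\bar s)}$ with $|\epsilon(f)|=1$. (Thus, when $\Lambda$ has no pole on $\Re s=1$, hence none on $\Re s=0$,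 it is entire of order 1.) The analytic conductor is $C=\dfrac{q(f)}{\pi^d}\prod_{j=1}^d\left|\dfrac14+\dfrac{k_j}{2}\right|$. Generalized Riemann Hypothesis: all zeros of $\Lambda(f,s)$ lie on $\Re s=\tfrac12$, and the same holds for the Riemann zeta function (all its nontrivial zeros lie on $\Re s=\tfrac12$). If $L(f,\frac12)=0$, the convention $\log 0=-\infty$ is used. *)

theory Defs
  imports
    "HOL-Complex_Analysis.Complex_Analysis"
    "HOL-Computational_Algebra.Primes"
begin

section \<open>Order of growth\<close>

text \<open>
  The order as the infimum of all exponents \<open>a \<ge> 0\<close> with \<open>\<bar>F(z)\<bar> \<le> exp(\<bar>z\<bar>\<^sup>a)\<close> for all large \<open>z\<close>.
  It is applied to meromorphic functions with at most two poles as well: multiplying such an \<open>F\<close>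
  by the polynomial that cancels the poles does not change the fact that the order is 1, and near
  infinity \<open>F\<close> has no poles.
\<close>
definition growth_order :: "(complex \<Rightarrow> complex) \<Rightarrow> ereal" where
  "growth_order F =
     Inf (ereal ` {a. 0 \<le> a \<and> (\<forall>\<^sub>F z in at_infinity. norm (F z) \<le> exp (norm z powr a))})"

section \<open>L-functions\<close>

text \<open>
  The index \<open>i \<in> {1..d}\<close> of the Euler and gamma parameters is shifted to \<open>i < d\<close>.  The completed
  function is part of the data; \<open>is_L_function\<close> determines it uniquely.
\<close>
record L_data =
  deg :: nat
  lam :: "nat \<Rightarrow> complex"
  alpha :: "nat \<Rightarrow> nat \<Rightarrow> complex"  \<comment> \<open>\<open>alpha f i p\<close> is \<open>\<alpha>\<^sub>i(p)\<close>\<close>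
  kpar :: "nat \<Rightarrow> complex"
  cond :: nat
  root_number :: complex
  Lambda :: "complex \<Rightarrow> complex"

definition L_series :: "L_data \<Rightarrow> complex \<Rightarrow> complex" where
  "L_series f s = (\<Sum>n. lam f (Suc n) * of_nat (Suc n) powr (- s))"

definition gamma_factor :: "L_data \<Rightarrow> complex \<Rightarrow> complex" where
  "gamma_factor f s =
     of_real pi powr (- of_nat (deg f) * s / 2) * (\<Prod>j<deg f. Gamma ((s + kpar f j) / 2))"

definition euler_factor :: "L_data \<Rightarrow> nat \<Rightarrow> complex \<Rightarrow> nat \<Rightarrow> complex" where
  "euler_factor f i s p = inverse (1 - alpha f i p * of_nat p powr (- s))"

text \<open>
  Products over primes are products over all naturals with factor 1 at non-primes.  Absolute
  convergence is that of the double product over \<open>p\<close> and \<open>i\<close>.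

  A nicely meromorphic function takes its limit value away from its poles and the (junk) value 0 at
  its poles, so the functional equation is only asked for away from the possible poles.
\<close>
definition is_L_function :: "L_data \<Rightarrow> bool" where
  "is_L_function f \<longleftrightarrow>
     deg f \<ge> 1 \<and> lam f 1 = 1 \<and>
     (\<forall>p i. prime p \<longrightarrow> i < deg f \<longrightarrow> norm (alpha f i p) < real p) \<and>
     (\<forall>s. Re s > 1 \<longrightarrow>
        summable (\<lambda>n. norm (lam f (Suc n) * of_nat (Suc n) powr (- s))) \<and>
        (\<forall>i<deg f. abs_convergent_prod (\<lambda>p. if prime p then euler_factor f i s p else 1)) \<and>
        (\<lambda>p. if prime p then \<Prod>i<deg f. euler_factor f i s p else 1) has_prod L_series f s) \<and>
     (\<forall>j<deg f. Re (kpar f j) \<ge> 0) \<and>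
     cond f \<ge> 1 \<and>
     (\<forall>p i. prime p \<longrightarrow> i < deg f \<longrightarrow> \<not> p dvd cond f \<longrightarrow> alpha f i p \<noteq> 0) \<and>
     Lambda f nicely_meromorphic_on UNIV \<and>
     (\<forall>s. Re s > 1 \<longrightarrow>
        Lambda f s = of_nat (cond f) powr (s / 2) * gamma_factor f s * L_series f s) \<and>
     growth_order (Lambda f) = 1 \<and>
     (\<forall>s. is_pole (Lambda f) s \<longrightarrow> s \<in> {0, 1}) \<and>
     norm (root_number f) = 1 \<and>
     (\<forall>s. s \<notin> {0, 1} \<longrightarrow> Lambda f s = root_number f * cnj (Lambda f (1 - cnj s)))"

text \<open>
  The value \<open>L(f,s)\<close> on the whole plane.  The quotient is the meromorphic continuation of
  \<open>L_series f\<close>, except at the poles of the gamma factor, where \<open>Gamma\<close> has the junk value 0;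
  \<open>remove_sings\<close> puts in the correct values there.
\<close>
definition L_fun :: "L_data \<Rightarrow> complex \<Rightarrow> complex" where
  "L_fun f = remove_sings (\<lambda>s. Lambda f s / (of_nat (cond f) powr (s / 2) * gamma_factor f s))"

text \<open>
  The conductor is positive but may be less than 1.  Since \<open>ln (- x) = ln x\<close> in the library, a bound
  on \<open>ln (ln C)\<close> has to be accompanied by \<open>C > 1\<close>, which says that \<open>log log C\<close> is defined.
\<close>
definition analytic_conductor :: "L_data \<Rightarrow> real" where
  "analytic_conductor f =
     real (cond f) / pi ^ deg f * (\<Prod>j<deg f. norm (1 / 4 + kpar f j / 2))"

definition Lambda_zero :: "L_data \<Rightarrow> complex \<Rightarrow> bool" where
  "Lambda_zero f s \<longleftrightarrow> \<not> is_pole (Lambda f) s \<and> Lambda f s = 0"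

definition ramanujan :: "L_data \<Rightarrow> bool" where
  "ramanujan f \<longleftrightarrow> (\<forall>p i. prime p \<longrightarrow> i < deg f \<longrightarrow> norm (alpha f i p) \<le> 1)"

section \<open>The Riemann zeta function and the Riemann hypotheses\<close>

definition is_zeta_continuation :: "(complex \<Rightarrow> complex) \<Rightarrow> bool" where
  "is_zeta_continuation Z \<longleftrightarrow>
     Z holomorphic_on (- {1}) \<and> (\<forall>s. Re s > 1 \<longrightarrow> (\<lambda>n. of_nat (Suc n) powr (- s)) sums Z s)"

text \<open>
  Such a function exists (lemma \<open>riemann_zeta\<close> below), and it is unique except for the value at the
  pole 1.
\<close>
definition riemann_zeta :: "complex \<Rightarrow> complex" where
  "riemann_zeta = (SOME Z. is_zeta_continuation Z)"

definition zeta_RH :: bool where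
  "zeta_RH \<longleftrightarrow>
     (\<forall>s. s \<noteq> 1 \<longrightarrow> riemann_zeta s = 0 \<longrightarrow> s \<notin> {- 2 * of_nat n | n. n \<ge> 1} \<longrightarrow> Re s = 1 / 2)"

definition GRH :: "L_data \<Rightarrow> bool" where
  "GRH f \<longleftrightarrow> (\<forall>s. Lambda_zero f s \<longrightarrow> Re s = 1 / 2) \<and> zeta_RH"

section \<open>Logarithm with the convention that the logarithm of 0 is minus infinity\<close>

definition log_ext :: "real \<Rightarrow> ereal" where
  "log_ext x = (if x = 0 then - \<infinity> else ereal (ln x))"

section \<open>Existence of the continuation of zeta\<close>

text \<open>
  Summing the Taylor expansion of \<open>(n + 1)\<^sup>1\<^sup>-\<^sup>s - n\<^sup>1\<^sup>-\<^sup>s\<close> over \<open>n\<close> expresses \<open>(s - 1) \<zeta>(s)\<close> in terms of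
  the \<open>\<zeta>(s + j)\<close> with \<open>j \<ge> 1\<close> and a remainder \<open>zrem\<close> that converges in a larger half-plane.
\<close>

lemma summable_Suc_powr: "x < - 1 \<Longrightarrow> summable (\<lambda>n. real (Suc n) powr x)"
  by (subst summable_Suc_iff) (simp add: summable_real_powr_iff)

lemma norm_Suc_powr: "norm (of_nat (Suc n) powr (z :: complex)) = real (Suc n) powr Re z"
  using norm_powr_real_powr[of "of_nat (Suc n)" z] by (simp del: of_nat_Suc)

lemma series_half_plane:
  fixes g :: "nat \<Rightarrow> complex \<Rightarrow> complex" and K :: "complex \<Rightarrow> real"
  assumes hol: "\<And>n. g n holomorphic_on {s. Re s > c}"
    and K: "continuous_on UNIV K"
    and bound: "\<And>n s. Re s > c \<Longrightarrow> norm (g n s) \<le> K s * real (Suc n) powr (c - 1 - Re s)"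
  shows "(\<lambda>s. \<Sum>n. g n s) holomorphic_on {s. Re s > c}"
    and "\<And>s. Re s > c \<Longrightarrow> summable (\<lambda>n. g n s)"
proof -
  have op: "open {s. Re s > c}" by (simp add: open_halfspace_Re_gt)
  show "summable (\<lambda>n. g n s)" if "Re s > c" for s
    by (rule summable_comparison_test'[OF summable_mult[OF summable_Suc_powr]])
       (use that bound in auto)
  show "(\<lambda>s. \<Sum>n. g n s) holomorphic_on {s. Re s > c}"
  proof (rule holomorphic_uniform_sequence[OF op])
    show "(\<lambda>s. \<Sum>i<n. g i s) holomorphic_on {s. Re s > c}" for n
      by (intro holomorphic_intros hol)
  next
    fix s assume "s \<in> {s. Re s > c}"
    define d where "d = (Re s - c) / 2"
    have d: "d > 0" using \<open>s \<in> _\<close> by (simp add: d_def)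
    have re: "Re z \<ge> c + d" if "z \<in> cball s d" for z
    proof -
      have "\<bar>Re (s - z)\<bar> \<le> d"
        using that abs_Re_le_cmod[of "s - z"] by (simp add: dist_norm del: minus_complex.sel)
      hence "Re z \<ge> Re s - d" by (simp add: abs_le_iff)
      thus ?thesis by (simp add: d_def field_simps)
    qed
    obtain B where B: "\<And>z. z \<in> cball s d \<Longrightarrow> \<bar>K z\<bar> \<le> B"
    proof -
      have "compact (K ` cball s d)"
        by (intro compact_continuous_image continuous_on_subset[OF K]) auto
      then obtain B where "\<forall>x\<in>K ` cball s d. norm x \<le> B"
        using compact_imp_bounded bounded_iff by blast
      thus ?thesis by (intro that) auto
    qed
    have "uniform_limit (cball s d) (\<lambda>n z. \<Sum>i<n. g i z) (\<lambda>z. \<Sum>i. g i z) sequentially"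
    proof (rule Weierstrass_m_test)
      show "norm (g n z) \<le> B * real (Suc n) powr (- 1 - d)" if "z \<in> cball s d" for n z
      proof -
        have "norm (g n z) \<le> K z * real (Suc n) powr (c - 1 - Re z)"
          using bound[of z n] re[OF that] d by simp
        also have "\<dots> \<le> B * real (Suc n) powr (- 1 - d)"
          using B[OF that] re[OF that] by (intro mult_mono powr_mono) auto
        finally show ?thesis .
      qed
      show "summable (\<lambda>n. B * real (Suc n) powr (- 1 - d))"
        using d by (intro summable_mult summable_Suc_powr) auto
    qed
    moreover have "cball s d \<subseteq> {s. Re s > c}" using re d by force
    ultimately show "\<exists>d>0. cball s d \<subseteq> {s. Re s > c} \<and>
        uniform_limit (cball s d) (\<lambda>n z. \<Sum>i<n. g i z) (\<lambda>z. \<Sum>i. g i z) sequentially"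
      using d by blast
  qed
qed

lemma gchoose_holomorphic [holomorphic_intros]:
  assumes "f holomorphic_on A"
  shows "(\<lambda>s. (f s :: complex) gchoose k) holomorphic_on A"
  unfolding gbinomial_prod_rev by (intro holomorphic_intros assms) auto

lemma gchoose_Suc: "(a :: complex) gchoose (Suc j) = (a gchoose j) * (a - of_nat j) / of_nat (Suc j)"
  by (simp add: gbinomial_prod_rev field_simps)

definition zrem :: "nat \<Rightarrow> nat \<Rightarrow> complex \<Rightarrow> complex" where
  "zrem m n s = of_nat (Suc (Suc n)) powr (1 - s) -
     (\<Sum>k\<le>Suc m. ((1 - s) gchoose k) * of_nat (Suc n) powr (1 - s - of_nat k))"

lemma zrem_bound:
  "norm (zrem m n s) \<le>
     (fact (m + 2) * norm ((1 - s) gchoose (m + 2)) * 2 powr \<bar>1 - Re s\<bar>) *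
       real (Suc n) powr (- real m - 1 - Re s)"
proof -
  define a where "a = 1 - s"
  define N :: complex where "N = of_nat (Suc n)"
  define F where "F i t = fact i * (a gchoose i) * (1 + t) powr (a - of_nat i)" for i and t :: complex
  define B where "B = fact (m + 2) * norm (a gchoose (m + 2)) * 2 powr \<bar>Re a\<bar>"
  define z where "z = 1 / N"
  have N0: "N \<noteq> 0" unfolding N_def by (simp del: of_nat_Suc)
  have zr: "z = of_real (1 / real (Suc n))" by (simp add: z_def N_def)
  let ?S = "of_real ` {0..1} :: complex set"
  have "norm (F 0 z - (\<Sum>i\<le>Suc m. F i 0 * (z - 0) ^ i / fact i))
          \<le> B * norm (z - 0) ^ Suc (Suc m) / fact (Suc m)"
  proof (rule field_Taylor[where S = ?S])
    show "convex ?S" by (intro convex_linear_image linear_of_real) auto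
    show "(F i has_field_derivative F (Suc i) t) (at t within ?S)" if "t \<in> ?S" for i t
    proof -
      have "1 + t \<notin> \<real>\<^sub>\<le>\<^sub>0" using that by (auto simp: complex_nonpos_Reals_iff)
      hence "(F i has_field_derivative fact i * (a gchoose i) *
               ((a - of_nat i) * (1 + t) powr (a - of_nat i - 1))) (at t within ?S)"
        unfolding F_def by (auto intro!: derivative_eq_intros)
      also have "fact i * (a gchoose i) * ((a - of_nat i) * (1 + t) powr (a - of_nat i - 1)) = F (Suc i) t"
        unfolding F_def gchoose_Suc by (simp add: field_simps del: of_nat_Suc) (simp add: algebra_simps)
      finally show ?thesis .
    qed
    show "norm (F (Suc (Suc m)) t) \<le> B" if t: "t \<in> ?S" for t
    proof -
      from t obtain x where x: "t = of_real x" "0 \<le> x" "x \<le> 1" by auto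
      have "norm ((1 + t) powr (a - of_nat (Suc (Suc m)))) = (1 + x) powr (Re a - real (m + 2))"
        using norm_powr_real_powr[of "1 + t" "a - of_nat (Suc (Suc m))"] x by simp
      also have "\<dots> \<le> (1 + x) powr \<bar>Re a\<bar>" using x by (intro powr_mono) auto
      also have "\<dots> \<le> 2 powr \<bar>Re a\<bar>" using x by (intro powr_mono2) auto
      finally have "norm ((1 + t) powr (a - of_nat (Suc (Suc m)))) \<le> 2 powr \<bar>Re a\<bar>" .
      thus ?thesis unfolding F_def B_def norm_mult
        by (intro mult_mono) (auto simp del: of_nat_Suc fact_Suc)
    qed
    show "(0 :: complex) \<in> ?S" by force
    show "z \<in> ?S" unfolding zr by (intro imageI) auto
  qed
  also have "\<dots> \<le> B * norm z ^ Suc (Suc m)"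
  proof -
    have "B * norm z ^ Suc (Suc m) * 1 \<le> B * norm z ^ Suc (Suc m) * fact (Suc m)"
      by (intro mult_left_mono fact_ge_1) (auto simp: B_def)
    thus ?thesis by (simp add: divide_le_eq del: fact_Suc power_Suc)
  qed
  finally have 1: "norm (F 0 z - (\<Sum>i\<le>Suc m. F i 0 * z ^ i / fact i)) \<le> B * norm z ^ Suc (Suc m)"
    by simp
  have powN: "N powr (a - of_nat k) = N powr a * z ^ k" for k
    using N0 by (simp add: powr_diff z_def powr_nat' power_divide divide_simps)
  have "of_nat (Suc (Suc n)) powr a = N powr a * (1 + z) powr a"
  proof -
    have "of_nat (Suc (Suc n)) = N * (1 + z)" using N0 by (simp add: z_def N_def field_simps)
    also have "\<dots> powr a = N powr a * (1 + z) powr a"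
      by (subst powr_times_real) (auto simp: N_def z_def)
    finally show ?thesis .
  qed
  hence "zrem m n s = N powr a * (F 0 z - (\<Sum>i\<le>Suc m. F i 0 * z ^ i / fact i))"
    unfolding zrem_def F_def a_def[symmetric] N_def[symmetric] powN
    by (simp add: right_diff_distrib sum_distrib_left mult_ac del: sum.atMost_Suc)
  hence "norm (zrem m n s) = real (Suc n) powr Re a * norm (F 0 z - (\<Sum>i\<le>Suc m. F i 0 * z ^ i / fact i))"
    using norm_Suc_powr[of n a] by (simp add: norm_mult N_def)
  also have "\<dots> \<le> real (Suc n) powr Re a * (B * norm z ^ Suc (Suc m))"
    by (intro mult_left_mono 1) auto
  also have "norm z ^ Suc (Suc m) = real (Suc n) powr (- real (m + 2))"
    unfolding zr norm_of_real
    by (simp add: powr_minus powr_realpow[symmetric] divide_simps del: of_nat_Suc power_Suc)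
       (simp add: powr_add powr_realpow add.commute del: of_nat_Suc)?
  also have "real (Suc n) powr Re a * (B * real (Suc n) powr (- real (m + 2))) =
               B * real (Suc n) powr (- real m - 1 - Re s)"
  proof -
    have "- real m - 1 - Re s = Re a + - real (m + 2)" by (simp add: a_def)
    thus ?thesis by (simp only: powr_add) simp
  qed
  finally show ?thesis by (simp add: B_def a_def)
qed

lemma zrem_series:
  "(\<lambda>s. \<Sum>n. zrem m n s) holomorphic_on {s. Re s > - real m}"
  "Re s > - real m \<Longrightarrow> summable (\<lambda>n. zrem m n s)"
proof -
  define K where "K s = fact (m + 2) * norm ((1 - s) gchoose (m + 2)) * 2 powr \<bar>1 - Re s\<bar>" for s
  have K: "continuous_on UNIV K" unfolding K_def gbinomial_prod_rev
    by (intro continuous_intros ballI fact_nonzero) simp_all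
  have hol: "zrem m n holomorphic_on {s. Re s > - real m}" for n
    unfolding zrem_def by (intro holomorphic_intros) (auto simp del: of_nat_Suc)
  note * = series_half_plane[OF hol K, unfolded K_def, OF zrem_bound]
  show "(\<lambda>s. \<Sum>n. zrem m n s) holomorphic_on {s. Re s > - real m}"
    "Re s > - real m \<Longrightarrow> summable (\<lambda>n. zrem m n s)"
    by (fact *)+
qed

definition zser :: "complex \<Rightarrow> complex" where "zser s = (\<Sum>n. of_nat (Suc n) powr (- s))"

lemma zser: "zser holomorphic_on {s. Re s > 1}"
  "Re s > 1 \<Longrightarrow> (\<lambda>n. of_nat (Suc n) powr (- s)) sums zser s"
proof -
  have hol: "(\<lambda>s. of_nat (Suc n) powr (- s)) holomorphic_on {s. Re s > 1}" for n
    by (intro holomorphic_intros) (auto simp del: of_nat_Suc)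
  have b: "norm (of_nat (Suc n) powr (- s)) \<le> 1 * real (Suc n) powr (1 - 1 - Re s)" for n s
    by (simp add: norm_Suc_powr del: of_nat_Suc)
  show "zser holomorphic_on {s. Re s > 1}"
    unfolding zser_def by (rule series_half_plane(1)[OF hol _ b]) auto
  assume "Re s > 1"
  hence "summable (\<lambda>n. of_nat (Suc n) powr (- s))"
    by (intro series_half_plane(2)[OF hol _ b]) auto
  thus "(\<lambda>n. of_nat (Suc n) powr (- s)) sums zser s" unfolding zser_def by (rule summable_sums)
qed

lemma zrem_sum:
  assumes "Re s > 1"
  shows "(\<Sum>n. zrem m n s) = - 1 - (\<Sum>k\<le>m. ((1 - s) gchoose Suc k) * zser (s + of_nat k))"
proof -
  have "(\<lambda>n. of_nat (Suc n) powr (1 - s)) \<longlonglongrightarrow> 0"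
  proof (rule tendsto_norm_zero_cancel)
    have "(\<lambda>n. real (Suc n) powr (1 - Re s)) \<longlonglongrightarrow> 0"
      by (rule tendsto_neg_powr) (use assms in \<open>auto intro!: filterlim_compose[OF filterlim_real_sequentially filterlim_Suc] simp del: of_nat_Suc\<close>)
    thus "(\<lambda>n. norm (of_nat (Suc n) powr (1 - s))) \<longlonglongrightarrow> 0" unfolding norm_Suc_powr by simp
  qed
  from telescope_sums[OF this]
  have 1: "(\<lambda>n. of_nat (Suc (Suc n)) powr (1 - s) - of_nat (Suc n) powr (1 - s)) sums (- 1)"
    by simp
  have 2: "(\<lambda>n. \<Sum>k\<le>m. ((1 - s) gchoose Suc k) * of_nat (Suc n) powr (- (s + of_nat k))) sums
             (\<Sum>k\<le>m. ((1 - s) gchoose Suc k) * zser (s + of_nat k))"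
    by (intro sums_sum sums_mult zser(2)) (use assms in auto)
  have "zrem m n s = of_nat (Suc (Suc n)) powr (1 - s) - of_nat (Suc n) powr (1 - s) -
          (\<Sum>k\<le>m. ((1 - s) gchoose Suc k) * of_nat (Suc n) powr (- (s + of_nat k)))" for n
    unfolding zrem_def by (subst sum.atMost_Suc_shift) (simp add: algebra_simps del: of_nat_Suc, simp)
  thus ?thesis using sums_unique[OF sums_diff[OF 1 2]] by simp
qed

lemma zeta_step:
  "\<exists>W. W holomorphic_on {s. Re s > 1 - real m} \<and> (\<forall>s. Re s > 1 \<longrightarrow> W s = (s - 1) * zser s)"
proof (induction m)
  case 0
  show ?case by (rule exI[of _ "\<lambda>s. (s - 1) * zser s"]) (auto intro!: holomorphic_intros zser(1))
next
  case (Suc m)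
  then obtain W where W: "W holomorphic_on {s. Re s > 1 - real m}"
    "\<And>s. Re s > 1 \<Longrightarrow> W s = (s - 1) * zser s" by blast
  define V where "V s = 1 - (\<Sum>j<m. ((1 - s) gchoose Suc j) / of_nat (Suc (Suc j)) * W (s + of_nat (Suc j)))
      + (\<Sum>n. zrem m n s)" for s
  have "(\<lambda>s. W (s + of_nat (Suc j))) holomorphic_on {s. Re s > - real m}" for j
    by (rule holomorphic_on_compose_gen[OF _ W(1), unfolded o_def]) (auto intro!: holomorphic_intros)
  hence "V holomorphic_on {s. Re s > - real m}"
    unfolding V_def by (intro holomorphic_intros zrem_series(1)) (auto simp del: of_nat_Suc)
  moreover have "V s = (s - 1) * zser s" if s: "Re s > 1" for s
  proof -
    have "((1 - s) gchoose Suc j) / of_nat (Suc (Suc j)) * W (s + of_nat (Suc j)) =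
            - (((1 - s) gchoose Suc (Suc j)) * zser (s + of_nat (Suc j)))" for j
    proof -
      have "W (s + of_nat (Suc j)) = - (1 - s - of_nat (Suc j)) * zser (s + of_nat (Suc j))"
        using s by (subst W(2)) (auto simp: algebra_simps)
      thus ?thesis unfolding gchoose_Suc[of _ "Suc j"]
        by (simp add: minus_divide_left[symmetric] del: of_nat_Suc minus_diff_eq)
    qed
    hence "V s = 1 + (\<Sum>j<m. ((1 - s) gchoose Suc (Suc j)) * zser (s + of_nat (Suc j))) + (\<Sum>n. zrem m n s)"
      unfolding V_def by (simp add: sum_negf)
    also have "\<dots> = (s - 1) * zser s"
      unfolding zrem_sum[OF s] lessThan_Suc_atMost[symmetric]
      by (subst sum.lessThan_Suc_shift) (simp add: algebra_simps)
    finally show ?thesis .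
  qed
  ultimately show ?case by (intro exI[of _ V]) auto
qed

lemma zeta_continuation_exists: "\<exists>Z. is_zeta_continuation Z"
proof -
  obtain W where W: "\<And>m. W m holomorphic_on {s. Re s > 1 - real m}"
    "\<And>m s. Re s > 1 \<Longrightarrow> W m s = (s - 1) * zser s"
    using zeta_step by metis
  have eq: "W m s = W n s" if "Re s > 1 - real m" "Re s > 1 - real n" for m n s
  proof (rule analytic_continuation_open[where f = "W m" and g = "W n"
        and s = "{s. Re s > 1}" and s' = "{s. Re s > 1 - real (min m n)}"])
    show "connected {s. Re s > 1 - real (min m n)}"
      by (intro convex_connected convex_halfspace_Re_gt)
    show "{s. Re s > 1} \<noteq> {}" by (auto intro: exI[of _ 2])
    show "W m holomorphic_on {s. Re s > 1 - real (min m n)}"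
      "W n holomorphic_on {s. Re s > 1 - real (min m n)}"
      by (auto intro!: holomorphic_on_subset[OF W(1)])
  qed (use that W(2) in \<open>auto simp: open_halfspace_Re_gt min_def split: if_splits\<close>)
  define F where "F s = W (nat \<lceil>2 - Re s\<rceil>) s" for s
  have F: "F s = W n s" if "Re s > 1 - real n" for s n
    unfolding F_def by (rule eq) (use that in linarith)+
  have "F holomorphic_on (\<Union>n. {s. Re s > 1 - real n})"
  proof (rule holomorphic_on_UN_open)
    show "F holomorphic_on {s. Re s > 1 - real n}" for n
      using W(1)[of n] F by (subst holomorphic_cong[OF refl]) auto
  qed (auto simp: open_halfspace_Re_gt)
  moreover have "(\<Union>n. {s. Re s > 1 - real n}) = UNIV"
  proof -
    have "\<exists>n. Re s > 1 - real n" for s using reals_Archimedean2[of "1 - Re s"] by (auto simp: algebra_simps)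
    thus ?thesis by auto
  qed
  ultimately have hol: "F holomorphic_on UNIV" by simp
  have "is_zeta_continuation (\<lambda>s. F s / (s - 1))"
    unfolding is_zeta_continuation_def
  proof (intro conjI allI impI)
    show "(\<lambda>s. F s / (s - 1)) holomorphic_on - {1}"
      by (intro holomorphic_intros holomorphic_on_subset[OF hol]) auto
    fix s :: complex assume s: "Re s > 1"
    hence "F s / (s - 1) = zser s" using F[of 0 s] W(2)[of s 0] by auto
    thus "(\<lambda>n. of_nat (Suc n) powr (- s)) sums (F s / (s - 1))" using zser(2)[OF s] by simp
  qed
  thus ?thesis by blast
qed

lemma riemann_zeta: "is_zeta_continuation riemann_zeta"
  unfolding riemann_zeta_def by (rule someI_ex[OF zeta_continuation_exists])

end

theory Submission
  imports Defs "HOL-Number_Theory.Prime_Powers" "HOL-Real_Asymp.Real_Asymp"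
begin

text \<open>
  Write \<open>g = \<Lambda>'/\<Lambda>\<close>.  The functional equation and the absence of zeros to the right of the critical
  line give, by Phragmen--Lindeloef for \<open>\<Lambda>(s) / \<Lambda>(s + h)\<close> in a strip, \<open>Re g \<ge> 0\<close> for \<open>Re s > 1/2\<close>.
  This positivity replaces the Hadamard product: Schwarz--Pick bounds \<open>g\<close> and shows that
  \<open>Re (g \<sigma>) / (\<sigma> - 1/2)\<close> decreases in \<open>\<sigma>\<close>, while a Poisson integral bounds the contribution of the zeros to the
  explicit formula for \<open>(\<Sum>n\<le>x. \<Lambda>\<^sub>f(n) n\<^sup>-\<^sup>\<sigma> log (x/n))\<close> by \<open>x powr (1/2 - \<sigma>) Re (g \<sigma>) / (\<sigma> - 1/2)\<close>.

  As in Chandee's work on central values, one integrates this formula over \<open>\<sigma> \<ge> 1/2 + \<lambda> / log x\<close> and passes from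
  there to \<open>1/2\<close> by monotonicity; if \<open>exp (- \<lambda>) \<le> \<lambda> + \<lambda>\<^sup>2 / 2\<close>, the terms with \<open>Re g\<close> may be dropped.  The prime
  sum is estimated with Chebyshev's bound \<open>\<psi>(n) \<le> 1.11 n + 3 sqrt n - 4\<close>, and the final choice is
  \<open>\<lambda> = 0.4915\<close>, \<open>x = exp (- 1.517) (log C)\<^sup>2\<close>.
\<close>

section \<open>Integrals over vertical lines\<close>

text \<open>The zeros enter only through Re g \<ge> 0: what a sum over zeros would supply is
  replaced by statements true of every holomorphic function with nonnegative real part on a
  half-plane. The delicate point is the denominator of the quotient in the maximum principle, which
  must be bounded below in the strip. A Harnack argument carries such a bound from the far right,
  with an exponent quadratic in Im s, and the maximum principle is built to admit this growth.
  Growth along vertical lines is measured by (1 + |w|)^(1/2), which Hoelder continuity of the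
  digamma function provides with explicit constants; against the kernel 1 / w^2 it leaves the
  exponent -3/2 of \<open>decay\<close>. As for the constants, the leading term is (1 + \<lambda>)
  log C / (2 log x), and the prime sum has order d sqrt x / (log x)^2. With x a multiple of (log
  C)^2 the former has coefficient (1 + \<lambda>) / 4, about 0.373, below 3/8, and the latter joins
  the second-order term. The factor exp (-1.517) splits 23/25 into 0.576 for the prime sum, 0.285
  for the leading term and 0.059 for the rest.\<close>

definition decay :: "real \<Rightarrow> real" where
  "decay t = (1 + \<bar>t\<bar>) powr (- (3 / 2))"

lemma decay_nonneg [simp]: "decay t \<ge> 0" by (simp add: decay_def)

lemma decay_measurable [measurable]: "decay \<in> borel_measurable borel"
  unfolding decay_def by measurable

lemma has_bochner_integral_decay: "has_bochner_integral lborel decay 4"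
proof (rule has_bochner_integral_nn_integral)
  define f :: "real \<Rightarrow> real" where "f x = (1 + x) powr (- (3 / 2))" for x
  have fm: "f \<in> borel_measurable borel" unfolding f_def by measurable
  have *: "(\<integral>\<^sup>+x. ennreal (f x) * indicator {0 ..} x \<partial>lborel) = ennreal 2"
  proof -
    have "((\<lambda>x::real. - 2 * (1 + x) powr (- (1 / 2))) \<longlongrightarrow> - 2 * 0) at_top"
      by (intro tendsto_mult tendsto_const tendsto_neg_powr filterlim_tendsto_add_at_top filterlim_ident) auto
    hence "(\<integral>\<^sup>+x. ennreal (f x) * indicator {0 ..} x \<partial>lborel) = ennreal (0 - (- 2 * (1 + 0) powr (- (1 / 2))))"
      by (intro nn_integral_FTC_atLeast fm) (auto simp: f_def intro!: derivative_eq_intros)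
    thus ?thesis by simp
  qed
  have "(\<integral>\<^sup>+x. ennreal (decay x) \<partial>lborel) =
      (\<integral>\<^sup>+x. ennreal (f x) * indicator {0 ..} x + ennreal (f (- x)) * indicator {0 ..} (- x) \<partial>lborel)"
  proof (rule nn_integral_cong_AE)
    have "AE x in lborel. x \<noteq> (0::real)" by (rule AE_lborel_singleton)
    thus "AE x in lborel. ennreal (decay x) = ennreal (f x) * indicator {0 ..} x + ennreal (f (- x)) * indicator {0 ..} (- x)"
      by (rule AE_mp) (auto simp: decay_def f_def indicator_def)
  qed
  also have "\<dots> = (\<integral>\<^sup>+x. ennreal (f x) * indicator {0 ..} x \<partial>lborel) + (\<integral>\<^sup>+x. ennreal (f (- x)) * indicator {0 ..} (- x) \<partial>lborel)"
    using fm by (intro nn_integral_add) auto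
  also have "(\<integral>\<^sup>+x. ennreal (f (- x)) * indicator {0 ..} (- x) \<partial>lborel) = (\<integral>\<^sup>+x. ennreal (f x) * indicator {0 ..} x \<partial>lborel)"
    using fm by (subst nn_integral_real_affine[where c = "-1" and t = 0]) auto
  finally show "(\<integral>\<^sup>+x. ennreal (decay x) \<partial>lborel) = ennreal 4"
    unfolding * by (simp flip: ennreal_plus)
qed auto

lemma integrable_decay: "integrable lborel decay"
  using has_bochner_integral_decay by (simp add: has_bochner_integral_iff)

lemma integral_decay: "integral\<^sup>L lborel decay = 4"
  using has_bochner_integral_decay by (simp add: has_bochner_integral_iff)

text \<open>Integration is in the ordinate: the contour integral is \<open>\<i>\<close> times this,
  so residues below carry the factor 2 pi rather than 2 pi i.\<close>

definition vint :: "(complex \<Rightarrow> complex) \<Rightarrow> real \<Rightarrow> complex" where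
  "vint f c = (LINT t|lborel. f (Complex c t))"

lemma continuous_on_Complex_line [continuous_intros]: "continuous_on A (Complex c)"
proof -
  have "Complex c = (\<lambda>t. of_real c + of_real t * \<i>)" by (auto simp: complex_eq_iff)
  thus ?thesis by (auto intro!: continuous_intros)
qed

lemma vline_integrable:
  fixes f :: "complex \<Rightarrow> complex"
  assumes "continuous_on {u. Re u = c} f" "\<And>t. norm (f (Complex c t)) \<le> M * decay t"
  shows "integrable lborel (\<lambda>t. f (Complex c t))"
proof (rule Bochner_Integration.integrable_bound)
  show "integrable lborel (\<lambda>t. M * decay t)" using integrable_decay by simp
  have "continuous_on UNIV (\<lambda>t. f (Complex c t))"
    by (rule continuous_on_compose2[OF assms(1)]) (auto intro!: continuous_intros)
  thus "(\<lambda>t. f (Complex c t)) \<in> borel_measurable lborel"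
    by (simp add: borel_measurable_continuous_onI)
  show "AE t in lborel. norm (f (Complex c t)) \<le> norm (M * decay t)"
    using assms(2) by (auto intro!: AE_I2 order.trans[OF assms(2)])
qed

lemma norm_vint_le:
  assumes "integrable lborel (\<lambda>t. f (Complex c t))" "\<And>t. norm (f (Complex c t)) \<le> M * decay t"
  shows "norm (vint f c) \<le> 4 * M"
proof -
  have "norm (vint f c) \<le> (LINT t|lborel. M * decay t)"
    unfolding vint_def using assms integrable_decay
    by (intro order.trans[OF integral_norm_bound] integral_mono) auto
  thus ?thesis by (simp add: integral_decay)
qed

lemma linepath_vertical:
  assumes cont: "continuous_on {u. Re u = c} f" and "T > 0"
  shows "contour_integral (linepath (Complex c (- T)) (Complex c T)) f =
           \<i> * (LINT t|lborel. indicator {- T..T} t *\<^sub>R f (Complex c t))"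
proof -
  have c: "continuous_on {- T..T} (\<lambda>t. f (Complex c t))"
    by (rule continuous_on_compose2[OF cont]) (auto intro!: continuous_intros)
  have "((\<lambda>t. f (Complex c t)) has_integral (LINT t|lborel. indicator {- T..T} t *\<^sub>R f (Complex c t))) {- T..T}"
    using has_integral_set_lebesgue[of "{-T..T}" "\<lambda>t. f (Complex c t)"] 
    using set_borel_integral_eq_integral[of "{-T..T}" "\<lambda>t. f (Complex c t)"]
      borel_integrable_atLeastAtMost'[OF c] integrable_continuous_interval[OF c]
    by (metis integrable_integral set_lebesgue_integral_def)
  hence "(f has_contour_integral \<i> * (LINT t|lborel. indicator {- T..T} t *\<^sub>R f (Complex c t))) 
       (linepath (Complex c (- T)) (Complex c T))"
    using \<open>T > 0\<close> by (subst has_contour_integral_linepath_same_Re_iff[where c = c and a = "-T" and b = T])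
       (auto simp: mult.assoc[symmetric])
  thus ?thesis by (rule contour_integral_unique)
qed

lemma truncated_integral_limit:
  assumes "integrable lborel (h :: real \<Rightarrow> complex)"
  shows "(\<lambda>n. LINT t|lborel. indicator {- real n..real n} t *\<^sub>R h t) \<longlonglongrightarrow> integral\<^sup>L lborel h"
proof (rule integral_dominated_convergence[where w = "\<lambda>t. norm (h t)"])
  show "AE x in lborel. (\<lambda>n. indicator {- real n..real n} x *\<^sub>R h x) \<longlonglongrightarrow> h x"
  proof (intro AE_I2 tendsto_eventually)
    fix x
    obtain N where N: "\<bar>x\<bar> \<le> real N" using real_arch_simple by blast
    show "\<forall>\<^sub>F n in sequentially. indicator {- real n..real n} x *\<^sub>R h x = h x"
      using eventually_ge_at_top[of N]
      by eventually_elim (use N in \<open>auto simp: indicator_def\<close>)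
  qed
qed (use assms in \<open>auto simp: indicator_def\<close>)

text \<open>The residue theorem for rectangles of height 2 T: the horizontal sides are at most
  \<open>(b - a) * (M * decay T)\<close> and disappear as T grows. The bound on \<open>f\<close> is
  asked for only at distance \<open>r\<close> from the singularity, and \<open>r\<close> also keeps
  both vertical lines off it.\<close>

lemma vline_shift:
  assumes S: "open S" "convex S" "{u. a \<le> Re u \<and> Re u \<le> b} \<subseteq> S"
    and hol: "f holomorphic_on S - {z0}"
    and r: "r > 0" "r \<le> Re z0 - a" "r \<le> b - Re z0"
    and bound: "\<And>u. a \<le> Re u \<Longrightarrow> Re u \<le> b \<Longrightarrow> norm (u - z0) \<ge> r \<Longrightarrow> norm (f u) \<le> M * decay (Im u)"
  shows "integrable lborel (\<lambda>t. f (Complex a t))" "integrable lborel (\<lambda>t. f (Complex b t))"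
    "vint f b - vint f a = 2 * pi * residue f z0"
proof -
  have dist: "norm (u - z0) \<ge> r" if "Re u = a \<or> Re u = b" for u
    using abs_Re_le_cmod[of "u - z0"] that r by auto
  have ab: "a < b" using r by linarith
  have cont: "continuous_on {u. Re u = a} f" "continuous_on {u. Re u = b} f"
    using S ab r by (auto intro!: continuous_on_subset[OF holomorphic_on_imp_continuous_on[OF hol]])
  have ba: "norm (f (Complex a t)) \<le> M * decay t" for t
    using bound[of "Complex a t"] dist[of "Complex a t"] ab by simp
  have bb: "norm (f (Complex b t)) \<le> M * decay t" for t
    using bound[of "Complex b t"] dist[of "Complex b t"] ab by simp
  show int: "integrable lborel (\<lambda>t. f (Complex a t))" "integrable lborel (\<lambda>t. f (Complex b t))"
    using vline_integrable[OF cont(1) ba] vline_integrable[OF cont(2) bb] by auto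
  define I where "I c T = (LINT t|lborel. indicator {- T..T} t *\<^sub>R f (Complex c t))" for c T
  define H where "H t = contour_integral (linepath (Complex a t) (Complex b t)) f" for t
  have H: "norm (H t) \<le> (b - a) * (M * decay t)" and
    Hc: "f contour_integrable_on linepath (Complex a t) (Complex b t)"
    if t: "\<bar>t\<bar> \<ge> \<bar>Im z0\<bar> + r" for t
  proof -
    have seg: "Re u \<in> {a..b} \<and> Im u = t" if "u \<in> closed_segment (Complex a t) (Complex b t)" for u
      using that ab by (auto simp: closed_segment_same_Im closed_segment_eq_real_ivl)
    have far: "norm (u - z0) \<ge> r" if "Im u = t" for u
      using abs_Im_le_cmod[of "u - z0"] that t by (auto simp: abs_le_iff)
    have sub: "closed_segment (Complex a t) (Complex b t) \<subseteq> S - {z0}"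
      using seg S(3) far r(1) by fastforce
    show c: "f contour_integrable_on linepath (Complex a t) (Complex b t)"
      by (intro contour_integrable_continuous_linepath continuous_on_subset[OF holomorphic_on_imp_continuous_on[OF hol] sub])
    have M: "M * decay t \<ge> 0"
      using order_trans[OF norm_ge_zero bound[of "Complex a t"]] ab far[of "Complex a t"] by simp
    have "norm (H t) \<le> M * decay t * norm (Complex b t - Complex a t)"
      unfolding H_def
      by (rule contour_integral_bound_linepath[OF c M]) (use bound seg far in fastforce)
    also have "Complex b t - Complex a t = of_real (b - a)" by (simp add: complex_eq_iff)
    also have "norm \<dots> = b - a" using ab by (simp del: of_real_diff)
    finally show "norm (H t) \<le> (b - a) * (M * decay t)" by (simp add: mult_ac)
  qed
  have rect: "H (- T) + \<i> * I b T - H T - \<i> * I a T = 2 * pi * \<i> * residue f z0"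
    if T: "T > \<bar>Im z0\<bar> + r" for T
  proof -
    let ?a = "Complex a (- T)" and ?c = "Complex b T"
    have T0: "T > 0" using T r by linarith
    have le: "Re ?a \<le> Re ?c" "Im ?a \<le> Im ?c" using ab T0 by auto
    have z0: "z0 \<in> box ?a ?c" using r T by (auto simp: in_box_complex_iff abs_if split: if_splits)
    have sub: "cbox ?a ?c \<subseteq> S" using S(3) by (auto simp: in_cbox_complex_iff)
    have "contour_integral (rectpath ?a ?c) f = 2 * pi * \<i> * (\<Sum>p\<in>{z0}. winding_number (rectpath ?a ?c) p * residue f p)"
    proof (rule Residue_theorem[OF S(1) convex_connected[OF S(2)] _ hol])
      show "path_image (rectpath ?a ?c) \<subseteq> S - {z0}"
        using path_image_rectpath_subset_cbox[OF le] sub path_image_rectpath_inter_box[OF le] z0 by blast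
      show "\<forall>z. z \<notin> S \<longrightarrow> winding_number (rectpath ?a ?c) z = 0"
        using winding_number_rectpath_outside[OF le] sub by blast
    qed auto
    also have "\<dots> = 2 * pi * \<i> * residue f z0"
      by (simp add: winding_number_rectpath[OF z0])
    finally have 1: "contour_integral (rectpath ?a ?c) f = 2 * pi * \<i> * residue f z0" .
    have ci: "f contour_integrable_on linepath (Complex c t) (Complex c t')" if "c = a \<or> c = b" for c t t'
    proof (intro contour_integrable_continuous_linepath)
      have "closed_segment (Complex c t) (Complex c t') \<subseteq> {u. Re u = c}"
        by (auto simp: closed_segment_same_Re)
      thus "continuous_on (closed_segment (Complex c t) (Complex c t')) f"
        using cont that by (auto intro: continuous_on_subset)
    qed
    have rev: "f contour_integrable_on linepath q p \<and>
         contour_integral (linepath q p) f = - contour_integral (linepath p q) f"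
      if "f contour_integrable_on linepath p q" for p q
      using that contour_integrable_reversepath[OF valid_path_linepath that]
        contour_integral_reversepath[OF valid_path_linepath, of p q f]
      unfolding reversepath_linepath by auto
    have Hci: "f contour_integrable_on linepath (Complex a T) (Complex b T)"
         "f contour_integrable_on linepath (Complex a (-T)) (Complex b (-T))"
      using Hc[of T] Hc[of "-T"] T T0 by auto
    have c: "(f has_contour_integral H (- T)) (linepath (Complex a (-T)) (Complex b (-T)))"
        "(f has_contour_integral \<i> * I b T) (linepath (Complex b (-T)) (Complex b T))"
        "(f has_contour_integral (- H T)) (linepath (Complex b T) (Complex a T))"
        "(f has_contour_integral (- (\<i> * I a T))) (linepath (Complex a T) (Complex a (- T)))"
      using Hci ci[of b "- T" T] rev[OF Hci(1)] rev[OF ci[of a "- T" T]]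
      unfolding H_def I_def linepath_vertical[OF cont(1) T0, symmetric]
        linepath_vertical[OF cont(2) T0, symmetric]
      by (metis has_contour_integral_integral)+
    have "(f has_contour_integral H (- T) + (\<i> * I b T + (- H T + - (\<i> * I a T)))) (rectpath ?a ?c)"
      unfolding rectpath_def Let_def complex.sel
      by (intro has_contour_integral_join c valid_path_join valid_path_linepath) auto
    from contour_integral_unique[OF this] show ?thesis using 1 by simp
  qed
  have decay0: "(\<lambda>n. (b - a) * (M * decay (real n))) \<longlonglongrightarrow> (b - a) * (M * 0)"
  proof (intro tendsto_mult tendsto_const)
    have "(\<lambda>n. (1 + real n) powr (- (3 / 2))) \<longlonglongrightarrow> 0"
      by (intro tendsto_neg_powr filterlim_tendsto_add_at_top[OF tendsto_const] filterlim_real_sequentially) auto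
    thus "(\<lambda>n. decay (real n)) \<longlonglongrightarrow> 0" by (simp add: decay_def)
  qed
  have ev: "\<forall>\<^sub>F n in sequentially. real n > \<bar>Im z0\<bar> + r"
    using filterlim_real_sequentially by (simp add: filterlim_at_top_dense)
  have Hlim: "(\<lambda>n. H (real n)) \<longlonglongrightarrow> 0" "(\<lambda>n. H (- real n)) \<longlonglongrightarrow> 0"
  proof -
    show "(\<lambda>n. H (real n)) \<longlonglongrightarrow> 0"
      by (rule Lim_null_comparison[OF eventually_mono[OF ev]]) (use decay0 H in auto)
    show "(\<lambda>n. H (- real n)) \<longlonglongrightarrow> 0"
      by (rule Lim_null_comparison[OF eventually_mono[OF ev]])
         (use decay0 H[of "- real n" for n] in \<open>auto simp: decay_def\<close>)
  qed
  have "(\<lambda>n. H (- real n) + \<i> * I b n - H n - \<i> * I a n) \<longlonglongrightarrow> 0 + \<i> * vint f b - 0 - \<i> * vint f a"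
    unfolding I_def vint_def by (intro tendsto_intros Hlim truncated_integral_limit int)
  moreover have "(\<lambda>n. H (- real n) + \<i> * I b n - H n - \<i> * I a n) \<longlonglongrightarrow> 2 * pi * \<i> * residue f z0"
    by (rule tendsto_eventually, rule eventually_mono[OF ev]) (use rect in auto)
  ultimately have "0 + \<i> * vint f b - 0 - \<i> * vint f a = 2 * pi * \<i> * residue f z0"
    by (rule LIMSEQ_unique)
  hence "\<i> * (vint f b - vint f a) = \<i> * (2 * pi * residue f z0)" by (simp add: right_diff_distrib)
  thus "vint f b - vint f a = 2 * pi * residue f z0" by simp
qed

text \<open>With decay in |u - a|, not just in Im u, the line can be pushed to +infinity: on Re u =
  n the integrand tends to 0 pointwise and is dominated by \<open>M * decay t\<close>. The sign is
  negative because the singularity lies to the right of the line.\<close>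

lemma vline_right:
  assumes a: "\<alpha> < a" and hol: "f holomorphic_on {u. Re u > \<alpha>} - {z0}"
    and r: "r > 0" "r \<le> Re z0 - a"
    and bound: "\<And>u. a \<le> Re u \<Longrightarrow> norm (u - z0) \<ge> r \<Longrightarrow>
                  norm (f u) \<le> M * (1 + norm (u - of_real a)) powr (- (3 / 2))"
  shows "integrable lborel (\<lambda>t. f (Complex a t))" "vint f a = - 2 * pi * residue f z0"
proof -
  have M: "M \<ge> 0"
  proof -
    have "r \<le> norm (of_real a - z0)" using abs_Re_le_cmod[of "of_real a - z0"] r by simp
    thus ?thesis using order_trans[OF norm_ge_zero bound[of "of_real a"]] by (simp add: zero_le_mult_iff)
  qed
  have le: "M * (1 + norm (u - of_real a)) powr (- (3 / 2)) \<le> M * decay (Im u)" for u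
    unfolding decay_def using abs_Im_le_cmod[of "u - of_real a"] M
    by (intro mult_left_mono powr_mono2') auto
  have sh: "integrable lborel (\<lambda>t. f (Complex a t))" "integrable lborel (\<lambda>t. f (Complex b t))"
      "vint f b - vint f a = 2 * pi * residue f z0" if b: "b \<ge> Re z0 + r" for b
    by (rule vline_shift[where S = "{u. Re u > \<alpha>}" and r = r and a = a and b = b and M = M]; 
       use a hol r b order_trans[OF bound le] in
          \<open>auto simp: open_halfspace_Re_gt convex_halfspace_Re_gt\<close>)+
  show "integrable lborel (\<lambda>t. f (Complex a t))" using sh by blast
  define B where "B = nat \<lceil>Re z0 + r\<rceil>"
  have B: "real n \<ge> Re z0 + r" if "n \<ge> B" for n using that unfolding B_def by linarith
  have "(\<lambda>n. vint f (real (n + B))) \<longlonglongrightarrow> (LINT (t::real)|lborel. (0::complex))"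
    unfolding vint_def
  proof (rule integral_dominated_convergence[where w = "\<lambda>t. M * decay t"])
    have far: "norm (Complex (real (n + B)) t - z0) \<ge> r" for n t
      using abs_Re_le_cmod[of "Complex (real (n + B)) t - z0"] B[of "n + B"] by auto
    have ge: "a \<le> real (n + B)" for n using B[of "n + B"] r by auto
    show "(\<lambda>t. f (Complex (real (n + B)) t)) \<in> borel_measurable lborel" for n
      using sh(2)[of "real (n + B)"] B[of "n + B"] by (auto intro: borel_measurable_integrable)
    show "integrable lborel (\<lambda>t. M * decay t)" using integrable_decay by simp
    show "(\<lambda>t::real. 0::complex) \<in> borel_measurable lborel" by simp
    show "AE t in lborel. norm (f (Complex (real (n + B)) t)) \<le> M * decay t" for n
      using order_trans[OF bound le, of "Complex (real (n + B)) _"] far ge by auto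
    show "AE t in lborel. (\<lambda>n. f (Complex (real (n + B)) t)) \<longlonglongrightarrow> 0"
    proof (rule AE_I2)
      fix t
      have "(\<lambda>n. M * (1 + (real (n + B) - a)) powr (- (3 / 2))) \<longlonglongrightarrow> M * 0"
      proof (intro tendsto_mult tendsto_const tendsto_neg_powr)
        have "filterlim (\<lambda>n. (1 - a + real B) + real n) at_top sequentially"
          by (intro filterlim_tendsto_add_at_top[OF tendsto_const] filterlim_real_sequentially)
        thus "filterlim (\<lambda>n. 1 + (real (n + B) - a)) at_top sequentially" by (simp add: algebra_simps)
      qed auto
      moreover have "norm (f (Complex (real (n + B)) t)) \<le> M * (1 + (real (n + B) - a)) powr (- (3 / 2))" for n
      proof -
        have "norm (f (Complex (real (n + B)) t)) \<le> M * (1 + norm (Complex (real (n + B)) t - of_real a)) powr (- (3 / 2))"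
          using bound[of "Complex (real (n + B)) t"] far ge by auto
        also have "\<dots> \<le> M * (1 + (real (n + B) - a)) powr (- (3 / 2))"
          using abs_Re_le_cmod[of "Complex (real (n + B)) t - of_real a"] ge[of n] M
          by (intro mult_left_mono powr_mono2') auto
        finally show ?thesis .
      qed
      ultimately show "(\<lambda>n. f (Complex (real (n + B)) t)) \<longlonglongrightarrow> 0"
        unfolding mult_zero_right by (rule Lim_null_comparison[OF always_eventually[OF allI], rotated])
    qed
  qed
  moreover have "vint f (real (n + B)) = vint f a + 2 * pi * residue f z0" for n
    using sh(3)[of "real (n + B)"] B[of "n + B"] by (simp add: diff_eq_eq add.commute)
  ultimately have "(\<lambda>n::nat. vint f a + 2 * pi * residue f z0) \<longlonglongrightarrow> 0" by simp
  hence "vint f a + 2 * pi * residue f z0 = 0" by (rule LIMSEQ_unique[OF tendsto_const])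
  thus "vint f a = - 2 * pi * residue f z0" by (simp add: eq_neg_iff_add_eq_0)
qed

lemma kernel_bound:
  fixes w :: complex
  assumes "r > 0" "norm w \<ge> r"
  shows "(1 + norm w) powr (1 / 2) / norm w ^ 2 \<le> ((1 + r) / r)\<^sup>2 * (1 + norm w) powr (- (3 / 2))"
proof -
  have w: "norm w > 0" using assms by linarith
  have "1 + norm w \<le> (1 + r) / r * norm w" using assms by (simp add: field_simps)
  hence "(1 + norm w)\<^sup>2 \<le> ((1 + r) / r * norm w)\<^sup>2" by (intro power_mono) auto
  hence le: "(1 + norm w)\<^sup>2 / norm w ^ 2 \<le> ((1 + r) / r)\<^sup>2"
    using w by (simp only: power_mult_distrib pos_divide_le_eq zero_less_power)
  have "(1 + norm w) powr (1 / 2) = (1 + norm w)\<^sup>2 * (1 + norm w) powr (- (3 / 2))"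
    using w by (simp add: powr_add[symmetric] flip: powr_numeral)
  hence "(1 + norm w) powr (1 / 2) / norm w ^ 2 = (1 + norm w)\<^sup>2 / norm w ^ 2 * (1 + norm w) powr (- (3 / 2))"
    by simp
  also have "\<dots> \<le> ((1 + r) / r)\<^sup>2 * (1 + norm w) powr (- (3 / 2))"
    by (intro mult_right_mono le) auto
  finally show ?thesis .
qed

text \<open>At the double pole 0 the residue is the derivative of
  \<open>G w * exp (of_real y * w)\<close>, whence the two terms. The radius \<open>r\<close> is the
  distance of 0 from the nearer of the two lines.\<close>

lemma perron_shift:
  fixes G :: "complex \<Rightarrow> complex" and y :: real
  assumes ac: "\<alpha> < a" "a < 0" "0 < c"
    and G: "G holomorphic_on {w. Re w > \<alpha>}"
    and M: "\<And>w. a \<le> Re w \<Longrightarrow> Re w \<le> c \<Longrightarrow> norm (G w) \<le> M * (1 + norm w) powr (1 / 2)"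
  defines "f \<equiv> \<lambda>w. G w * exp (of_real y * w) / w\<^sup>2"
  shows "integrable lborel (\<lambda>t. f (Complex a t))" "integrable lborel (\<lambda>t. f (Complex c t))"
    "vint f c - vint f a = 2 * pi * (deriv G 0 + y * G 0)"
proof -
  define r where "r = min (- a) c"
  have r: "r > 0" "r \<le> - a" "r \<le> c" using ac by (auto simp: r_def)
  define K where "K = M * exp (\<bar>y\<bar> * (c - a)) * ((1 + r) / r)\<^sup>2"
  have M0: "M \<ge> 0" using order_trans[OF norm_ge_zero M[of 0]] ac by simp
  have bound: "norm (f w) \<le> K * decay (Im w)" if w: "a \<le> Re w" "Re w \<le> c" "norm (w - 0) \<ge> r" for w
  proof -
    have "norm (exp (of_real y * w)) = exp (y * Re w)" by simp
    also have "y * Re w \<le> \<bar>y\<bar> * \<bar>Re w\<bar>" by (metis abs_ge_self abs_mult)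
    also have "\<dots> \<le> \<bar>y\<bar> * (c - a)" using w ac by (intro mult_left_mono) auto
    finally have e: "norm (exp (of_real y * w)) \<le> exp (\<bar>y\<bar> * (c - a))" by simp
    have "norm (f w) = norm (G w) * norm (exp (of_real y * w)) / norm w ^ 2"
      by (simp add: f_def norm_mult norm_divide norm_power)
    also have "\<dots> \<le> (M * (1 + norm w) powr (1 / 2)) * exp (\<bar>y\<bar> * (c - a)) / norm w ^ 2"
      using M0 by (intro divide_right_mono mult_mono M e w) auto
    also have "\<dots> = M * exp (\<bar>y\<bar> * (c - a)) * ((1 + norm w) powr (1 / 2) / norm w ^ 2)" by simp
    also have "\<dots> \<le> M * exp (\<bar>y\<bar> * (c - a)) * (((1 + r) / r)\<^sup>2 * (1 + norm w) powr (- (3 / 2)))"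
      using kernel_bound[OF r(1), of w] w M0 by (intro mult_left_mono) auto
    also have "\<dots> = K * (1 + norm w) powr (- (3 / 2))" by (simp add: K_def)
    also have "\<dots> \<le> K * decay (Im w)"
      unfolding decay_def K_def using M0 abs_Im_le_cmod[of w]
      by (intro mult_left_mono powr_mono2') auto
    finally show ?thesis .
  qed
  have hol: "f holomorphic_on {w. Re w > \<alpha>} - {0}"
    unfolding f_def by (intro holomorphic_intros holomorphic_on_subset[OF G]) auto
  note * = vline_shift[where S = "{w. Re w > \<alpha>}" and r = r and ?z0.0 = 0 and a = a and b = c and f = f and M = K,
      OF open_halfspace_Re_gt convex_halfspace_Re_gt _ hol r(1) _ _ bound]
  show "integrable lborel (\<lambda>t. f (Complex a t))" "integrable lborel (\<lambda>t. f (Complex c t))"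
    by (rule *; use ac r in auto)+
  have res: "residue f 0 = deriv G 0 + y * G 0"
  proof -
    have hF: "(\<lambda>w. G w * exp (of_real y * w)) holomorphic_on {w. Re w > \<alpha>}"
      by (intro holomorphic_intros G)
    have "residue (\<lambda>w. (\<lambda>w. G w * exp (of_real y * w)) w / w ^ Suc 1) 0 =
        (deriv ^^ 1) (\<lambda>w. G w * exp (of_real y * w)) 0 / fact 1"
      by (rule residue_holomorphic_over_power'[OF open_halfspace_Re_gt _ hF]) (use ac in auto)
    also have "(deriv ^^ 1) (\<lambda>w. G w * exp (of_real y * w)) 0 = deriv G 0 + y * G 0"
    proof -
      have "(G has_field_derivative deriv G 0) (at 0)"
        using holomorphic_derivI[OF G open_halfspace_Re_gt] ac by auto
      hence "((\<lambda>w. G w * exp (of_real y * w)) has_field_derivative (deriv G 0 + y * G 0)) (at 0)"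
        by (auto intro!: derivative_eq_intros)
      thus ?thesis by (simp add: DERIV_imp_deriv)
    qed
    finally show ?thesis by (simp add: f_def numeral_2_eq_2)
  qed
  show "vint f c - vint f a = 2 * pi * (deriv G 0 + y * G 0)"
    unfolding res[symmetric] by (rule *; use ac r in auto)
qed

text \<open>For y \<le> 0 the exponential is at most 1 to the right of the line, so the line can be
  moved to +infinity, and no pole is met.\<close>

lemma vint_right_zero:
  fixes G :: "complex \<Rightarrow> complex" and y :: real
  assumes a: "0 \<le> \<alpha>" "\<alpha> < a" and G: "G holomorphic_on {w. Re w > \<alpha>}"
    and M: "\<And>w. a \<le> Re w \<Longrightarrow> norm (G w) \<le> M * (1 + norm w) powr (1 / 2)"
    and y: "y \<le> 0"
  defines "f \<equiv> \<lambda>w. G w * exp (of_real y * w) / w\<^sup>2"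
  shows "integrable lborel (\<lambda>t. f (Complex a t))" "vint f a = 0"
proof -
  have a0: "a > 0" using a by linarith
  have M0: "M \<ge> 0" using order_trans[OF norm_ge_zero M[of "of_real a"]] a0 
    by (simp add: zero_le_mult_iff)
  define K where "K = M * ((1 + a) / a)\<^sup>2 * (1 + a) powr (3 / 2)"
  have bound: "norm (f w) \<le> K * (1 + norm (w - of_real a)) powr (- (3 / 2))" if w: "a \<le> Re w" for w
  proof -
    have na: "norm w \<ge> a" using w abs_Re_le_cmod[of w] by linarith
    have "y * Re w \<le> 0" using y w a0 by (simp add: mult_nonpos_nonneg)
    hence e: "norm (exp (of_real y * w)) \<le> 1" by simp
    have "norm (f w) = norm (G w) * norm (exp (of_real y * w)) / norm w ^ 2"
      by (simp add: f_def norm_mult norm_divide norm_power)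
    also have "\<dots> \<le> (M * (1 + norm w) powr (1 / 2)) * 1 / norm w ^ 2"
      using M0 by (intro divide_right_mono mult_mono M e w) auto
    also have "\<dots> = M * ((1 + norm w) powr (1 / 2) / norm w ^ 2)" by simp
    also have "\<dots> \<le> M * (((1 + a) / a)\<^sup>2 * (1 + norm w) powr (- (3 / 2)))"
      using kernel_bound[OF a0 na] M0 by (intro mult_left_mono) auto
    also have "\<dots> \<le> M * (((1 + a) / a)\<^sup>2 * ((1 + a) powr (3 / 2) * (1 + norm (w - of_real a)) powr (- (3 / 2))))"
    proof (intro mult_left_mono)
      have "1 + norm (w - of_real a) \<le> (1 + a) * (1 + norm w)"
        using norm_triangle_ineq4[of w "of_real a"] a0 by (simp add: algebra_simps) (smt (verit) mult_nonneg_nonneg norm_ge_zero)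
      hence "((1 + a) * (1 + norm w)) powr (- (3 / 2)) \<le> (1 + norm (w - of_real a)) powr (- (3 / 2))"
        by (intro powr_mono2') (auto intro: add_pos_nonneg)
      hence "(1 + a) powr (3 / 2) * ((1 + a) * (1 + norm w)) powr (- (3 / 2)) \<le> (1 + a) powr (3 / 2) * (1 + norm (w - of_real a)) powr (- (3 / 2))"
        by (intro mult_left_mono) auto
      moreover have "(1 + a) powr (3 / 2) * ((1 + a) * (1 + norm w)) powr (- (3 / 2)) = (1 + norm w) powr (- (3 / 2))"
      proof -
        have "(1 + a) powr (3 / 2) * (1 + a) powr (- (3 / 2)) = 1" using a0 by (simp add: powr_add[symmetric])
        thus ?thesis using a0 by (simp add: powr_mult mult.assoc[symmetric])
      qed
      ultimately show "(1 + norm w) powr (- (3 / 2)) \<le> (1 + a) powr (3 / 2) * (1 + norm (w - of_real a)) powr (- (3 / 2))"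
        by simp
    qed (use M0 in auto)
    finally show ?thesis by (simp add: K_def mult_ac)
  qed
  have hol: "f holomorphic_on {w. Re w > \<alpha>}"
    unfolding f_def using a by (intro holomorphic_intros G) auto
  \<comment> \<open>\<open>vline_right\<close> speaks of a singularity; an arbitrary regular point
    to the right of the line, with residue 0, serves as one.\<close>
  have res: "residue f (of_real (a + 1)) = 0"
    by (rule residue_holo[OF open_halfspace_Re_gt _ hol]) (use a in auto)
  have *: "integrable lborel (\<lambda>t. f (Complex a t))" "vint f a = - 2 * pi * residue f (of_real (a + 1))"
    by (rule vline_right[where r = 1 and M = K and ?z0.0 = "of_real (a + 1)", OF a(2) holomorphic_on_subset[OF hol]]; use bound in auto)+
  thus "integrable lborel (\<lambda>t. f (Complex a t))" "vint f a = 0" unfolding res by auto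
qed

text \<open>The image of \<open>vint_right_zero\<close> under w to -w, which reverses the sign of
  y.\<close>

lemma vint_left_zero:
  fixes G :: "complex \<Rightarrow> complex" and y :: real
  assumes a: "0 \<le> \<alpha>" "\<alpha> < a" and G: "G holomorphic_on {w. Re w < - \<alpha>}"
    and M: "\<And>w. Re w \<le> - a \<Longrightarrow> norm (G w) \<le> M * (1 + norm w) powr (1 / 2)"
    and y: "y \<ge> 0"
  defines "f \<equiv> \<lambda>w. G w * exp (of_real y * w) / w\<^sup>2"
  shows "integrable lborel (\<lambda>t. f (Complex (- a) t))" "vint f (- a) = 0"
proof -
  define F where "F = (\<lambda>w. G (- w) * exp (of_real (- y) * w) / w\<^sup>2)"
  have hG: "(\<lambda>w. G (- w)) holomorphic_on {w. Re w > \<alpha>}"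
    by (rule holomorphic_on_compose_gen[OF _ G, unfolded o_def]) (auto intro!: holomorphic_intros)
  have *: "integrable lborel (\<lambda>t. F (Complex a t))" "vint F a = 0"
    unfolding F_def by (rule vint_right_zero[OF a hG, of M]; use M[of "- w" for w] y in auto)+
  have eq: "f (Complex (- a) t) = F (Complex a (0 + (-1) * t))" for t
  proof -
    have "- Complex a (- t) = Complex (- a) t" by (simp add: complex_eq_iff)
    moreover have "(Complex a (- t))\<^sup>2 = (Complex (- a) t)\<^sup>2" by (simp add: complex_eq_iff power2_eq_square)
    moreover have "of_real (- y) * Complex a (- t) = of_real y * Complex (- a) t" by (simp add: complex_eq_iff)
    ultimately show ?thesis by (simp add: f_def F_def)
  qed
  show "integrable lborel (\<lambda>t. f (Complex (- a) t))"
    unfolding eq by (rule lborel_integrable_real_affine[OF *(1)]) auto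
  have "vint F a = \<bar>-1\<bar> *\<^sub>R vint f (- a)"
    unfolding vint_def eq by (rule lborel_integral_real_affine) auto
  thus "vint f (- a) = 0" using *(2) by simp
qed

text \<open>The smoothed Perron formula: for y = log (x / n) it yields the weight log (x / n) when n
  \<le> x and 0 beyond. For y > 0 the line is moved to the left across the double pole 0, whose
  residue is y.\<close>

lemma perron_kernel:
  fixes y :: real
  assumes c: "c > 0"
  defines "f \<equiv> \<lambda>w. exp (of_real y * w) / w\<^sup>2"
  shows "integrable lborel (\<lambda>t. f (Complex c t))" "vint f c = 2 * pi * max y 0"
proof -
  have one: "norm (1 :: complex) \<le> 1 * (1 + norm w) powr (1 / 2)" for w :: complex
    using ge_one_powr_ge_zero[of "1 + norm w" "1 / 2"] by simp
  have "integrable lborel (\<lambda>t. f (Complex c t)) \<and> vint f c = 2 * pi * max y 0"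
  proof (cases "y \<le> 0")
    case True
    from vint_right_zero[of 0 c "\<lambda>_. 1", OF _ c _ one True] True show ?thesis by (simp add: f_def)
  next
    case False
    hence y: "y \<ge> 0" by simp
    from vint_left_zero[of 0 1 "\<lambda>_. 1", OF _ _ _ one y]
      perron_shift[of "-2" "-1" c "\<lambda>_. 1", OF _ _ c _ one, of y] y show ?thesis
      by (simp add: f_def)
  qed
  thus "integrable lborel (\<lambda>t. f (Complex c t))" "vint f c = 2 * pi * max y 0" by auto
qed

text \<open>The residue theorem with the kernel 1 / (w (w + 2 b)), where -2 b is the mirror image of
  0 in the line Re w = -b. On that line w (w + 2 b) = -(b^2 + t^2), so the Poisson kernel
  appears.\<close>

lemma half_plane_poisson:
  fixes g :: "complex \<Rightarrow> complex"
  assumes b: "b > 0" "\<alpha> < - b" and g: "g holomorphic_on {w. Re w > \<alpha>}"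
    and M: "\<And>w. - b \<le> Re w \<Longrightarrow> norm (g w) \<le> M * (1 + norm w) powr (1 / 2)"
  shows "integrable lborel (\<lambda>t. g (Complex (- b) t) / of_real (b\<^sup>2 + t\<^sup>2))"
    "(LINT t|lborel. g (Complex (- b) t) / of_real (b\<^sup>2 + t\<^sup>2)) = pi * g 0 / b"
proof -
  define f where "f = (\<lambda>w. g w / (w + of_real (2 * b)) / w)"
  have M0: "M \<ge> 0" using order_trans[OF norm_ge_zero M[of 0]] b by simp
  define K where "K = M * (1 + b) powr (1 / 2) * ((1 + b) / b + 1) * (1 / b + 1)"
  have bound: "norm (f w) \<le> K * (1 + norm (w - of_real (- b))) powr (- (3 / 2))"
    if w: "- b \<le> Re w" "norm (w - 0) \<ge> b" for w
  proof -
    define N where "N = norm (w - of_real (- b))"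
    have N0: "N \<ge> 0" by (simp add: N_def)
    have w0: "norm w > 0" using w b by auto
    have Nw: "N \<le> norm w + b" "norm w \<le> N + b"
      using norm_triangle_ineq[of w "of_real b"] norm_triangle_ineq4[of "w + of_real b" "of_real b"] b
      by (auto simp: N_def)
    have "1 + N \<le> ((1 + b) / b + 1) * norm w"
    proof -
      have "(1 + b) / b * b \<le> (1 + b) / b * norm w" using w b by (intro mult_left_mono) auto
      hence "1 + b \<le> (1 + b) / b * norm w" using b by simp
      thus ?thesis using Nw by (simp add: distrib_right)
    qed
    hence i1: "inverse (norm w) \<le> ((1 + b) / b + 1) * inverse (1 + N)"
      using w0 N0 by (simp add: field_simps)
    have Re2: "b \<le> norm (w + of_real (2 * b))" using abs_Re_le_cmod[of "w + of_real (2 * b)"] w by auto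
    have N2: "N \<le> norm (w + of_real (2 * b))"
    proof -
      have "(Re w + b)\<^sup>2 \<le> (Re w + 2 * b)\<^sup>2" using w b by (intro power_mono) auto
      thus ?thesis unfolding N_def cmod_def by simp
    qed
    have pos2: "norm (w + of_real (2 * b)) > 0" using Re2 b by linarith
    have "1 + N \<le> (1 / b + 1) * norm (w + of_real (2 * b))"
    proof -
      have "1 \<le> 1 / b * norm (w + of_real (2 * b))" using Re2 b by (simp add: field_simps)
      thus ?thesis using N2 by (simp add: distrib_right)
    qed
    hence i2: "inverse (norm (w + of_real (2 * b))) \<le> (1 / b + 1) * inverse (1 + N)"
      using pos2 N0 by (simp add: field_simps)
    have "1 + norm w \<le> (1 + b) * (1 + N)" using Nw b N0 by (simp add: algebra_simps) (smt (verit) mult_nonneg_nonneg)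
    hence "(1 + norm w) powr (1 / 2) \<le> ((1 + b) * (1 + N)) powr (1 / 2)"
      by (intro powr_mono2) auto
    hence i3: "(1 + norm w) powr (1 / 2) \<le> (1 + b) powr (1 / 2) * (1 + N) powr (1 / 2)"
      using b N0 by (simp add: powr_mult)
    have "norm (f w) = norm (g w) * (inverse (norm w) * inverse (norm (w + of_real (2 * b))))"
      by (simp add: f_def norm_divide norm_mult norm_inverse divide_inverse mult_ac del: of_real_mult)
    also have "\<dots> \<le> (M * ((1 + b) powr (1 / 2) * (1 + N) powr (1 / 2))) *
         ((((1 + b) / b + 1) * inverse (1 + N)) * ((1 / b + 1) * inverse (1 + N)))"
      using M0 b N0 by (intro mult_mono order.trans[OF M[OF w(1)]] i1 i2 i3 mult_left_mono) auto
    also have "\<dots> = K * ((1 + N) powr (1 / 2) * (inverse (1 + N) * inverse (1 + N)))" by (simp add: K_def)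
    also have "(1 + N) powr (1 / 2) * (inverse (1 + N) * inverse (1 + N)) = (1 + N) powr (- (3 / 2))"
    proof -
      have i: "inverse (1 + N) = (1 + N) powr (- 1)" using N0 by (simp add: powr_minus)
      show ?thesis unfolding i powr_add[symmetric] by simp
    qed
    finally show ?thesis by (simp add: N_def)
  qed
  \<comment> \<open>The bound -2 b keeps the mirror image outside the domain, so that 0 is the only
    singularity of \<open>f\<close>.\<close>
  have h: "(\<lambda>w. g w / (w + of_real (2 * b))) holomorphic_on {w. Re w > max \<alpha> (- 2 * b)}"
    by (intro holomorphic_intros holomorphic_on_subset[OF g]) (auto simp: complex_eq_iff)
  have hol: "f holomorphic_on {w. Re w > max \<alpha> (- 2 * b)} - {0}"
    unfolding f_def by (intro holomorphic_intros holomorphic_on_subset[OF h]) auto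
  have res: "residue f 0 = g 0 / of_real (2 * b)"
  proof -
    have "residue (\<lambda>w. (\<lambda>w. g w / (w + of_real (2 * b))) w / w ^ Suc 0) 0 =
        (deriv ^^ 0) (\<lambda>w. g w / (w + of_real (2 * b))) 0 / fact 0"
      by (rule residue_holomorphic_over_power'[OF open_halfspace_Re_gt _ h]) (use b in auto)
    thus ?thesis by (simp add: f_def)
  qed
  have *: "integrable lborel (\<lambda>t. f (Complex (- b) t))" "vint f (- b) = - 2 * pi * residue f 0"
    by (rule vline_right[where r = b and M = K and \<alpha> = "max \<alpha> (- 2 * b)", OF _ hol _ _ bound];
        use b in auto)+
  have eq: "f (Complex (- b) t) = - (g (Complex (- b) t) / of_real (b\<^sup>2 + t\<^sup>2))" for t
  proof -
    have "(Complex (- b) t + of_real (2 * b)) * Complex (- b) t = - of_real (b\<^sup>2 + t\<^sup>2)"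
      by (simp add: complex_eq_iff power2_eq_square algebra_simps)
    thus ?thesis unfolding f_def divide_divide_eq_left by (simp del: of_real_add of_real_mult)
  qed
  show "integrable lborel (\<lambda>t. g (Complex (- b) t) / of_real (b\<^sup>2 + t\<^sup>2))"
    using *(1) unfolding eq by simp
  show "(LINT t|lborel. g (Complex (- b) t) / of_real (b\<^sup>2 + t\<^sup>2)) = pi * g 0 / b"
    using *(2) unfolding vint_def eq res using b by (simp add: field_simps)
qed

section \<open>Holomorphic functions with nonnegative real part\<close>

text \<open>Schwarz's lemma for the Cayley transform of \<open>g\<close> composed with
  \<open>m\<close>, a map of the unit disc into S that sends 0 to z. Different choices of
  \<open>m\<close> produce the half-plane and the disc version below.\<close>

lemma Schwarz_Pick_half_plane:
  assumes hol: "g holomorphic_on S" and S: "open S"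
    and pos: "\<And>z. z \<in> S \<Longrightarrow> Re (g z) \<ge> 0"
    and m: "m holomorphic_on ball 0 1" "m ` ball 0 1 \<subseteq> S" "m 0 = z"
  shows "norm (deriv g z) * norm (deriv m 0) \<le> 2 * Re (g z)"
proof (rule field_le_epsilon)
  fix e :: real assume e: "e > 0"
  \<comment> \<open>Adding e / 2 makes the real part strictly positive, so the denominator of the
    Cayley transform \<open>q\<close> cannot vanish; at the end e is arbitrarily small.\<close>
  define h where "h u = g (m u) + of_real (e / 2)" for u
  have z: "z \<in> S" using m by force
  have hh: "h holomorphic_on ball 0 1"
    unfolding h_def by (intro holomorphic_intros holomorphic_on_compose_gen[OF m(1) hol m(2), unfolded o_def])
  have hp: "Re (h u) > 0" if "u \<in> ball 0 1" for u
    using pos[of "m u"] m(2) that e by (auto simp: h_def image_subset_iff)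
  define q where "q u = (h u - h 0) / (h u + cnj (h 0))" for u
  have nz: "h u + cnj (h 0) \<noteq> 0" if "u \<in> ball 0 1" for u
  proof -
    have "Re (h u + cnj (h 0)) > 0" using hp[OF that] hp[of 0] by simp
    thus ?thesis by (metis less_irrefl zero_complex.sel(1))
  qed
  have qh: "q holomorphic_on ball 0 1"
    unfolding q_def by (intro holomorphic_intros hh nz)
  have q1: "norm (q u) < 1" if "norm u < 1" for u
  proof -
    have "(Re (h u) - Re (h 0))\<^sup>2 < (Re (h u) + Re (h 0))\<^sup>2"
      using hp[of u] hp[of 0] that by (simp add: power2_eq_square algebra_simps)
    hence "norm (h u - h 0) < norm (h u + cnj (h 0))" by (simp add: cmod_def)
    thus ?thesis using nz[of u] that by (simp add: q_def norm_divide divide_simps)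
  qed
  have "norm (deriv q 0) \<le> 1"
    by (rule Schwarz_Lemma(2)[OF qh _ q1, of 0]) (auto simp: q_def)
  moreover have "deriv q 0 = deriv h 0 / of_real (2 * Re (h 0))"
  proof -
    have d: "(h has_field_derivative deriv h 0) (at 0)"
      using holomorphic_derivI[OF hh open_ball] by auto
    have "h 0 + cnj (h 0) = of_real (2 * Re (h 0))" by (simp add: complex_add_cnj)
    moreover have "(q has_field_derivative (deriv h 0 * (h 0 + cnj (h 0)) - (h 0 - h 0) * deriv h 0) / ((h 0 + cnj (h 0)) * (h 0 + cnj (h 0)))) (at 0)"
      unfolding q_def using nz[of 0] by (auto intro!: derivative_eq_intros d)
    ultimately show ?thesis using hp[of 0] by (auto simp: DERIV_imp_deriv)
  qed
  moreover have "deriv h 0 = deriv g z * deriv m 0"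
  proof -
    have "(m has_field_derivative deriv m 0) (at 0)"
      using holomorphic_derivI[OF m(1) open_ball] by auto
    moreover have "(g has_field_derivative deriv g z) (at (m 0))"
      using holomorphic_derivI[OF hol S z] m(3) by simp
    ultimately have "((\<lambda>u. g (m u)) has_field_derivative deriv g z * deriv m 0) (at 0)"
      using DERIV_chain2 by blast
    hence "(h has_field_derivative deriv g z * deriv m 0) (at 0)"
      unfolding h_def by (auto intro!: derivative_eq_intros)
    thus ?thesis by (rule DERIV_imp_deriv)
  qed
  ultimately have "norm (deriv g z) * norm (deriv m 0) \<le> 2 * Re (h 0)"
    using hp[of 0] by (simp add: norm_divide norm_mult)
  thus "norm (deriv g z) * norm (deriv m 0) \<le> 2 * Re (g z) + e" using m(3) by (simp add: h_def)
qed

text \<open>The Moebius map \<open>m\<close> from the disc to the half-plane with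
  \<open>m 0 = z\<close> has derivative 2 (Re z - c) at 0.\<close>

lemma Schwarz_Pick_right_half_plane:
  assumes hol: "g holomorphic_on {z. Re z > c}" and pos: "\<And>z. Re z > c \<Longrightarrow> Re (g z) \<ge> 0"
    and z: "Re z > c"
  shows "norm (deriv g z) \<le> Re (g z) / (Re z - c)"
proof -
  define w where "w = z - of_real c"
  have w: "Re w > 0" using z by (simp add: w_def)
  define m where "m u = of_real c + (w + cnj w * u) / (1 - u)" for u
  have "norm (deriv g z) * norm (deriv m 0) \<le> 2 * Re (g z)"
  proof (rule Schwarz_Pick_half_plane[OF hol open_halfspace_Re_gt])
    show "m holomorphic_on ball 0 1" unfolding m_def by (intro holomorphic_intros) auto
    show "m ` ball 0 1 \<subseteq> {z. Re z > c}"
    proof clarify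
      fix u :: complex assume "u \<in> ball 0 1"
      hence u: "norm u < 1" by simp
      hence u1: "1 - u \<noteq> 0" by auto
      have "Re ((w + cnj w * u) / (1 - u)) = Re w * (1 - (norm u)\<^sup>2) / (norm (1 - u))\<^sup>2"
        unfolding Re_complex_div_gt_0 Re_divide cmod_power2 
        by (simp add: power2_eq_square algebra_simps)
      moreover have "\<dots> > 0" using w u u1 by (intro divide_pos_pos mult_pos_pos) (auto simp: power_less_one_iff abs_square_less_1)
      ultimately show "Re (m u) > c" by (simp add: m_def)
    qed
    show "m 0 = z" by (simp add: m_def w_def)
  qed (use pos in auto)
  moreover have "deriv m 0 = of_real (2 * Re w)"
  proof -
    have "(m has_field_derivative (w + cnj w)) (at 0)"
      unfolding m_def by (auto intro!: derivative_eq_intros)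
    thus ?thesis by (simp add: DERIV_imp_deriv complex_add_cnj)
  qed
  ultimately have "norm (deriv g z) * (2 * Re w) \<le> 2 * Re (g z)" using w by (simp del: of_real_mult)
  thus ?thesis using w by (simp add: w_def field_simps)
qed

text \<open>Meant for functions whose real part is known to be bounded on one side on a disc, in the
  manner of Borel and Caratheodory.\<close>

lemma Schwarz_Pick_ball:
  assumes hol: "g holomorphic_on ball z R" and pos: "\<And>u. u \<in> ball z R \<Longrightarrow> Re (g u) \<ge> 0" and R: "R > 0"
  shows "norm (deriv g z) \<le> 2 * Re (g z) / R"
proof -
  define m where "m u = z + of_real R * u" for u
  have "norm (deriv g z) * norm (deriv m 0) \<le> 2 * Re (g z)"
  proof (rule Schwarz_Pick_half_plane[OF hol open_ball pos])
    show "m holomorphic_on ball 0 1" unfolding m_def by (intro holomorphic_intros)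
    show "m ` ball 0 1 \<subseteq> ball z R" using R by (auto simp: m_def dist_norm norm_mult)
    show "m 0 = z" by (simp add: m_def)
  qed
  moreover have "deriv m 0 = of_real R"
  proof -
    have "(m has_field_derivative of_real R) (at 0)"
      unfolding m_def by (auto intro!: derivative_eq_intros)
    thus ?thesis by (simp add: DERIV_imp_deriv)
  qed
  ultimately show ?thesis using R by (simp add: field_simps)
qed

lemma horizontal_derivative:
  assumes "(g has_field_derivative D) (at (Complex x t))"
  shows "((\<lambda>x. Re (g (Complex x t))) has_field_derivative Re D) (at x)"
    "((\<lambda>x. Im (g (Complex x t))) has_field_derivative Im D) (at x)"
    "((\<lambda>x. g (Complex x t)) has_vector_derivative D) (at x)"
proof -
  have "((\<lambda>x. of_real x + \<i> * of_real t) has_vector_derivative 1) (at x)"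
    by (auto intro!: derivative_eq_intros)
  moreover have "(\<lambda>x. of_real x + \<i> * of_real t) = (\<lambda>x. Complex x t)"
    by (auto simp: complex_eq_iff)
  ultimately have "((\<lambda>x. Complex x t) has_vector_derivative 1) (at x)" by simp
  from field_vector_diff_chain_at[OF this assms]
  show v: "((\<lambda>x. g (Complex x t)) has_vector_derivative D) (at x)" by (simp add: o_def)
  show "((\<lambda>x. Re (g (Complex x t))) has_field_derivative Re D) (at x)"
    using bounded_linear.has_vector_derivative[OF bounded_linear_Re v]
    by (simp add: has_real_derivative_iff_has_vector_derivative)
  show "((\<lambda>x. Im (g (Complex x t))) has_field_derivative Im D) (at x)"
    using bounded_linear.has_vector_derivative[OF bounded_linear_Im v]
    by (simp add: has_real_derivative_iff_has_vector_derivative)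
qed

text \<open>Schwarz--Pick gives (Re z - c) Re g' \<le> Re g, which is the sign of the derivative of
  the quotient. In the classical picture a zero 1/2 + i \<gamma> contributes (\<sigma> - 1/2) /
  ((\<sigma> - 1/2)^2 + (t - \<gamma>)^2) to Re g, and division by \<sigma> - 1/2 leaves a
  decreasing function of \<sigma>.\<close>

lemma Re_over_dist_antimono:
  assumes hol: "g holomorphic_on {z. Re z > c}" and pos: "\<And>z. Re z > c \<Longrightarrow> Re (g z) \<ge> 0"
    and x: "c < x" "x \<le> y"
  shows "Re (g (Complex y t)) / (y - c) \<le> Re (g (Complex x t)) / (x - c)"
proof -
  define h where "h x = - (Re (g (Complex x t)) / (x - c))" for x
  have "h x \<le> h y"
  proof (rule DERIV_nonneg_imp_nondecreasing[OF x(2)])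
    fix v assume v: "x \<le> v" "v \<le> y"
    define D where "D = deriv g (Complex v t)"
    have "(g has_field_derivative D) (at (Complex v t))"
      unfolding D_def by (rule holomorphic_derivI[OF hol open_halfspace_Re_gt]) (use v x in auto)
    note d = horizontal_derivative[OF this]
    have "(h has_real_derivative - ((Re D * (v - c) - Re (g (Complex v t)) * 1) / ((v - c) * (v - c)))) (at v)"
      unfolding h_def using v x by (auto intro!: derivative_eq_intros d)
    moreover have "Re D * (v - c) \<le> Re (g (Complex v t))"
    proof -
      have "Re D \<le> Re (g (Complex v t)) / (v - c)"
        using Schwarz_Pick_right_half_plane[OF hol pos, of "Complex v t"] v x complex_Re_le_cmod[of D]
        by (simp add: D_def)
      thus ?thesis using v x by (simp add: field_simps)
    qed
    hence "- ((Re D * (v - c) - Re (g (Complex v t)) * 1) / ((v - c) * (v - c))) \<ge> 0"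
      by (simp add: divide_nonpos_nonneg)
    ultimately show "\<exists>y. (h has_real_derivative y) (at v) \<and> 0 \<le> y" by blast
  qed
  thus ?thesis by (simp add: h_def)
qed

text \<open>
  By Schwarz--Pick the quantity \<open>\<bar>g\<bar>\<^sup>2 (Re z - c)\<^sup>2\<close> increases along horizontal lines.
\<close>

lemma half_plane_norm_growth:
  assumes hol: "g holomorphic_on {z. Re z > c}" and pos: "\<And>z. Re z > c \<Longrightarrow> Re (g z) \<ge> 0"
    and x: "c < x" "x \<le> y"
  shows "norm (g (Complex x t)) * (x - c) \<le> norm (g (Complex y t)) * (y - c)"
proof -
  define h where "h x = ((Re (g (Complex x t)))\<^sup>2 + (Im (g (Complex x t)))\<^sup>2) * (x - c)\<^sup>2" for x
  have "h x \<le> h y"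
  proof (rule DERIV_nonneg_imp_nondecreasing[OF x(2)])
    fix v assume v: "x \<le> v" "v \<le> y"
    define D where "D = deriv g (Complex v t)"
    define G where "G = g (Complex v t)"
    have "(g has_field_derivative D) (at (Complex v t))"
      unfolding D_def by (rule holomorphic_derivI[OF hol open_halfspace_Re_gt]) (use v x in auto)
    note d = horizontal_derivative[OF this]
    define H where "H = 2 * (Re G * Re D + Im G * Im D) * (v - c)\<^sup>2 + ((Re G)\<^sup>2 + (Im G)\<^sup>2) * (2 * (v - c))"
    have "(h has_real_derivative H) (at v)"
      unfolding h_def H_def G_def by (auto intro!: derivative_eq_intros d simp: algebra_simps)
    moreover have "H \<ge> 0"
    proof -
      have "Re G * Re D + Im G * Im D = Re (G * cnj D)" by simp
      also have "\<dots> \<ge> - (norm G * norm D)"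
        using abs_Re_le_cmod[of "G * cnj D"] by (simp add: norm_mult del: times_complex.sel complex_cnj_mult)
      finally have 1: "Re G * Re D + Im G * Im D \<ge> - (norm G * norm D)" .
      have "norm D * (v - c) \<le> norm G"
      proof -
        have "norm D \<le> Re G / (v - c)"
          using Schwarz_Pick_right_half_plane[OF hol pos, of "Complex v t"] v x by (simp add: D_def G_def)
        thus ?thesis using v x complex_Re_le_cmod[of G] by (simp add: field_simps)
      qed
      hence "norm G * (norm D * (v - c)) \<le> norm G * norm G" by (intro mult_left_mono) auto
      hence "norm G * norm D * (v - c) \<le> (Re G)\<^sup>2 + (Im G)\<^sup>2" using cmod_power2[of G] by (simp add: power2_eq_square mult_ac)
      moreover have "- (norm G * norm D * (v - c)) \<le> (Re G * Re D + Im G * Im D) * (v - c)"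
        using mult_right_mono[OF 1, of "v - c"] v x by simp
      ultimately have "0 \<le> (Re G * Re D + Im G * Im D) * (v - c) + ((Re G)\<^sup>2 + (Im G)\<^sup>2)" by linarith
      hence "0 \<le> 2 * (v - c) * ((Re G * Re D + Im G * Im D) * (v - c) + ((Re G)\<^sup>2 + (Im G)\<^sup>2))"
        using v x by (intro mult_nonneg_nonneg) auto
      thus ?thesis unfolding H_def by (simp add: algebra_simps power2_eq_square)
    qed
    ultimately show "\<exists>y. (h has_real_derivative y) (at v) \<and> 0 \<le> y" by blast
  qed
  hence "(norm (g (Complex x t)) * (x - c))\<^sup>2 \<le> (norm (g (Complex y t)) * (y - c))\<^sup>2"
    by (simp add: h_def power_mult_distrib cmod_power2)
  thus ?thesis using x by (simp add: power2_le_iff_abs_le abs_mult)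
qed

lemma powr_half_le: "0 \<le> x \<Longrightarrow> x \<le> k * y \<Longrightarrow> 0 \<le> k \<Longrightarrow> 0 \<le> y \<Longrightarrow> x powr (1 / 2) \<le> k powr (1 / 2) * (y :: real) powr (1 / 2)"
  by (subst powr_mult[symmetric]) (auto intro!: powr_mono2)

text \<open>
  The integral on the line \<open>Re w = - b\<close> is unchanged when the conjugate of \<open>g\<close> is added, because
  that conjugate extends holomorphically to the left of the line.  The resulting integrand \<open>2 Re g\<close> is
  nonnegative, and its Poisson integral is the value of \<open>Re g\<close> at 0.
\<close>

lemma half_plane_explicit_formula:
  fixes g :: "complex \<Rightarrow> complex" and y :: real
  assumes d: "\<delta> > 0" and c: "c > 0" and y: "y \<ge> 0"
    and hol: "g holomorphic_on {w. Re w > - \<delta>}"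
    and pos: "\<And>w. Re w > - \<delta> \<Longrightarrow> Re (g w) \<ge> 0"
    and growth: "\<And>b. 0 < b \<Longrightarrow> b < \<delta> \<Longrightarrow> \<exists>M. \<forall>w. Re w \<ge> - b \<longrightarrow> norm (g w) \<le> M * (1 + norm w) powr (1 / 2)"
  defines "f \<equiv> \<lambda>w. g w * exp (of_real y * w) / w\<^sup>2"
  shows "integrable lborel (\<lambda>t. f (Complex c t))"
    "norm (vint f c - 2 * pi * (deriv g 0 + y * g 0)) \<le> 2 * pi * (exp (- y * \<delta>) * Re (g 0) / \<delta>)"
proof -
  have *: "integrable lborel (\<lambda>t. f (Complex c t)) \<and>
     norm (vint f c - 2 * pi * (deriv g 0 + y * g 0)) \<le> 2 * pi * (exp (- y * b) * Re (g 0) / b)"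
    if b: "0 < b" "b < \<delta>" for b
  proof -
    obtain M where M: "\<And>w. Re w \<ge> - b \<Longrightarrow> norm (g w) \<le> M * (1 + norm w) powr (1 / 2)"
      using growth[OF b] by blast
    have M0: "M \<ge> 0" using order_trans[OF norm_ge_zero M[of 0]] b by simp
    have sh: "integrable lborel (\<lambda>t. f (Complex (- b) t))" "integrable lborel (\<lambda>t. f (Complex c t))"
        "vint f c - vint f (- b) = 2 * pi * (deriv g 0 + y * g 0)"
      unfolding f_def by (rule perron_shift[OF _ _ c hol, of "- b" M y]; use b M in auto)+
    define gc where "gc w = cnj (g (- of_real (2 * b) - cnj w))" for w
    define h where "h = (\<lambda>w. gc w * exp (of_real y * w) / w\<^sup>2)"
    have hh: "integrable lborel (\<lambda>t. h (Complex (- b) t))" "vint h (- b) = 0"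
    proof -
      \<comment> \<open>The reflected function \<open>gc\<close> is holomorphic for Re w < \<delta>
        - 2 b, while \<open>vint_left_zero\<close> works on a half-plane Re w < -\<alpha> with
        \<alpha> \<ge> 0; hence the maximum with 0.\<close>
      define \<alpha> where "\<alpha> = max 0 (2 * b - \<delta>)"
      have al: "0 \<le> \<alpha>" "\<alpha> < b" using b by (auto simp: \<alpha>_def)
      have gch: "gc holomorphic_on {w. Re w < - \<alpha>}"
      proof -
        have im: "cnj ` {w. Re w < - \<alpha>} = {w. Re w < - \<alpha>}" 
        proof safe
          fix x assume "Re x < - \<alpha>"
          thus "x \<in> cnj ` {w. Re w < - \<alpha>}" by (intro image_eqI[of _ _ "cnj x"]) auto
        qed auto
        have "(\<lambda>w. g (- of_real (2 * b) - w)) holomorphic_on {w. Re w < - \<alpha>}"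
          by (rule holomorphic_on_compose_gen[OF _ hol, unfolded o_def])
             (auto intro!: holomorphic_intros simp: \<alpha>_def)
        hence "(cnj \<circ> (\<lambda>w. g (- of_real (2 * b) - w)) \<circ> cnj) holomorphic_on cnj ` {w. Re w < - \<alpha>}"
          by (intro holomorphic_on_compose_cnj_cnj) (simp_all add: im open_halfspace_Re_lt)
        moreover have "cnj \<circ> (\<lambda>w. g (- of_real (2 * b) - w)) \<circ> cnj = gc" by (auto simp: gc_def o_def fun_eq_iff)
        ultimately show ?thesis by (simp only: im)
      qed
      have gcM: "norm (gc w) \<le> (M * (1 + 2 * b) powr (1 / 2)) * (1 + norm w) powr (1 / 2)" if w: "Re w \<le> - b" for w
      proof -
        have "norm (gc w) = norm (g (- of_real (2 * b) - cnj w))" by (simp add: gc_def)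
        also have "\<dots> \<le> M * (1 + norm (- of_real (2 * b) - cnj w)) powr (1 / 2)" using w by (intro M) auto
        also have "\<dots> \<le> M * ((1 + 2 * b) powr (1 / 2) * (1 + norm w) powr (1 / 2))"
        proof (intro mult_left_mono powr_half_le)
          have "norm (- of_real (2 * b) - cnj w) \<le> norm (- of_real (2 * b) :: complex) + norm (cnj w)"
            by (rule norm_triangle_ineq4)
          also have "\<dots> = 2 * b + norm w" using b by (simp del: of_real_mult)
          finally show "1 + norm (- of_real (2 * b) - cnj w) \<le> (1 + 2 * b) * (1 + norm w)"
            using b by (simp add: algebra_simps del: of_real_mult) (smt (verit) mult_nonneg_nonneg norm_ge_zero)
        qed (use b M0 in auto)
        finally show ?thesis by (simp add: mult_ac)
      qed
      show "integrable lborel (\<lambda>t. h (Complex (- b) t))" "vint h (- b) = 0"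
        unfolding h_def
        by (rule vint_left_zero(1)[OF al gch gcM y], assumption, rule vint_left_zero(2)[OF al gch gcM y], assumption)
    qed
    have bM: "0 < b" "- \<delta> < - b" using b by auto
    note poisson = half_plane_poisson[OF bM hol M]
    have sum: "f (Complex (- b) t) + h (Complex (- b) t) =
        of_real (2 * Re (g (Complex (- b) t))) * exp (of_real y * Complex (- b) t) / (Complex (- b) t)\<^sup>2" for t
    proof -
      have "- of_real (2 * b) - cnj (Complex (- b) t) = Complex (- b) t" by (simp add: complex_eq_iff)
      hence "h (Complex (- b) t) = cnj (g (Complex (- b) t)) * exp (of_real y * Complex (- b) t) / (Complex (- b) t)\<^sup>2"
        by (simp add: h_def gc_def)
      moreover have "of_real (2 * Re (g (Complex (- b) t))) = g (Complex (- b) t) + cnj (g (Complex (- b) t))"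
        by (simp add: complex_add_cnj)
      ultimately show ?thesis by (simp add: f_def add_divide_distrib ring_distribs)
    qed
    define P where "P = (\<lambda>t. g (Complex (- b) t) / of_real (b\<^sup>2 + t\<^sup>2))"
    have Pint: "integrable lborel P" "integral\<^sup>L lborel P = pi * g 0 / b"
      unfolding P_def by (rule poisson(1), assumption, rule poisson(2), assumption)
    have nm: "norm (f (Complex (- b) t) + h (Complex (- b) t)) = 2 * exp (- y * b) * Re (P t)" for t
    proof -
      have "norm ((Complex (- b) t)\<^sup>2) = b\<^sup>2 + t\<^sup>2" by (simp add: norm_power cmod_power2)
      moreover have "norm (exp (of_real y * Complex (- b) t)) = exp (- y * b)" by simp
      moreover have "Re (P t) = Re (g (Complex (- b) t)) / (b\<^sup>2 + t\<^sup>2)"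
        unfolding P_def by (simp only: Re_divide_of_real)
      moreover have "norm (of_real (2 * Re (g (Complex (- b) t))) :: complex) = 2 * Re (g (Complex (- b) t))"
        using pos[of "Complex (- b) t"] b by (simp del: of_real_mult)
      ultimately show ?thesis unfolding sum norm_divide norm_mult by simp
    qed
    have "vint f (- b) = vint f (- b) + vint h (- b)" using hh by simp
    also have "\<dots> = (LINT t|lborel. f (Complex (- b) t) + h (Complex (- b) t))"
      unfolding vint_def by (rule Bochner_Integration.integral_add[symmetric]) (use sh hh in auto)
    finally have "norm (vint f (- b)) \<le> (LINT t|lborel. norm (f (Complex (- b) t) + h (Complex (- b) t)))"
      using integral_norm_bound by metis
    also have "\<dots> = 2 * exp (- y * b) * Re (pi * g 0 / b)"
      unfolding nm using Pint by (simp add: integral_Re[symmetric])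
    also have "Re (pi * g 0 / b) = pi * Re (g 0) / b" by simp
    finally have "norm (vint f (- b)) \<le> 2 * pi * (exp (- y * b) * Re (g 0) / b)" by (simp add: mult_ac)
    moreover have "vint f (- b) = vint f c - 2 * pi * (deriv g 0 + y * g 0)" using sh(3) by (simp add: algebra_simps)
    ultimately show ?thesis using sh(2) by simp
  qed
  show "integrable lborel (\<lambda>t. f (Complex c t))" using *[of "\<delta> / 2"] d by simp
  \<comment> \<open>The estimate is available for every b < \<delta>, and its right-hand side is
    continuous in b, so b can tend to \<delta> although nothing is known about \<open>g\<close> on
    the line Re w = -\<delta>.\<close>
  have "((\<lambda>b. 2 * pi * (exp (- y * b) * Re (g 0) / b)) \<longlongrightarrow> 2 * pi * (exp (- y * \<delta>) * Re (g 0) / \<delta>)) (at_left \<delta>)"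
    using d by (intro tendsto_intros) auto
  moreover have "\<forall>\<^sub>F b in at_left \<delta>. norm (vint f c - 2 * pi * (deriv g 0 + y * g 0)) \<le> 2 * pi * (exp (- y * b) * Re (g 0) / b)"
    using eventually_at_left_real[OF d] by eventually_elim (use * in auto)
  ultimately show "norm (vint f c - 2 * pi * (deriv g 0 + y * g 0)) \<le> 2 * pi * (exp (- y * \<delta>) * Re (g 0) / \<delta>)"
    by (intro tendsto_lowerbound[where F = "at_left \<delta>"]) auto
qed

text \<open>Counterpart of the previous formula for the gamma part, which is regular further to the
  left. Subtracting the constant \<open>E 0\<close> does not change the integral on Re w = -b, by
  \<open>vint_left_zero\<close>, and the Hoelder bound then makes the integrand O(|w|^(-3/2)). The
  48 is 4 * 12: the integral of \<open>decay\<close> is 4, and |w| \<ge> 1/4 gives 1 + |t| \<le> 5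
  |w| together with 5^(3/2) \<le> 12.\<close>

lemma smooth_explicit_formula:
  fixes E :: "complex \<Rightarrow> complex" and y K :: real
  assumes b: "1 / 4 \<le> b" "b < \<beta>" and c: "c > 0" and y: "y \<ge> 0" and K: "K \<ge> 0"
    and hol: "E holomorphic_on {w. Re w > - \<beta>}"
    and hoelder: "\<And>w. Re w \<ge> - b \<Longrightarrow> norm (E w - E 0) \<le> K * sqrt (norm w)"
  defines "f \<equiv> \<lambda>w. E w * exp (of_real y * w) / w\<^sup>2"
  shows "integrable lborel (\<lambda>t. f (Complex c t))"
    "norm (vint f c - 2 * pi * (deriv E 0 + y * E 0)) \<le> 48 * K * exp (- y * b)"
proof -
  have sq: "sqrt (norm w) \<le> (1 + norm w) powr (1 / 2)" for w :: complex
    by (simp add: powr_half_sqrt)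
  have one: "1 \<le> (1 + norm w) powr (1 / 2)" for w :: complex
    by (intro ge_one_powr_ge_zero) auto
  have EM: "norm (E w) \<le> (K + norm (E 0)) * (1 + norm w) powr (1 / 2)" if "Re w \<ge> - b" for w
  proof -
    have "norm (E w) \<le> norm (E w - E 0) + norm (E 0)" by (metis diff_add_cancel norm_triangle_ineq)
    also have "\<dots> \<le> K * (1 + norm w) powr (1 / 2) + norm (E 0) * (1 + norm w) powr (1 / 2)"
      using mult_left_mono[OF one, of "norm (E 0)" w] mult_left_mono[OF sq K, of w] hoelder[OF that] by simp
    finally show ?thesis by (simp add: ring_distribs)
  qed
  have sh: "integrable lborel (\<lambda>t. f (Complex (- b) t))" "integrable lborel (\<lambda>t. f (Complex c t))"
      "vint f c - vint f (- b) = 2 * pi * (deriv E 0 + y * E 0)"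
    unfolding f_def by (rule perron_shift[OF _ _ c hol, of "- b" "K + norm (E 0)" y]; use b EM in auto)+
  show "integrable lborel (\<lambda>t. f (Complex c t))" by (rule sh)
  define h where "h = (\<lambda>w. E 0 * exp (of_real y * w) / w\<^sup>2)"
  have hh: "integrable lborel (\<lambda>t. h (Complex (- b) t))" "vint h (- b) = 0"
    unfolding h_def
    by (rule vint_left_zero[of 0 b "\<lambda>_. E 0" "norm (E 0)"]; use b y one in \<open>auto intro!: mult_left_mono[of 1 _ "norm (E 0)", simplified]\<close>)+
  define k where "k w = f w - h w" for w
  have ki: "integrable lborel (\<lambda>t. k (Complex (- b) t))" unfolding k_def using sh hh by auto
  have "vint k (- b) = vint f (- b) - vint h (- b)"
    unfolding vint_def k_def by (rule Bochner_Integration.integral_diff) (use sh hh in auto)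
  hence "vint f (- b) = vint k (- b)" using hh by simp
  moreover have "norm (vint k (- b)) \<le> 4 * (12 * K * exp (- y * b))"
  proof (rule norm_vint_le[OF ki])
    fix t
    define w where "w = Complex (- b) t"
    have w: "norm w \<ge> 1 / 4" "norm w \<ge> \<bar>t\<bar>" using abs_Re_le_cmod[of w] abs_Im_le_cmod[of w] b by (auto simp: w_def)
    hence n5: "1 + \<bar>t\<bar> \<le> 5 * norm w" by simp
    have "norm (k w) = norm (E w - E 0) * exp (- y * b) / (norm w)\<^sup>2"
      by (simp add: k_def f_def h_def w_def norm_divide norm_mult norm_power flip: left_diff_distrib diff_divide_distrib)
    also have "\<dots> \<le> K * sqrt (norm w) * exp (- y * b) / (norm w)\<^sup>2"
      by (intro divide_right_mono mult_right_mono hoelder) (auto simp: w_def)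
    also have "\<dots> = K * exp (- y * b) * (sqrt (norm w) / (norm w)\<^sup>2)" by simp
    also have "sqrt (norm w) / (norm w)\<^sup>2 = (norm w) powr (- (3 / 2))"
    proof -
      have "sqrt (norm w) = norm w powr (1 / 2)" by (simp add: powr_half_sqrt)
      moreover have "(norm w)\<^sup>2 = norm w powr 2" using w by (intro powr_numeral[symmetric]) auto
      ultimately show ?thesis by (simp only: powr_diff[symmetric]) simp
    qed
    also have "K * exp (- y * b) * (norm w) powr (- (3 / 2)) \<le> K * exp (- y * b) * (12 * decay t)"
    proof (intro mult_left_mono)
      have "(5 * norm w) powr (- (3 / 2)) \<le> decay t"
        unfolding decay_def using n5 by (intro powr_mono2') auto
      hence "5 powr (- (3 / 2)) * norm w powr (- (3 / 2)) \<le> decay t" by (simp add: powr_mult)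
      hence "5 powr (3 / 2) * (5 powr (- (3 / 2)) * norm w powr (- (3 / 2))) \<le> 5 powr (3 / 2) * decay t"
        by (intro mult_left_mono) auto
      moreover have "(5::real) powr (3 / 2) * (5 powr (- (3 / 2)) * norm w powr (- (3 / 2))) = norm w powr (- (3 / 2))"
        by (simp add: powr_minus)
      moreover have "(5::real) powr (3 / 2) \<le> 12"
      proof -
        have "((5::real) powr (3 / 2))\<^sup>2 = 125" by (simp add: powr_power)
        also have "\<dots> \<le> 12\<^sup>2" by simp
        finally show ?thesis by (rule power2_le_imp_le) simp
      qed
      hence "(5::real) powr (3 / 2) * decay t \<le> 12 * decay t" by (intro mult_right_mono) auto
      ultimately show "norm w powr (- (3 / 2)) \<le> 12 * decay t" by linarith
    qed (use K in auto)
    finally show "norm (k (Complex (- b) t)) \<le> 12 * K * exp (- y * b) * decay t" by (simp add: w_def)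
  qed
  moreover have "vint f (- b) = vint f c - 2 * pi * (deriv E 0 + y * E 0)" using sh(3) by (simp add: algebra_simps)
  ultimately show "norm (vint f c - 2 * pi * (deriv E 0 + y * E 0)) \<le> 48 * K * exp (- y * b)" by simp
qed

section \<open>The digamma function\<close>

lemma Digamma_diff_sums:
  fixes z w :: complex
  assumes "z \<notin> \<int>\<^sub>\<le>\<^sub>0" "w \<notin> \<int>\<^sub>\<le>\<^sub>0"
  shows "(\<lambda>n. inverse (w + of_nat n) - inverse (z + of_nat n)) sums (Digamma z - Digamma w)"
proof -
  have s: "(\<lambda>n. inverse (of_nat (Suc n)) - inverse (z + of_nat n)) sums (Digamma z + euler_mascheroni)"
    if "z \<notin> \<int>\<^sub>\<le>\<^sub>0" for z :: complex
  proof -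
    have "summable (\<lambda>n. inverse (of_nat (Suc n)) - inverse (z + of_nat n))"
      using summable_Digamma[of z] that by auto
    thus ?thesis by (simp add: Digamma_def summable_sums)
  qed
  from sums_diff[OF s[OF assms(1)] s[OF assms(2)]] show ?thesis by simp
qed

lemma not_nonpos_Int_Re_pos: "Re z > 0 \<Longrightarrow> z \<notin> \<int>\<^sub>\<le>\<^sub>0"
  by (auto elim!: nonpos_Ints_cases)

lemma powr_minus_three_halves: "x > 0 \<Longrightarrow> x powr (- (3 / 2)) = inverse (sqrt x ^ 3)"
  by (simp add: powr_minus powr_half_sqrt[symmetric] powr_power)

text \<open>Integral comparison in telescoping form: a term is at most 2 / s - 2 / r for consecutive
  square roots s < r.\<close>

lemma sum_inverse_sqrt_cube_le:
  "(\<Sum>n<N. (real n + 1) powr (- (3 / 2))) \<le> 3"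
proof -
  have *: "(\<Sum>n<Suc N. (real n + 1) powr (- (3 / 2))) \<le> 3 - 2 / sqrt (real N + 1)" for N
  proof (induction N)
    case (Suc N)
    define s r where "s = sqrt (real N + 1)" and "r = sqrt (real N + 2)"
    have sr: "s > 0" "r > 0" "r\<^sup>2 = s\<^sup>2 + 1" "s \<le> r" by (auto simp: s_def r_def)
    have "s * (r + s) \<le> r * (r + r)" using sr by (intro mult_mono) auto
    hence "1 / r ^ 3 \<le> 2 / (r * (s * (r + s)))"
      using sr by (simp add: divide_simps power3_eq_cube)
    also have "\<dots> = 2 * (r\<^sup>2 - s\<^sup>2) / (r * (s * (r + s)))" using sr by simp
    also have "\<dots> = 2 / s - 2 / r"
    proof -
      have "r + s \<noteq> 0" using sr by linarith
      thus ?thesis using sr(1,2) by (simp add: divide_simps power2_eq_square) (simp add: algebra_simps)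
    qed
    finally have "(real (Suc N) + 1) powr (- (3 / 2)) \<le> 2 / s - 2 / r"
      by (subst powr_minus_three_halves) (simp_all add: r_def divide_inverse add_ac)
    thus ?case using Suc by (simp add: s_def r_def add_ac)
  qed simp
  have "(\<Sum>n<N. (real n + 1) powr (- (3 / 2))) \<le> (\<Sum>n<Suc N. (real n + 1) powr (- (3 / 2)))" by simp
  also note *[of N]
  also have "3 - 2 / sqrt (real N + 1) \<le> 3" by simp
  finally show ?thesis .
qed

text \<open>A term of the difference series is at most |z - w| / m^2 and at most 2 / m with m = (n +
  1) / 8. The geometric mean of these bounds is a multiple of sqrt |z - w| * (n + 1)^(-3/2), which
  is summable.\<close>

lemma Digamma_Hoelder:
  fixes z w :: complex
  assumes z: "Re z \<ge> 1 / 8" and w: "Re w \<ge> 1 / 8"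
  shows "norm (Digamma z - Digamma w) \<le> 100 * sqrt (norm (z - w))"
proof -
  define h where "h n = inverse (w + of_nat n) - inverse (z + of_nat n)" for n
  have ni: "z \<notin> \<int>\<^sub>\<le>\<^sub>0" "w \<notin> \<int>\<^sub>\<le>\<^sub>0"
    using z w by (auto intro!: not_nonpos_Int_Re_pos)
  have sums: "h sums (Digamma z - Digamma w)"
    unfolding h_def by (rule Digamma_diff_sums[OF ni])
  define B where "B n = 8 * sqrt 8 * sqrt 2 * sqrt (norm (z - w)) * (real n + 1) powr (- (3 / 2))" for n
  have hB: "norm (h n) \<le> B n" for n
  proof -
    define m where "m = (real n + 1) / 8"
    have m: "m > 0" by (simp add: m_def)
    have nz: "norm (z + of_nat n) \<ge> m" "norm (w + of_nat n) \<ge> m"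
      using z w abs_Re_le_cmod[of "z + of_nat n"] abs_Re_le_cmod[of "w + of_nat n"] by (auto simp: m_def)
    hence nz0: "z + of_nat n \<noteq> 0" "w + of_nat n \<noteq> 0" using m by auto
    have "h n = (z - w) / ((w + of_nat n) * (z + of_nat n))"
      using nz0 by (simp add: h_def divide_simps)
    hence "norm (h n) = norm (z - w) / (norm (w + of_nat n) * norm (z + of_nat n))"
      by (simp add: norm_divide norm_mult)
    also have "\<dots> \<le> norm (z - w) / (m * m)"
      using nz m by (intro divide_left_mono mult_mono mult_pos_pos) auto
    finally have 1: "norm (h n) \<le> norm (z - w) / m\<^sup>2" by (simp add: power2_eq_square)
    have "norm (h n) \<le> inverse (norm (w + of_nat n)) + inverse (norm (z + of_nat n))"
      unfolding h_def using norm_triangle_ineq4 by (metis norm_inverse)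
    also have "\<dots> \<le> inverse m + inverse m"
      using nz m by (intro add_mono le_imp_inverse_le) auto
    finally have 2: "norm (h n) \<le> 2 / m" by (simp add: divide_inverse)
    have "norm (h n) * norm (h n) \<le> (norm (z - w) / m\<^sup>2) * (2 / m)"
      using 1 2 m by (intro mult_mono) auto
    hence "(norm (h n))\<^sup>2 \<le> 2 * norm (z - w) / m ^ 3" by (simp add: power2_eq_square power3_eq_cube mult_ac)
    hence "norm (h n) \<le> sqrt (2 * norm (z - w) / m ^ 3)" by (rule real_le_rsqrt)
    also have "\<dots> = sqrt 2 * sqrt (norm (z - w)) * sqrt (inverse (m ^ 3))"
      by (simp add: real_sqrt_mult real_sqrt_divide divide_inverse real_sqrt_inverse)
    also have "sqrt (inverse (m ^ 3)) = 8 * sqrt 8 * (real n + 1) powr (- (3 / 2))"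
    proof (rule real_sqrt_unique)
      have "((real n + 1) powr (- (3 / 2)))\<^sup>2 = inverse ((real n + 1) ^ 3)"
      proof -
        have "(inverse (sqrt (real n + 1) ^ 3))\<^sup>2 = inverse (((sqrt (real n + 1))\<^sup>2) ^ 3)"
          unfolding power_inverse power_mult[symmetric] by simp
        thus ?thesis by (simp add: powr_minus_three_halves)
      qed
      moreover have "inverse (m ^ 3) = 512 * inverse ((real n + 1) ^ 3)"
        unfolding m_def power_divide by (simp add: inverse_eq_divide)
      moreover have "(8 * sqrt 8)\<^sup>2 = (512 :: real)" by (simp add: power_mult_distrib)
      ultimately show "(8 * sqrt 8 * (real n + 1) powr (- (3 / 2)))\<^sup>2 = inverse (m ^ 3)"
        by (simp only: power_mult_distrib)
    qed auto
    finally show ?thesis by (simp add: B_def mult_ac)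
  qed
  have "norm (\<Sum>n<N. h n) \<le> 100 * sqrt (norm (z - w))" for N
  proof -
    have "norm (\<Sum>n<N. h n) \<le> (\<Sum>n<N. B n)" by (rule order.trans[OF norm_sum sum_mono[OF hB]])
    also have "\<dots> = 8 * sqrt 8 * sqrt 2 * sqrt (norm (z - w)) * (\<Sum>n<N. (real n + 1) powr (- (3 / 2)))"
      by (simp add: B_def sum_distrib_left)
    also have "\<dots> \<le> 8 * sqrt 8 * sqrt 2 * sqrt (norm (z - w)) * 3"
      by (intro mult_left_mono sum_inverse_sqrt_cube_le) auto
    also have "8 * sqrt 8 * sqrt 2 * sqrt (norm (z - w)) * 3 = 96 * sqrt (norm (z - w))"
    proof -
      have "sqrt 8 * sqrt 2 = 4" by (simp add: real_sqrt_mult[symmetric])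
      thus ?thesis by (simp add: mult.assoc)
    qed
    also have "\<dots> \<le> 100 * sqrt (norm (z - w))" by simp
    finally show ?thesis .
  qed
  moreover have "(\<lambda>N. norm (\<Sum>n<N. h n)) \<longlonglongrightarrow> norm (Digamma z - Digamma w)"
    using sums unfolding sums_def by (intro tendsto_intros)
  ultimately show ?thesis by (intro LIMSEQ_le_const2) auto
qed

text \<open>Term by term in the difference series: Re (1 / (z + n)) \<le> 1 / |z + n| \<le> 1 / (x +
  n).\<close>

lemma Re_Digamma_ge:
  assumes "Re z \<ge> x" "x > 0"
  shows "Re (Digamma z) \<ge> (Digamma x :: real)"
proof -
  have ni: "z \<notin> \<int>\<^sub>\<le>\<^sub>0" "complex_of_real x \<notin> \<int>\<^sub>\<le>\<^sub>0"
    using assms by (auto intro!: not_nonpos_Int_Re_pos)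
  have s: "(\<lambda>n. Re (inverse (of_real x + of_nat n) - inverse (z + of_nat n))) sums Re (Digamma z - Digamma (of_real x))"
    by (intro sums_Re Digamma_diff_sums ni)
  have nn: "Re (inverse (of_real x + of_nat n) - inverse (z + of_nat n)) \<ge> 0" for n
  proof -
    have p: "x + real n \<le> norm (z + of_nat n)" using assms abs_Re_le_cmod[of "z + of_nat n"] by auto
    have "Re (inverse (z + of_nat n)) \<le> norm (inverse (z + of_nat n))" by (rule complex_Re_le_cmod)
    also have "\<dots> = inverse (norm (z + of_nat n))" by (rule norm_inverse)
    also have "\<dots> \<le> inverse (x + real n)" using p assms by (intro le_imp_inverse_le) auto
    also have "\<dots> = Re (inverse (of_real x + of_nat n))"
      by (metis Re_complex_of_real of_real_add of_real_inverse of_real_of_nat_eq)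
    finally show ?thesis by simp
  qed
  have "0 \<le> Re (Digamma z - Digamma (of_real x))"
    by (rule sums_le[OF nn sums_zero s])
  thus ?thesis using assms by (simp add: Polygamma_of_real)
qed

lemma Digamma_at_top: "filterlim (\<lambda>n. Digamma (real n)) at_top sequentially"
proof (subst filterlim_sequentially_Suc[symmetric])
  have "filterlim (\<lambda>n. - euler_mascheroni + harm n :: real) at_top sequentially"
    by (rule filterlim_tendsto_add_at_top[OF tendsto_const harm_at_top])
  thus "filterlim (\<lambda>n. Digamma (real (Suc n))) at_top sequentially"
    by (simp only: Digamma_of_nat) simp
qed

text \<open>The partial sums of Re (1 / (z + n)) dominate the telescoping differences of ln |z + n|
  up to errors O(1 / n^2). The comparison starts at n = 2, where |1 / (z + n)| \<le> 1/2; the way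
  back from z + 2 to z costs ln 9 \<le> 3, as |z| \<ge> 1/4. A bounded error per gamma factor ends
  up as O(d / y) in the final estimate.\<close>

lemma Re_Digamma_le:
  assumes "Re z \<ge> 1 / 4"
  shows "Re (Digamma z) \<le> ln (norm z) + 5"
proof -
  have ni: "z \<notin> \<int>\<^sub>\<le>\<^sub>0" using assms by (auto intro!: not_nonpos_Int_Re_pos)
  have nz: "norm z \<ge> 1 / 4" using assms abs_Re_le_cmod[of z] by linarith
  have step1: "ln (norm (z + of_nat n + 1)) - ln (norm (z + of_nat n)) \<le> Re (inverse (z + of_nat n)) + 2 * (inverse (real n) - inverse (real (Suc n)))"
    if n: "n \<ge> 2" for n
  proof -
    define v where "v = inverse (z + of_nat n)"
    have zn: "norm (z + of_nat n) \<ge> real n" "z + of_nat n \<noteq> 0"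
      using assms abs_Re_le_cmod[of "z + of_nat n"] n by (auto simp: complex_eq_iff)
    have v: "norm v \<le> inverse (real n)" unfolding v_def norm_inverse using zn n by (intro le_imp_inverse_le) auto
    also have "\<dots> \<le> 1 / 2" using n by (simp add: field_simps)
    finally have v2: "norm v \<le> 1 / 2" .
    have "norm (1 + v) \<ge> 1 / 2" using v2 norm_triangle_ineq4[of "1 + v" v] by simp
    hence p: "norm (1 + v) > 0" by linarith
    \<comment> \<open>The inequality ln u \<le> u - 1 is applied to |1 + v|^2, whose linear part is
      2 Re v.\<close>
    have "(norm (1 + v))\<^sup>2 = 1 + 2 * Re v + (norm v)\<^sup>2"
      unfolding cmod_power2 by (simp add: power2_eq_square algebra_simps)
    moreover have "ln ((norm (1 + v))\<^sup>2) \<le> (norm (1 + v))\<^sup>2 - 1" using p by (intro ln_le_minus_one) auto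
    moreover have "ln ((norm (1 + v))\<^sup>2) = 2 * ln (norm (1 + v))" using p by (subst ln_realpow) auto
    ultimately have "2 * ln (norm (1 + v)) \<le> 2 * Re v + (norm v)\<^sup>2" by linarith
    moreover have "(norm v)\<^sup>2 \<le> (inverse (real n))\<^sup>2" using v by (intro power_mono) auto
    moreover have "(inverse (real n))\<^sup>2 \<le> 4 * (inverse (real n) - inverse (real (Suc n)))"
    proof -
      have d: "inverse (real n) - inverse (real (Suc n)) = inverse (real n * real (Suc n))"
        using n by (simp add: field_simps)
      have le: "inverse (4 * (real n * real n)) \<le> inverse (real n * real (Suc n))"
      proof (rule le_imp_inverse_le)
        have "real n * real (Suc n) \<le> real n * (4 * real n)" using n by (intro mult_left_mono) auto
        thus "real n * real (Suc n) \<le> 4 * (real n * real n)" by (simp only: mult_ac)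
      qed (use n in auto)
      have "(inverse (real n))\<^sup>2 = 4 * inverse (4 * (real n * real n))"
        unfolding inverse_mult_distrib power2_eq_square by simp
      also have "\<dots> \<le> 4 * inverse (real n * real (Suc n))" by (rule mult_left_mono[OF le]) simp
      finally show ?thesis unfolding d .
    qed
    moreover define q where "q = inverse (real n) - inverse (real (Suc n))"
    ultimately have "ln (norm (1 + v)) \<le> Re v + 2 * (inverse (real n) - inverse (real (Suc n)))"
      unfolding q_def[symmetric] by linarith
    moreover have "z + of_nat n + 1 = (z + of_nat n) * (1 + v)" using zn(2) by (simp add: v_def distrib_left)
    hence "ln (norm (z + of_nat n + 1)) = ln (norm (z + of_nat n)) + ln (norm (1 + v))"
      using zn p by (simp add: norm_mult ln_mult)
    ultimately show ?thesis unfolding v_def[symmetric] by linarith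
  qed
  have tele: "ln (norm (z + of_nat m)) - ln (norm (z + 2)) \<le> (\<Sum>n=2..<m. Re (inverse (z + of_nat n))) + 2 * (inverse 2 - inverse (real m))"
    if "m \<ge> 2" for m
    using that
  proof (induction m rule: dec_induct)
    case (step m)
    have e: "z + of_nat (Suc m) = z + of_nat m + 1" by simp
    have s: "(\<Sum>n=2..<Suc m. Re (inverse (z + of_nat n))) = (\<Sum>n=2..<m. Re (inverse (z + of_nat n))) + Re (inverse (z + of_nat m))"
      using step by (intro sum.atLeastLessThan_Suc) auto
    show ?case using step(3) step1[OF step(1)] unfolding e s right_diff_distrib by linarith
  qed simp
  have z2: "ln (norm (z + 2)) \<le> ln (norm z) + 3"
  proof -
    have "norm (z + 2) \<le> norm z + 2" using norm_triangle_ineq[of z 2] by simp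
    also have "\<dots> \<le> 9 * norm z" using nz by simp
    finally have "ln (norm (z + 2)) \<le> ln (9 * norm z)" using nz assms by (intro ln_mono) (auto simp: complex_eq_iff)
    also have "\<dots> = ln 9 + ln (norm z)" using nz by (intro ln_mult_pos) auto
    also have "ln (9::real) \<le> 3" 
    proof -
      have "(9::real) \<le> (1 + 3 / real 6) ^ 6" by (simp add: power_divide eval_nat_numeral)
      also have "\<dots> \<le> exp 3" by (rule exp_ge_one_plus_x_over_n_power_n) auto
      finally have "ln 9 \<le> ln (exp (3::real))" by (intro ln_mono) auto
      thus ?thesis by simp
    qed
    finally show ?thesis by simp
  qed
  have ev: "ln (real m) - (\<Sum>n<m. Re (inverse (z + of_nat n))) \<le> ln (norm z) + 5" if m: "m \<ge> 2" for m
  proof -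
    have "ln (real m) \<le> ln (norm (z + of_nat m))"
      using assms abs_Re_le_cmod[of "z + of_nat m"] m by (intro ln_mono) auto
    moreover have "(\<Sum>n=2..<m. Re (inverse (z + of_nat n))) \<le> (\<Sum>n<m. Re (inverse (z + of_nat n)))"
    proof (rule sum_mono2)
      show "0 \<le> Re (inverse (z + of_nat b))" for b using assms by (auto intro!: divide_nonneg_nonneg)
    qed auto
    moreover have "inverse (real m) \<ge> 0" by simp
    moreover have "2 * (inverse 2 - inverse (real m)) = 1 - 2 * inverse (real m)" by simp
    ultimately show ?thesis using tele[OF m] z2 by linarith
  qed
  have "(\<lambda>m. of_real (ln (real m)) - (\<Sum>n<m. inverse (z + of_nat n))) \<longlonglongrightarrow> Digamma z"
    using Digamma_LIMSEQ[of z] ni by auto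
  from tendsto_Re[OF this] have "(\<lambda>m. ln (real m) - (\<Sum>n<m. Re (inverse (z + of_nat n)))) \<longlonglongrightarrow> Re (Digamma z)"
    by (simp add: Re_sum)
  thus ?thesis
  proof (rule tendsto_upperbound)
    show "\<forall>\<^sub>F m in sequentially. ln (real m) - (\<Sum>n<m. Re (inverse (z + of_nat n))) \<le> ln (norm z) + 5"
      using eventually_ge_at_top[of 2] by eventually_elim (rule ev)
  qed simp
qed

section \<open>Dirichlet series and the Euler product\<close>

definition dseries :: "(nat \<Rightarrow> complex) \<Rightarrow> complex \<Rightarrow> complex" where
  "dseries c s = (\<Sum>n. c (Suc n) * of_nat (Suc n) powr (- s))"

lemma dseries_abs_summable:
  fixes c :: "nat \<Rightarrow> complex" and s :: complex
  assumes c: "\<And>n. n \<ge> 1 \<Longrightarrow> norm (c n) \<le> M" and s: "Re s > 1"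
  shows "summable (\<lambda>n. norm (c (Suc n) * of_nat (Suc n) powr (- s)))"
proof (rule summable_comparison_test')
  show "summable (\<lambda>n. M * real (Suc n) powr (- Re s))"
    using s by (intro summable_mult summable_Suc_powr) auto
  show "norm (norm (c (Suc n) * of_nat (Suc n) powr (- s))) \<le> M * real (Suc n) powr (- Re s)" for n
    using c[of "Suc n"] by (auto simp: norm_mult norm_Suc_powr simp del: of_nat_Suc intro!: mult_right_mono)
qed

lemma dseries_ln_abs_summable:
  fixes c :: "nat \<Rightarrow> complex" and s :: complex
  assumes c: "\<And>n. n \<ge> 1 \<Longrightarrow> norm (c n) \<le> M" and s: "Re s > 1"
  shows "summable (\<lambda>n. norm (c (Suc n) * ln (real (Suc n)) * of_nat (Suc n) powr (- s)))"
proof (rule summable_comparison_test')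
  define e where "e = (Re s - 1) / 2"
  have e: "e > 0" using s by (simp add: e_def)
  show "summable (\<lambda>n. M / e * real (Suc n) powr (e - Re s))"
    using s by (intro summable_mult summable_Suc_powr) (auto simp: e_def field_simps)
  have M: "M \<ge> 0" using order_trans[OF norm_ge_zero c[of 1]] by simp
  show "norm (norm (c (Suc n) * ln (real (Suc n)) * of_nat (Suc n) powr (- s))) \<le> M / e * real (Suc n) powr (e - Re s)" for n
  proof -
    have "norm (c (Suc n) * ln (real (Suc n)) * of_nat (Suc n) powr (- s)) = norm (c (Suc n)) * ln (real (Suc n)) * real (Suc n) powr (- Re s)"
      by (simp add: norm_mult norm_Suc_powr del: of_nat_Suc)
    also have "\<dots> \<le> M * (real (Suc n) powr e / e) * real (Suc n) powr (- Re s)"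
      using c[of "Suc n"] e M by (intro mult_right_mono mult_mono ln_powr_bound) auto
    also have "\<dots> = M / e * real (Suc n) powr (e - Re s)"
      by (simp add: powr_diff powr_minus divide_inverse)
    finally show ?thesis by simp
  qed
qed

lemma dseries_has_derivative:
  fixes c :: "nat \<Rightarrow> complex" and s :: complex
  assumes c: "\<And>n. n \<ge> 1 \<Longrightarrow> norm (c n) \<le> M" and s: "Re s > 1"
  shows "(dseries c has_field_derivative - dseries (\<lambda>n. c n * ln (real n)) s) (at s)"
proof -
  define S where "S = {z. Re z > (1 + Re s) / 2}"
  define f where "f = (\<lambda>n z. c (Suc n) * of_nat (Suc n) powr (- z))"
  define f' where "f' = (\<lambda>n z. - (c (Suc n) * ln (real (Suc n)) * of_nat (Suc n) powr (- z)))"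
  have M: "M \<ge> 0" using order_trans[OF norm_ge_zero c[of 1]] by simp
  have "open S" unfolding S_def by (rule open_halfspace_Re_gt)
  moreover have "summable (\<lambda>n. M * real (Suc n) powr (- ((1 + Re s) / 2)))"
    using s by (intro summable_mult summable_Suc_powr) auto
  moreover have "(f n has_field_derivative f' n z) (at z)" if "z \<in> S" for n z
  proof -
    have "of_nat (Suc n) powr (- x) = exp (- x * of_real (ln (real (Suc n))))" for x :: complex
      by (simp add: powr_def Ln_of_nat del: of_nat_Suc)
    thus ?thesis
      unfolding f_def f'_def by (auto intro!: derivative_eq_intros simp del: of_nat_Suc)
  qed
  moreover have "\<forall>\<^sub>F n in sequentially. \<forall>x\<in>S. norm (f n x) \<le> M * real (Suc n) powr (- ((1 + Re s) / 2))"
  proof (intro always_eventually allI ballI)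
    fix n x assume "x \<in> S"
    thus "norm (f n x) \<le> M * real (Suc n) powr (- ((1 + Re s) / 2))"
      unfolding f_def norm_mult norm_Suc_powr using c[of "Suc n"] M
      by (intro mult_mono powr_mono) (auto simp: S_def)
  qed
  ultimately obtain g g' where g: "\<forall>x \<in> S. ((\<lambda>n. f n x) sums g x) \<and> ((\<lambda>n. f' n x) sums g' x) \<and> (g has_field_derivative g' x) (at x)"
    by (rule series_and_derivative_comparison)
  have sS: "s \<in> S" using s by (simp add: S_def)
  have eq: "g x = dseries c x" if "x \<in> S" for x
    using g that by (auto simp: dseries_def f_def sums_iff)
  have "g' s = - dseries (\<lambda>n. c n * ln (real n)) s"
  proof -
    have "(\<lambda>n. - f' n s) sums - g' s" by (rule sums_minus) (use g sS in auto)
    thus ?thesis by (simp add: dseries_def f'_def sums_iff)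
  qed
  moreover have "(dseries c has_field_derivative g' s) (at s)"
    using has_field_derivative_transform_within_open[of g "g' s" s S "dseries c"] g sS eq \<open>open S\<close> by auto
  ultimately show ?thesis by simp
qed

text \<open>\<open>lcoeff f\<close> and \<open>logcoeff f\<close> are the Dirichlet coefficients of \<open>- L'/L\<close> and \<open>log L\<close>.\<close>

definition lcoeff :: "L_data \<Rightarrow> nat \<Rightarrow> complex" where
  "lcoeff f n = mangoldt n * (\<Sum>i<deg f. alpha f i (aprimedivisor n) ^ multiplicity (aprimedivisor n) n)"

lemma norm_lcoeff_le:
  assumes "ramanujan f"
  shows "norm (lcoeff f n) \<le> real (deg f) * mangoldt n"
proof (cases "primepow n")
  case True
  hence "prime (aprimedivisor n)"
    by (intro prime_aprimedivisor') (auto simp: primepow_def prime_gt_0_nat)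
  hence "norm (\<Sum>i<deg f. alpha f i (aprimedivisor n) ^ multiplicity (aprimedivisor n) n) \<le> (\<Sum>i<deg f. 1)"
    using assms by (intro sum_norm_le) (auto simp: norm_power ramanujan_def intro!: power_le_one)
  hence "mangoldt n * norm (\<Sum>i<deg f. alpha f i (aprimedivisor n) ^ multiplicity (aprimedivisor n) n) \<le> mangoldt n * real (deg f)"
    by (intro mult_left_mono mangoldt_nonneg) simp
  thus ?thesis by (simp add: lcoeff_def norm_mult mult_ac)
qed (auto simp: lcoeff_def mangoldt_def)

lemma lcoeff_prime_power:
  assumes "prime p"
  shows "lcoeff f (p ^ Suc k) = ln (real p) * (\<Sum>i<deg f. alpha f i p ^ Suc k)"
  using assms mangoldt_primepow'[OF assms, of "Suc k", where ?'a = complex]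
  by (simp add: lcoeff_def aprimedivisor_prime_power del: power_Suc mangoldt_primepow')

definition logcoeff :: "L_data \<Rightarrow> nat \<Rightarrow> complex" where
  "logcoeff f n = lcoeff f n / ln (real n)"

lemma norm_logcoeff_le:
  assumes "ramanujan f" "n \<ge> 1"
  shows "norm (logcoeff f n) \<le> real (deg f)"
proof (cases "n = 1")
  case False
  with assms have "ln (real n) > 0" by simp
  moreover have "norm (lcoeff f n) \<le> real (deg f) * ln (real n)"
    using norm_lcoeff_le[OF assms(1), of n] mangoldt_le[of n] assms(2)
    by (meson mult_left_mono of_nat_0_le_iff order_trans less_le_trans zero_less_one)
  ultimately show ?thesis by (simp add: logcoeff_def norm_divide divide_le_eq)
qed (auto simp: logcoeff_def)

lemma logcoeff_ln: "logcoeff f n * ln (real n) = lcoeff f n"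
proof (cases "n \<le> 1")
  case True
  hence "n = 0 \<or> n = 1" by auto
  thus ?thesis by (auto simp: logcoeff_def lcoeff_def)
qed (auto simp: logcoeff_def)

lemma has_sum_finite_sum:
  fixes h :: "'i \<Rightarrow> 'k \<Rightarrow> complex"
  assumes "finite I" "\<And>i. i \<in> I \<Longrightarrow> (h i has_sum x i) A"
  shows "((\<lambda>k. \<Sum>i\<in>I. h i k) has_sum (\<Sum>i\<in>I. x i)) A"
  using assms by (induction I) (auto intro!: has_sum_add)

text \<open>Absolute convergence allows the sum over prime powers to be regrouped along (p, k) to
  p^(k + 1). The inner sums are logarithms of the local factors, with arguments kept in the unit
  disc by Ramanujan's bound, and the exponentials of the partial sums over p are the partial Euler
  products.\<close>

lemma L_series_eq_exp:
  assumes L: "is_L_function f" and R: "ramanujan f" and s: "Re s > 1"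
  shows "L_series f s = exp (dseries (logcoeff f) s)"
proof -
  define g where "g n = logcoeff f n * of_nat n powr (- s)" for n
  define S where "S = dseries (logcoeff f) s"
  have sm: "summable (\<lambda>n. norm (g (Suc n)))"
    unfolding g_def by (rule dseries_abs_summable[OF norm_logcoeff_le[OF R] s])
  have "(\<lambda>n. g (Suc n)) sums S"
    using summable_norm_cancel[OF sm] by (simp add: S_def dseries_def g_def summable_sums)
  hence "((\<lambda>n. g (Suc n)) has_sum S) UNIV" by (rule norm_summable_imp_has_sum[OF sm])
  hence "(g has_sum S) (range Suc)" by (subst has_sum_reindex) (auto simp: o_def)
  hence gs: "(g has_sum S) (Collect primepow)"
    by (rule has_sum_cong_neutral[THEN iffD1, rotated 3])
       (auto simp: g_def logcoeff_def lcoeff_def mangoldt_def image_iff intro: Suc_pred[symmetric] primepow_gt_0_nat)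
  define t where "t p k = (\<Sum>i<deg f. (alpha f i p * of_nat p powr (- s)) ^ Suc k / of_nat (Suc k))" for p k
  have gt: "g (p ^ Suc k) = t p k" if p: "prime p" for p k
  proof -
    have lnp: "ln (real p) > 0" using prime_gt_1_nat[OF p] by simp
    have p0: "p > 0" using prime_gt_0_nat[OF p] .
    have l: "ln (real (p ^ Suc k)) = real (Suc k) * ln (real p)"
      using p0 by (simp only: of_nat_power ln_realpow of_nat_0_less_iff)
    have e: "of_nat m powr (- s) = exp (- s * of_real (ln (real m)))" if "m > 0" for m
      using that by (simp add: powr_def Ln_of_nat)
    have pw: "of_nat (p ^ Suc k) powr (- s) = (of_nat p powr (- s)) ^ Suc k"
    proof -
      have "of_nat (p ^ Suc k) powr (- s) = exp (of_nat (Suc k) * (- s * of_real (ln (real p))))"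
        unfolding e[OF zero_less_power[OF p0]] l by (simp only: of_real_mult of_real_of_nat_eq mult_ac)
      thus ?thesis unfolding e[OF p0] exp_of_nat_mult .
    qed
    have "g (p ^ Suc k) = (\<Sum>i<deg f. alpha f i p ^ Suc k) / of_nat (Suc k) * (of_nat p powr (- s)) ^ Suc k"
      unfolding g_def logcoeff_def l pw lcoeff_prime_power[OF p] using lnp by (simp del: power_Suc of_nat_Suc)
    also have "\<dots> = t p k"
      unfolding t_def by (simp add: sum_divide_distrib sum_distrib_right power_mult_distrib del: power_Suc of_nat_Suc)
    finally show ?thesis .
  qed
  have small: "norm (alpha f i p * of_nat p powr (- s)) < 1" if p: "prime p" "i < deg f" for i p
  proof -
    have p1: "real p > 1" using prime_gt_1_nat[OF p(1)] by simp
    have "norm (of_nat p powr (- s)) = real p powr (- Re s)"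
      using norm_powr_real_powr[of "of_nat p" "- s"] p1 by simp
    also have "\<dots> < 1" using p1 s by (intro powr_less_one) auto
    finally have "norm (of_nat p powr (- s)) < 1" .
    moreover have "norm (alpha f i p) \<le> 1" using R p by (auto simp: ramanujan_def)
    ultimately show ?thesis unfolding norm_mult
      by (meson mult_left_le_one_le mult_less_le_imp_less norm_ge_zero mult_right_le_one_le le_less_trans)
  qed
  define \<Phi> where "\<Phi> p = (\<Sum>i<deg f. - ln (1 - alpha f i p * of_nat p powr (- s)))" for p
  have inner: "((\<lambda>k. t p k) has_sum \<Phi> p) UNIV" if p: "prime p" for p
    unfolding t_def \<Phi>_def
  proof (intro has_sum_finite_sum finite_lessThan)
    fix i assume i: "i \<in> {..<deg f}"
    define z where "z = alpha f i p * of_nat p powr (- s)"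
    have z: "norm z < 1" using small[OF p] i by (simp add: z_def)
    show "((\<lambda>k. z ^ Suc k / of_nat (Suc k)) has_sum - ln (1 - z)) UNIV"
    proof (rule norm_summable_imp_has_sum)
      have "(\<lambda>n. - ((- (- z)) ^ n) / of_nat n) sums ln (1 + (- z))"
        by (rule Ln_series') (use z in auto)
      hence "(\<lambda>n. - (- ((- (- z)) ^ n) / of_nat n)) sums - ln (1 + (- z))" by (rule sums_minus)
      hence "(\<lambda>n. z ^ n / of_nat n) sums - ln (1 - z)" by simp
      thus "(\<lambda>k. z ^ Suc k / of_nat (Suc k)) sums - ln (1 - z)"
        by (subst sums_Suc_iff) simp
      show "summable (\<lambda>k. norm (z ^ Suc k / of_nat (Suc k)))"
      proof (rule summable_comparison_test')
        show "summable (\<lambda>k. norm z ^ k)" using z by (intro summable_geometric) auto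
        show "norm (norm (z ^ Suc k / of_nat (Suc k))) \<le> norm z ^ k" for k
        proof -
          have "norm z ^ Suc k / real (Suc k) \<le> norm z ^ Suc k / 1"
            by (intro divide_left_mono) auto
          also have "\<dots> \<le> norm z ^ k" using z by (simp add: mult_left_le_one_le)
          finally show ?thesis by (simp add: norm_divide norm_power del: power_Suc of_nat_Suc)
        qed
      qed
    qed
  qed
  have "((\<lambda>(p, k). t p k) has_sum S) (Collect prime \<times> UNIV)"
  proof -
    have "((\<lambda>x. g (case x of (p, k) \<Rightarrow> p ^ Suc k)) has_sum S) (Collect prime \<times> UNIV)"
      using gs by (subst has_sum_reindex_bij_betw[OF bij_betw_primepows])
    thus ?thesis by (rule has_sum_cong[THEN iffD1, rotated]) (auto simp: gt simp del: power_Suc)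
  qed
  hence "(\<Phi> has_sum S) (Collect prime)"
    by (rule has_sum_Sigma') (use inner in auto)
  hence "((\<lambda>p. if prime p then \<Phi> p else 0) has_sum S) UNIV"
    by (rule has_sum_cong_neutral[THEN iffD1, rotated 3]) auto
  hence sums: "(\<lambda>p. if prime p then \<Phi> p else 0) sums S" by (rule has_sum_imp_sums)
  have "exp (\<Sum>p<n. if prime p then \<Phi> p else 0) = (\<Prod>p<n. if prime p then \<Prod>i<deg f. euler_factor f i s p else 1)" for n
  proof -
    have "exp (\<Sum>p<n. if prime p then \<Phi> p else 0) = (\<Prod>p<n. exp (if prime p then \<Phi> p else 0))"
      by (rule exp_sum) simp
    also have "\<dots> = (\<Prod>p<n. if prime p then \<Prod>i<deg f. euler_factor f i s p else 1)"
    proof (intro prod.cong refl)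
      fix p
      show "exp (if prime p then \<Phi> p else 0) = (if prime p then \<Prod>i<deg f. euler_factor f i s p else 1)"
      proof (cases "prime p")
        case True
        have "exp (\<Phi> p) = (\<Prod>i<deg f. exp (- ln (1 - alpha f i p * of_nat p powr (- s))))"
          unfolding \<Phi>_def by (rule exp_sum) simp
        also have "\<dots> = (\<Prod>i<deg f. euler_factor f i s p)"
        proof (intro prod.cong refl)
          fix i assume "i \<in> {..<deg f}"
          hence "1 - alpha f i p * of_nat p powr (- s) \<noteq> 0" using small[OF True, of i] by auto
          thus "exp (- ln (1 - alpha f i p * of_nat p powr (- s))) = euler_factor f i s p"
            by (simp add: euler_factor_def exp_minus)
        qed
        finally show ?thesis using True by simp
      qed auto
    qed
    finally show ?thesis .
  qed
  moreover have "(\<lambda>n. exp (\<Sum>p<n. if prime p then \<Phi> p else 0)) \<longlonglongrightarrow> exp S"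
    using sums unfolding sums_def by (intro tendsto_exp)
  moreover have "(\<lambda>p. if prime p then \<Prod>i<deg f. euler_factor f i s p else 1) has_prod L_series f s"
    using L s unfolding is_L_function_def by blast
  hence "(\<lambda>n. \<Prod>p<n. if prime p then \<Prod>i<deg f. euler_factor f i s p else 1) \<longlonglongrightarrow> L_series f s"
    by (rule has_prod_imp_tendsto')
  ultimately show ?thesis unfolding S_def using LIMSEQ_unique by simp
qed

text \<open>Since the first coefficient vanishes, n \<ge> 2 and n^(3 - x) \<le> 2^(3 - x) for x
  \<ge> 3; this factor is pulled out of a multiple of the series of n^(-2).\<close>

lemma dseries_tendsto_0:
  assumes c: "\<And>n. n \<ge> 1 \<Longrightarrow> norm (c n) \<le> M * real n" and c1: "c 1 = 0"
  shows "((\<lambda>x::real. dseries c (of_real x)) \<longlongrightarrow> 0) at_top"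
proof -
  define Z where "Z = (\<Sum>n. real (Suc n) powr (- 2))"
  have sm: "summable (\<lambda>n. real (Suc n) powr (- 2))" by (rule summable_Suc_powr) simp
  have M: "M \<ge> 0" using order_trans[OF norm_ge_zero c[of 1]] by simp
  have b: "norm (dseries c (of_real x)) \<le> M * Z * 2 powr (3 - x)" if x: "x \<ge> 3" for x
  proof -
    have t: "norm (c (Suc n) * of_nat (Suc n) powr (- of_real x)) \<le> M * 2 powr (3 - x) * real (Suc n) powr (- 2)" for n
    proof (cases "n = 0")
      case False
      have "norm (c (Suc n) * of_nat (Suc n) powr (- of_real x)) = norm (c (Suc n)) * real (Suc n) powr (- x)"
        unfolding norm_mult norm_Suc_powr by simp
      also have "\<dots> \<le> M * real (Suc n) powr 1 * real (Suc n) powr (- x)"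
        using c[of "Suc n"] by (intro mult_right_mono) auto
      also have "\<dots> = M * (real (Suc n) powr (3 - x) * real (Suc n) powr (- 2))"
        unfolding mult.assoc powr_add[symmetric] by (simp add: algebra_simps)
      also have "\<dots> \<le> M * (2 powr (3 - x) * real (Suc n) powr (- 2))"
        using False x M by (intro mult_left_mono mult_right_mono powr_mono2') auto
      finally show ?thesis by (simp add: mult_ac)
    qed (use c1 M in auto)
    have "summable (\<lambda>n. norm (c (Suc n) * of_nat (Suc n) powr (- of_real x)))"
      by (rule summable_comparison_test'[OF summable_mult[OF sm, of "M * 2 powr (3 - x)"]]) (use t in auto)
    hence "norm (dseries c (of_real x)) \<le> (\<Sum>n. M * 2 powr (3 - x) * real (Suc n) powr (- 2))"
      unfolding dseries_def by (intro order.trans[OF summable_norm suminf_le] t summable_mult sm)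
    also have "\<dots> = M * Z * 2 powr (3 - x)" by (simp only: suminf_mult[OF sm] Z_def) (simp only: mult_ac)
    finally show ?thesis .
  qed
  have "((\<lambda>x::real. M * Z * 2 powr (3 - x)) \<longlongrightarrow> 0) at_top" by real_asymp
  thus ?thesis
    by (rule Lim_null_comparison[rotated]) (use b in \<open>auto intro: eventually_mono[OF eventually_ge_at_top[of 3]]\<close>)
qed

text \<open>
  Multiplying by \<open>exp (- e s\<^sup>4)\<close> turns a bound of Gaussian growth in a vertical strip into decay,
  whatever the constants.
\<close>

lemma strip_maximum_principle:
  fixes Q :: "complex \<Rightarrow> complex"
  assumes U: "{s. a \<le> Re s \<and> Re s \<le> b} \<subseteq> U" "Q holomorphic_on U"
    and growth: "\<And>s. a \<le> Re s \<Longrightarrow> Re s \<le> b \<Longrightarrow> norm (Q s) \<le> exp (C * (1 + (Im s)\<^sup>2))"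
    and left: "\<And>s. Re s = a \<Longrightarrow> norm (Q s) \<le> 1" and right: "\<And>s. Re s = b \<Longrightarrow> norm (Q s) \<le> 1"
    and z: "a \<le> Re z" "Re z \<le> b"
  shows "norm (Q z) \<le> 1"
proof -
  define A where "A = max \<bar>a\<bar> \<bar>b\<bar>"
  have fourth: "Re (s ^ 4) \<ge> (Im s) ^ 4 / 2 - 18 * A ^ 4" if "a \<le> Re s" "Re s \<le> b" for s
  proof -
    have "\<bar>Re s\<bar> \<le> A" using that by (auto simp: A_def)
    hence "\<bar>Re s\<bar> ^ 4 \<le> A ^ 4" by (intro power_mono) auto
    hence le: "(Re s) ^ 4 \<le> A ^ 4" by simp
    \<comment> \<open>The square absorbs the mixed term of Re (s^4): with s = x + i t, 6 x^2 t^2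
      \<le> t^4 / 2 + 18 x^4.\<close>
    have "0 \<le> ((Im s)\<^sup>2 - 6 * (Re s)\<^sup>2)\<^sup>2" by simp
    hence "12 * ((Re s)\<^sup>2 * (Im s)\<^sup>2) \<le> (Im s) ^ 4 + 36 * (Re s) ^ 4"
      by (simp add: power2_eq_square algebra_simps power4_eq_xxxx)
    moreover have "Re (s ^ 4) = (Re s) ^ 4 - 6 * ((Re s)\<^sup>2 * (Im s)\<^sup>2) + (Im s) ^ 4"
      by (simp add: power4_eq_xxxx power2_eq_square algebra_simps)
    moreover have "(Re s) ^ 4 \<ge> 0" by simp
    ultimately show ?thesis using le by linarith
  qed
  have eps: "norm (Q z) * exp (- e * Re (z ^ 4)) \<le> exp (18 * e * A ^ 4)" if e: "e > 0" for e
  proof -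
    define P where "P s = Q s * exp (- of_real e * s ^ 4)" for s
    have nP: "norm (P s) = norm (Q s) * exp (- e * Re (s ^ 4))" for s
      by (simp add: P_def norm_mult)
    \<comment> \<open>A height above z at which the damping exponent e T^4 / 2 outweighs the growth
      exponent C (1 + T^2).\<close>
    define T where "T = max (1 + \<bar>Im z\<bar>) (1 + 4 * \<bar>C\<bar> / e)"
    have T1: "T \<ge> 1" "T > \<bar>Im z\<bar>" by (auto simp: T_def)
    have T2: "4 * \<bar>C\<bar> \<le> e * T"
    proof -
      have "1 + 4 * \<bar>C\<bar> / e \<le> T" by (simp add: T_def)
      hence "4 * \<bar>C\<bar> / e \<le> T" by linarith
      thus ?thesis using e by (simp add: field_simps)
    qed
    have CT: "C * (1 + T\<^sup>2) \<le> e * T ^ 4 / 2"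
    proof -
      have "C * (1 + T\<^sup>2) \<le> \<bar>C\<bar> * (T\<^sup>2 + T\<^sup>2)" using T1 by (intro mult_mono) auto
      also have "\<dots> = 4 * \<bar>C\<bar> * T\<^sup>2 / 2" by simp
      also have "\<dots> \<le> e * T * T\<^sup>2 / 2" using T2 by (intro divide_right_mono mult_right_mono) auto
      also have "\<dots> \<le> e * T * T\<^sup>2 * T / 2" using T1 e by (intro divide_right_mono) auto
      also have "\<dots> = e * T ^ 4 / 2" by (simp add: power2_eq_square power4_eq_xxxx)
      finally show ?thesis .
    qed
    define R where "R = cbox (Complex a (- T)) (Complex b T)"
    have R: "s \<in> R \<longleftrightarrow> a \<le> Re s \<and> Re s \<le> b \<and> \<bar>Im s\<bar> \<le> T" for s
      by (auto simp: R_def in_cbox_complex_iff abs_le_iff)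
    have hol: "P holomorphic_on R"
      unfolding P_def using U R by (intro holomorphic_intros) (auto intro: holomorphic_on_subset)
    have "norm (P z) \<le> exp (18 * e * A ^ 4)"
    proof (rule maximum_modulus_frontier[where S = R and f = P and \<xi> = z])
      show "P holomorphic_on interior R" using hol interior_subset by (rule holomorphic_on_subset)
      show "continuous_on (closure R) P" using holomorphic_on_imp_continuous_on[OF hol] by (simp add: R_def)
      show "bounded R" by (simp add: R_def)
      show "z \<in> R" using z T1 by (simp add: R)
    next
      fix s assume "s \<in> frontier R"
      hence sR: "s \<in> R" and "s \<notin> box (Complex a (- T)) (Complex b T)"
        by (auto simp: R_def frontier_cbox)
      hence "Re s = a \<or> Re s = b \<or> \<bar>Im s\<bar> = T"
        using sR by (auto simp: R in_box_complex_iff)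
      moreover have f: "- e * Re (s ^ 4) \<le> 18 * e * A ^ 4 - e * (Im s) ^ 4 / 2"
        using mult_left_mono[OF fourth[of s], of e] sR e by (simp add: R algebra_simps)
      hence f2: "- e * Re (s ^ 4) \<le> 18 * e * A ^ 4" using e by (smt (verit) zero_le_even_power divide_nonneg_nonneg mult_nonneg_nonneg even_numeral)
      moreover have "norm (P s) \<le> exp (18 * e * A ^ 4)" if "norm (Q s) \<le> 1"
      proof -
        have "norm (P s) \<le> 1 * exp (18 * e * A ^ 4)" unfolding nP using that f2 by (intro mult_mono) auto
        thus ?thesis by simp
      qed
      moreover have "norm (P s) \<le> exp (18 * e * A ^ 4)" if t: "\<bar>Im s\<bar> = T"
      proof -
        have t2: "(Im s)\<^sup>2 = T\<^sup>2" using t by (metis power2_abs)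
        have t4: "(Im s) ^ 4 = T ^ 4" using t by (metis power_even_abs_numeral even_numeral)
        have "norm (P s) \<le> exp (C * (1 + T\<^sup>2)) * exp (18 * e * A ^ 4 - e * T ^ 4 / 2)"
          unfolding nP using growth[of s] f sR t2 t4 by (intro mult_mono) (auto simp: R)
        also have "\<dots> = exp (C * (1 + T\<^sup>2) + (18 * e * A ^ 4 - e * T ^ 4 / 2))" by (rule exp_add[symmetric])
        also have "\<dots> \<le> exp (18 * e * A ^ 4)" using CT by simp
        finally show ?thesis .
      qed
      ultimately show "norm (P s) \<le> exp (18 * e * A ^ 4)" using left right by blast
    qed
    thus ?thesis by (simp add: nP)
  qed
  \<comment> \<open>At the fixed point z the damping factor tends to 1 with e, and so does the bound
    on the right.\<close>
  have "((\<lambda>e. norm (Q z) * exp (- e * Re (z ^ 4))) \<longlongrightarrow> norm (Q z) * exp (- 0 * Re (z ^ 4))) (at_right 0)"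
    by (intro tendsto_intros)
  moreover have "((\<lambda>e. exp (18 * e * A ^ 4)) \<longlongrightarrow> exp (18 * 0 * A ^ 4)) (at_right 0)"
    by (intro tendsto_intros)
  moreover have "\<forall>\<^sub>F e in at_right 0. norm (Q z) * exp (- e * Re (z ^ 4)) \<le> exp (18 * e * A ^ 4)"
    using eventually_at_right_less[of 0] by eventually_elim (rule eps)
  ultimately have "norm (Q z) * exp (- 0 * Re (z ^ 4)) \<le> exp (18 * 0 * A ^ 4)"
    by (intro tendsto_le[OF trivial_limit_at_right_real])
  thus ?thesis by simp
qed

text \<open>The infimum 1 supplies an admissible exponent a < 2 for large |z|; compactness covers
  the remaining disc by enlarging K.\<close>

lemma entire_growth:
  assumes hol: "F holomorphic_on UNIV" and ord: "growth_order F = 1"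
  shows "\<exists>K>0. \<forall>z. norm (F z) \<le> exp (K + (norm z)\<^sup>2)"
proof -
  have "Inf (ereal ` {a. 0 \<le> a \<and> (\<forall>\<^sub>F z in at_infinity. norm (F z) \<le> exp (norm z powr a))}) < ereal 2"
    using ord unfolding growth_order_def by simp
  then obtain a where a: "a < 2" "0 \<le> a" "\<forall>\<^sub>F z in at_infinity. norm (F z) \<le> exp (norm z powr a)"
    unfolding Inf_less_iff by auto
  then obtain B where B: "\<And>z. norm z \<ge> B \<Longrightarrow> norm (F z) \<le> exp (norm z powr a)"
    by (auto simp: eventually_at_infinity)
  define R where "R = max B 1"
  have "compact (F ` cball 0 R)"
    by (intro compact_continuous_image holomorphic_on_imp_continuous_on holomorphic_on_subset[OF hol]) auto
  then obtain M where M: "\<And>z. norm z \<le> R \<Longrightarrow> norm (F z) \<le> M"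
    by (force dest!: compact_imp_bounded simp: bounded_iff)
  have M0: "M \<ge> 0" using order_trans[OF norm_ge_zero M[of 0]] by (simp add: R_def)
  have "norm (F z) \<le> exp (M + 1 + (norm z)\<^sup>2)" for z
  proof (cases "norm z \<le> R")
    case True
    hence "norm (F z) \<le> M + 1" using M by fastforce
    also have "\<dots> \<le> exp (M + 1)" using exp_ge_add_one_self[of "M + 1"] by linarith
    also have "\<dots> \<le> exp (M + 1 + (norm z)\<^sup>2)" by simp
    finally show ?thesis .
  next
    case False
    hence z: "norm z \<ge> B" "norm z \<ge> 1" by (auto simp: R_def)
    have "norm z powr a \<le> norm z powr 2" using z a by (intro powr_mono) auto
    also have "\<dots> = (norm z)\<^sup>2" using z by (intro powr_numeral) auto
    finally have "exp (norm z powr a) \<le> exp (M + 1 + (norm z)\<^sup>2)" using M0 by simp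
    thus ?thesis using B[OF z(1)] by linarith
  qed
  thus ?thesis using M0 by (intro exI[of _ "M + 1"]) auto
qed

section \<open>The completed function under the hypotheses: its logarithm, its factors and their
  growth\<close>

locale grh_L_function =
  fixes f :: L_data
  assumes L: "is_L_function f"
    and edge: "\<forall>s. Re s = 1 \<longrightarrow> \<not> is_pole (Lambda f) s \<and> \<not> Lambda_zero f s"
    and grh: "GRH f" and ram: "ramanujan f"
begin

lemma functional_equation:
  "s \<noteq> 0 \<Longrightarrow> s \<noteq> 1 \<Longrightarrow> Lambda f s = root_number f * cnj (Lambda f (1 - cnj s))"
  "norm (root_number f) = 1"
  using L unfolding is_L_function_def by blast+

lemma nicely: "Lambda f nicely_meromorphic_on UNIV"
  using L unfolding is_L_function_def by blast

text \<open>A pole at 1 contradicts the hypothesis on the edge, and a pole at 0 would be carried to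
  1 by the functional equation. As that equation is only given off 0 and 1, the argument compares
  limits at 0.\<close>

lemma no_pole: "\<not> is_pole (Lambda f) s"
proof
  assume p: "is_pole (Lambda f) s"
  hence "s \<in> {0, 1}" using L unfolding is_L_function_def by blast
  moreover have "s \<noteq> 1" using p edge by auto
  ultimately have s: "s = 0" by simp
  have "Lambda f \<midarrow>1\<rightarrow> Lambda f 1" using nicely edge unfolding nicely_meromorphic_on_def by force
  hence "isCont (Lambda f) 1" by (simp add: isCont_def)
  hence "((\<lambda>s. root_number f * cnj (Lambda f (1 - cnj s))) \<longlongrightarrow> root_number f * cnj (Lambda f 1)) (at 0)"
    by (intro tendsto_intros isCont_tendsto_compose[of 1 "Lambda f"]) (auto intro!: tendsto_eq_intros)
  moreover have "\<forall>\<^sub>F s in at 0. root_number f * cnj (Lambda f (1 - cnj s)) = Lambda f s"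
  proof -
    have "\<forall>\<^sub>F s in at (0::complex). s \<in> ball 0 1 - {0}" by (intro eventually_at_in_open) auto
    thus ?thesis by eventually_elim (rule functional_equation(1)[symmetric], auto)
  qed
  ultimately have "Lambda f \<midarrow>0\<rightarrow> root_number f * cnj (Lambda f 1)"
    using Lim_transform_eventually by blast
  moreover have "filterlim (Lambda f) at_infinity (at 0)" using p s by (simp add: is_pole_def)
  ultimately show False using not_tendsto_and_filterlim_at_infinity[OF at_neq_bot] by blast
qed

lemma holomorphic_Lambda: "Lambda f holomorphic_on A"
  using nicely_meromorphic_without_singularities[OF nicely] no_pole
  by (intro analytic_imp_holomorphic) (auto intro: analytic_on_subset)

lemma Lambda_nonzero: "Re s > 1 / 2 \<Longrightarrow> Lambda f s \<noteq> 0"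
  using grh no_pole unfolding GRH_def Lambda_zero_def by fastforce

lemma norm_functional_equation:
  assumes "s \<noteq> 0" "s \<noteq> 1"
  shows "norm (Lambda f s) = norm (Lambda f (1 - cnj s))"
  unfolding functional_equation(1)[OF assms] norm_mult functional_equation(2) by simp

text \<open>A half-plane is simply connected, so a logarithm exists. The choice is free up to a
  multiple of 2 pi i, which affects neither the derivative nor the real part.\<close>

definition logLambda :: "complex \<Rightarrow> complex" where
  "logLambda = (SOME l. l holomorphic_on {s. Re s > 1 / 2} \<and> (\<forall>s. Re s > 1 / 2 \<longrightarrow> Lambda f s = exp (l s)))"

lemma logLambda: "logLambda holomorphic_on {s. Re s > 1 / 2}"
  "Re s > 1 / 2 \<Longrightarrow> Lambda f s = exp (logLambda s)"
proof -
  let ?S = "{s. Re s > 1 / 2}"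
  have "\<exists>g. g holomorphic_on ?S \<and> (\<forall>z \<in> ?S. Lambda f z = exp (g z))"
  proof -
    have "simply_connected ?S" by (intro convex_imp_simply_connected convex_halfspace_Re_gt)
    hence "\<And>F. F holomorphic_on ?S \<Longrightarrow> (\<forall>z\<in>?S. F z \<noteq> 0) \<Longrightarrow> \<exists>g. g holomorphic_on ?S \<and> (\<forall>z\<in>?S. F z = exp (g z))"
      unfolding simply_connected_eq_holomorphic_log[OF open_halfspace_Re_gt] by blast
    thus "\<exists>g. g holomorphic_on ?S \<and> (\<forall>z \<in> ?S. Lambda f z = exp (g z))"
      using holomorphic_Lambda Lambda_nonzero by simp
  qed
  hence "\<exists>l. l holomorphic_on ?S \<and> (\<forall>s. Re s > 1 / 2 \<longrightarrow> Lambda f s = exp (l s))" by auto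
  hence "logLambda holomorphic_on ?S \<and> (\<forall>s. Re s > 1 / 2 \<longrightarrow> Lambda f s = exp (logLambda s))"
    unfolding logLambda_def by (rule someI_ex)
  thus "logLambda holomorphic_on ?S" "Re s > 1 / 2 \<Longrightarrow> Lambda f s = exp (logLambda s)" by blast+
qed

lemma norm_Lambda: "Re s > 1 / 2 \<Longrightarrow> norm (Lambda f s) = exp (Re (logLambda s))"
  by (simp add: logLambda(2))

definition g :: "complex \<Rightarrow> complex" where "g = deriv logLambda"

lemma g_holomorphic: "g holomorphic_on {s. Re s > 1 / 2}"
  unfolding g_def by (intro holomorphic_deriv logLambda open_halfspace_Re_gt)

lemma g_deriv: "Re s > 1 / 2 \<Longrightarrow> (logLambda has_field_derivative g s) (at s)"
  unfolding g_def by (rule holomorphic_derivI[OF logLambda(1) open_halfspace_Re_gt]) auto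

text \<open>The logarithmic derivative of
  \<open>of_nat (cond f) powr (s / 2) * gamma_factor f s\<close>.\<close>

definition E :: "complex \<Rightarrow> complex" where
  "E s = of_real (ln (cond f) / 2 - deg f * ln pi / 2) + (\<Sum>j<deg f. Digamma ((s + kpar f j) / 2)) / 2"

lemma data: "deg f \<ge> 1" "j < deg f \<Longrightarrow> Re (kpar f j) \<ge> 0" "cond f \<ge> 1"
  using L unfolding is_L_function_def by blast+

lemma E_holomorphic: "E holomorphic_on {s. Re s > 0}"
proof -
  have "(\<lambda>s. Digamma ((s + kpar f j) / 2)) holomorphic_on {s. Re s > 0}" if "j < deg f" for j
  proof -
    have "(Digamma \<circ> (\<lambda>s. (s + kpar f j) / 2)) holomorphic_on {s. Re s > 0}"
    proof (rule holomorphic_on_compose_gen)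
      show "(\<lambda>s. (s + kpar f j) / 2) holomorphic_on {s. Re s > 0}" by (intro holomorphic_intros) auto
      show "Digamma holomorphic_on (- \<int>\<^sub>\<le>\<^sub>0 :: complex set)" by (intro holomorphic_on_Polygamma) auto
      show "(\<lambda>s. (s + kpar f j) / 2) ` {s. Re s > 0} \<subseteq> - \<int>\<^sub>\<le>\<^sub>0"
      proof clarify
        fix s :: complex assume "0 < Re s" "(s + kpar f j) / 2 \<in> \<int>\<^sub>\<le>\<^sub>0"
        thus False using not_nonpos_Int_Re_pos[of "(s + kpar f j) / 2"] data(2)[OF that] by auto
      qed
    qed
    thus ?thesis by (simp add: o_def)
  qed
  thus ?thesis unfolding E_def by (intro holomorphic_intros) auto
qed

lemma E_Hoelder:
  assumes "Re u \<ge> 1 / 4" "Re v \<ge> 1 / 4"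
  shows "norm (E u - E v) \<le> 50 * real (deg f) * sqrt (norm (u - v))"
proof -
  have "E u - E v = (\<Sum>j<deg f. Digamma ((u + kpar f j) / 2) - Digamma ((v + kpar f j) / 2)) / 2"
    by (simp add: E_def sum_subtractf diff_divide_distrib)
  also have "norm \<dots> = norm (\<Sum>j<deg f. Digamma ((u + kpar f j) / 2) - Digamma ((v + kpar f j) / 2)) / 2"
    by (simp add: norm_divide)
  also have "norm (\<Sum>j<deg f. Digamma ((u + kpar f j) / 2) - Digamma ((v + kpar f j) / 2))
      \<le> (\<Sum>j<deg f. 100 * sqrt (norm (u - v)))"
  proof (rule sum_norm_le)
    fix j assume "j \<in> {..<deg f}"
    hence j: "Re (kpar f j) \<ge> 0" using data by auto
    have "norm (Digamma ((u + kpar f j) / 2) - Digamma ((v + kpar f j) / 2))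
        \<le> 100 * sqrt (norm ((u + kpar f j) / 2 - (v + kpar f j) / 2))"
      using assms j by (intro Digamma_Hoelder) auto
    also have "(u + kpar f j) / 2 - (v + kpar f j) / 2 = (u - v) / 2" by (simp add: field_simps)
    also have "100 * sqrt (norm ((u - v) / 2)) \<le> 100 * sqrt (norm (u - v))" by (simp add: norm_divide)
    finally show "norm (Digamma ((u + kpar f j) / 2) - Digamma ((v + kpar f j) / 2)) \<le> 100 * sqrt (norm (u - v))" .
  qed
  finally show ?thesis by (simp add: field_simps)
qed

text \<open>This is -L'/L for Re s > 1.\<close>

definition D :: "complex \<Rightarrow> complex" where "D = dseries (lcoeff f)"

text \<open>A holomorphic logarithm, for Re s > 0, of the factor whose logarithmic derivative is
  \<open>E\<close>.\<close>

definition Gexp :: "complex \<Rightarrow> complex" where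
  "Gexp s = of_real (ln (cond f) / 2 - deg f * ln pi / 2) * s + (\<Sum>j<deg f. ln_Gamma ((s + kpar f j) / 2))"

lemma Gexp: assumes "Re s > 0"
  shows "of_nat (cond f) powr (s / 2) * gamma_factor f s = exp (Gexp s)"
    "(Gexp has_field_derivative E s) (at s)"
proof -
  have pos: "Re ((s + kpar f j) / 2) > 0" if "j < deg f" for j using data(2)[OF that] assms by simp
  have "of_nat (cond f) powr (s / 2) = exp (s / 2 * of_real (ln (cond f)))"
    using data(3) by (auto simp: powr_def Ln_of_nat)
  moreover have "of_real pi powr (- of_nat (deg f) * s / 2) = exp (- of_nat (deg f) * s / 2 * of_real (ln pi))"
    by (simp add: powr_def Ln_of_real)
  moreover have "(\<Prod>j<deg f. Gamma ((s + kpar f j) / 2)) = exp (\<Sum>j<deg f. ln_Gamma ((s + kpar f j) / 2))"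
    unfolding exp_sum[OF finite_lessThan] using pos
    by (intro prod.cong refl) (simp add: Gamma_complex_altdef not_nonpos_Int_Re_pos)
  ultimately show "of_nat (cond f) powr (s / 2) * gamma_factor f s = exp (Gexp s)"
    unfolding gamma_factor_def Gexp_def by (simp add: exp_add[symmetric] field_simps)
  have "(s + kpar f j) / 2 \<notin> \<real>\<^sub>\<le>\<^sub>0" if "j < deg f" for j
    using pos[OF that] by (auto simp: complex_nonpos_Reals_iff)
  thus "(Gexp has_field_derivative E s) (at s)"
    unfolding Gexp_def E_def by (auto intro!: derivative_eq_intros simp: sum_divide_distrib)
qed

lemma L_exp:
  assumes "Re s > 1"
  shows "Lambda f s = exp (Gexp s + dseries (logcoeff f) s)"
proof -
  have "Lambda f s = of_nat (cond f) powr (s / 2) * gamma_factor f s * L_series f s"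
    using L assms unfolding is_L_function_def by blast
  thus ?thesis using Gexp(1)[of s] L_series_eq_exp[OF L ram assms] assms by (simp add: exp_add)
qed

text \<open>\<open>Lambda f\<close> is the exponential both of \<open>logLambda\<close> and of
  \<open>Gexp\<close> plus the series for log L. Differentiating the exponentials and cancelling
  avoids any comparison of branches.\<close>

lemma g_eq: assumes s: "Re s > 1" shows "g s = E s - D s"
proof -
  have "(dseries (logcoeff f) has_field_derivative - dseries (\<lambda>n. logcoeff f n * ln (real n)) s) (at s)"
    by (rule dseries_has_derivative[OF norm_logcoeff_le[OF ram] s])
  hence d: "(dseries (logcoeff f) has_field_derivative - D s) (at s)"
    by (simp only: logcoeff_ln D_def)
  have "((\<lambda>s. exp (Gexp s + dseries (logcoeff f) s)) has_field_derivative
          exp (Gexp s + dseries (logcoeff f) s) * (E s - D s)) (at s)"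
    using s by (auto intro!: derivative_eq_intros d Gexp(2))
  moreover have "((\<lambda>s. exp (logLambda s)) has_field_derivative exp (logLambda s) * g s) (at s)"
    using s by (auto intro!: derivative_eq_intros g_deriv)
  hence "((\<lambda>s. exp (Gexp s + dseries (logcoeff f) s)) has_field_derivative exp (logLambda s) * g s) (at s)"
    by (rule has_field_derivative_transform_within_open[of _ _ _ "{s. Re s > 1}"])
       (use s L_exp logLambda in \<open>auto simp: open_halfspace_Re_gt\<close>)
  ultimately have "exp (Gexp s + dseries (logcoeff f) s) * (E s - D s) = exp (logLambda s) * g s"
    by (rule DERIV_unique)
  moreover have "exp (Gexp s + dseries (logcoeff f) s) = exp (logLambda s)"
    using L_exp[OF s] logLambda(2)[of s] s by simp
  ultimately show ?thesis by simp
qed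

lemma D_abs_summable:
  assumes "Re s > 1"
  shows "summable (\<lambda>n. norm (lcoeff f (Suc n) * of_nat (Suc n) powr (- s)))"
proof -
  have "summable (\<lambda>n. norm (logcoeff f (Suc n) * ln (real (Suc n)) * of_nat (Suc n) powr (- s)))"
    by (rule dseries_ln_abs_summable[OF norm_logcoeff_le[OF ram] assms])
  thus ?thesis by (simp only: logcoeff_ln)
qed

lemma D_bounded: "\<exists>B\<ge>0. \<forall>s. Re s \<ge> 2 \<longrightarrow> norm (D s) \<le> B"
proof -
  define h where "h n = norm (lcoeff f (Suc n) * of_nat (Suc n) powr (- (2 :: complex)))" for n
  have h: "summable h" unfolding h_def by (rule D_abs_summable) auto
  have "norm (D s) \<le> suminf h" if s: "Re s \<ge> 2" for s
  proof -
    have "norm (D s) \<le> (\<Sum>n. norm (lcoeff f (Suc n) * of_nat (Suc n) powr (- s)))"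
      unfolding D_def dseries_def by (rule summable_norm[OF D_abs_summable]) (use s in auto)
    also have "\<dots> \<le> suminf h"
    proof (rule suminf_le[OF _ D_abs_summable h])
      fix n
      have "real (Suc n) powr (- Re s) \<le> real (Suc n) powr (- 2)" using s by (intro powr_mono) auto
      thus "norm (lcoeff f (Suc n) * of_nat (Suc n) powr (- s)) \<le> h n"
        unfolding h_def norm_mult norm_Suc_powr by (intro mult_left_mono) auto
    qed (use s in auto)
    finally show ?thesis .
  qed
  moreover have "suminf h \<ge> 0" by (rule suminf_nonneg[OF h]) (simp add: h_def)
  ultimately show ?thesis by blast
qed

lemma g_growth_right: "\<exists>M\<ge>0. \<forall>u. Re u \<ge> 2 \<longrightarrow> norm (g u) \<le> M * (1 + norm u) powr (1 / 2)"
proof -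
  obtain B where B: "B \<ge> 0" "\<And>s. Re s \<ge> 2 \<Longrightarrow> norm (D s) \<le> B" using D_bounded by blast
  define M where "M = norm (E 2) + B + 100 * real (deg f)"
  have "norm (g u) \<le> M * (1 + norm u) powr (1 / 2)" if u: "Re u \<ge> 2" for u
  proof -
    have one: "1 \<le> sqrt (1 + norm u)" by simp
    have "norm (u - 2) \<le> norm u + 2" using norm_triangle_ineq4[of u 2] by simp
    also have "\<dots> \<le> 4 * (1 + norm u)" by simp
    finally have "norm (u - 2) \<le> 4 * (1 + norm u)" .
    hence "sqrt (norm (u - 2)) \<le> sqrt (4 * (1 + norm u))" by (rule real_sqrt_le_mono)
    hence sq: "sqrt (norm (u - 2)) \<le> 2 * sqrt (1 + norm u)" by (simp only: real_sqrt_mult real_sqrt_four)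
    have "norm (g u) = norm (E 2 + (E u - E 2) - D u)" using g_eq[of u] u by simp
    also have "\<dots> \<le> norm (E 2) + norm (E u - E 2) + norm (D u)"
      using norm_triangle_ineq4[of "E 2 + (E u - E 2)" "D u"] norm_triangle_ineq[of "E 2" "E u - E 2"] by linarith
    also have "\<dots> \<le> norm (E 2) * sqrt (1 + norm u) + 50 * real (deg f) * (2 * sqrt (1 + norm u)) + B * sqrt (1 + norm u)"
    proof (intro add_mono)
      show "norm (E 2) \<le> norm (E 2) * sqrt (1 + norm u)" using mult_left_mono[OF one, of "norm (E 2)"] by simp
      show "norm (D u) \<le> B * sqrt (1 + norm u)" using mult_left_mono[OF one B(1)] B(2)[OF u] by linarith
      show "norm (E u - E 2) \<le> 50 * real (deg f) * (2 * sqrt (1 + norm u))"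
        using E_Hoelder[of u 2] u mult_left_mono[OF sq, of "50 * real (deg f)"] by simp
    qed
    also have "\<dots> = M * (1 + norm u) powr (1 / 2)" by (simp add: M_def powr_half_sqrt algebra_simps)
    finally show ?thesis .
  qed
  moreover have "M \<ge> 0" using B by (simp add: M_def)
  ultimately show ?thesis by blast
qed

text \<open>Far to the right the gamma factors dominate: \<open>D\<close> is bounded by B, while the
  digamma function is unbounded. Of the threshold ln pi + 2 B, the first part pays for the power of
  pi in \<open>E\<close> and the second for \<open>D\<close>, as d \<ge> 1.\<close>

lemma g_nonneg_right: "\<exists>A\<ge>2. \<forall>u. Re u \<ge> A \<longrightarrow> Re (g u) \<ge> 0"
proof -
  obtain B where B: "B \<ge> 0" "\<And>s. Re s \<ge> 2 \<Longrightarrow> norm (D s) \<le> B" using D_bounded by blast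
  have "\<forall>\<^sub>F n in sequentially. Digamma (real n) \<ge> ln pi + 2 * B"
    using Digamma_at_top[unfolded filterlim_at_top, rule_format, of "ln pi + 2 * B"] .
  hence "\<forall>\<^sub>F n in sequentially. Digamma (real n) \<ge> ln pi + 2 * B \<and> n \<ge> 1"
    using eventually_ge_at_top[of 1] by eventually_elim auto
  hence "\<exists>n. Digamma (real n) \<ge> ln pi + 2 * B \<and> n \<ge> 1"
    by (rule eventually_happens'[OF sequentially_bot])
  then obtain N where N: "Digamma (real N) \<ge> ln pi + 2 * B" "N \<ge> 1" by blast
  have "Re (g u) \<ge> 0" if u: "Re u \<ge> 2 * real N" for u
  proof -
    have u2: "Re u \<ge> 2" using u N by simp
    have "(\<Sum>j<deg f. ln pi + 2 * B) \<le> (\<Sum>j<deg f. Re (Digamma ((u + kpar f j) / 2)))"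
    proof (rule sum_mono)
      fix j assume "j \<in> {..<deg f}"
      hence "Re (kpar f j) \<ge> 0" using data by auto
      hence "Re (Digamma ((u + kpar f j) / 2)) \<ge> Digamma (real N)"
        using u N by (intro Re_Digamma_ge) auto
      thus "ln pi + 2 * B \<le> Re (Digamma ((u + kpar f j) / 2))" using N by linarith
    qed
    moreover have "Re (E u) = ln (cond f) / 2 - deg f * ln pi / 2 + (\<Sum>j<deg f. Re (Digamma ((u + kpar f j) / 2))) / 2"
      by (simp add: E_def)
    moreover have "ln (real (cond f)) \<ge> 0" using data by simp
    ultimately have "Re (E u) \<ge> real (deg f) * B" by (simp add: algebra_simps)
    moreover have "real (deg f) * B \<ge> 1 * B" using data B by (intro mult_right_mono) auto
    moreover have "Re (D u) \<le> B" using B(2)[OF u2] complex_Re_le_cmod[of "D u"] by linarith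
    ultimately show ?thesis using g_eq[of u] u2 by simp
  qed
  thus ?thesis using N by (intro exI[of _ "2 * real N"]) auto
qed

section \<open>Positivity of the logarithmic derivative\<close>

lemma Re_logLambda_derivative:
  assumes "v > 1 / 2"
  shows "((\<lambda>x. Re (logLambda (Complex x t))) has_field_derivative Re (g (Complex v t))) (at v)"
  using g_deriv[of "Complex v t"] assms by (intro horizontal_derivative(1)) auto

lemma Re_logLambda_mono_right:
  assumes A: "\<forall>u. Re u \<ge> A \<longrightarrow> Re (g u) \<ge> 0" "A \<ge> 2" and x: "A \<le> x" "x \<le> y"
  shows "Re (logLambda (Complex x t)) \<le> Re (logLambda (Complex y t))"
proof (rule DERIV_nonneg_imp_nondecreasing[OF x(2)])
  fix v assume v: "x \<le> v" "v \<le> y"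
  hence "((\<lambda>x. Re (logLambda (Complex x t))) has_field_derivative Re (g (Complex v t))) (at v)"
    using A x by (intro Re_logLambda_derivative) auto
  moreover have "Re (g (Complex v t)) \<ge> 0" using A v x by auto
  ultimately show "\<exists>y. ((\<lambda>x. Re (logLambda (Complex x t))) has_real_derivative y) (at v) \<and> 0 \<le> y" by blast
qed

lemma Re_logLambda_vertical:
  assumes A: "A \<ge> 2"
  shows "\<exists>M\<ge>0. \<forall>t. Re (logLambda (Complex A t)) \<ge> - M * (1 + \<bar>t\<bar>)\<^sup>2"
proof -
  obtain M where M: "M \<ge> 0" "\<And>u. Re u \<ge> 2 \<Longrightarrow> norm (g u) \<le> M * (1 + norm u) powr (1 / 2)"
    using g_growth_right by blast
  define K where "K = norm (logLambda (of_real A)) + M * (1 + A)"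
  have "Re (logLambda (Complex A t)) \<ge> - K * (1 + \<bar>t\<bar>)\<^sup>2" for t
  proof -
    define S where "S = closed_segment (of_real A) (Complex A t)"
    have S: "Re u = A \<and> \<bar>Im u\<bar> \<le> \<bar>t\<bar>" if "u \<in> S" for u
      using that unfolding S_def
      by (auto simp: closed_segment_same_Re closed_segment_eq_real_ivl split: if_splits)
    have "norm (logLambda (Complex A t) - logLambda (of_real A)) \<le> (M * ((1 + A) * (1 + \<bar>t\<bar>))) * norm (Complex A t - of_real A)"
    proof (rule field_differentiable_bound[where S = S and f' = g])
      show "convex S" by (simp add: S_def)
      show "(logLambda has_field_derivative g u) (at u within S)" if "u \<in> S" for u
        using S[OF that] A g_deriv[of u] by (auto intro: has_field_derivative_at_within)
      show "norm (g u) \<le> M * ((1 + A) * (1 + \<bar>t\<bar>))" if "u \<in> S" for u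
      proof -
        have "(1 + norm u) powr (1 / 2) \<le> (1 + norm u) powr 1" by (intro powr_mono) auto
        also have "\<dots> = 1 + norm u" by simp
        also have "\<dots> \<le> 1 + (A + \<bar>t\<bar>)" using S[OF that] cmod_le[of u] A by simp
        also have "\<dots> \<le> (1 + A) * (1 + \<bar>t\<bar>)" using A by (simp add: algebra_simps)
        finally have "M * (1 + norm u) powr (1 / 2) \<le> M * ((1 + A) * (1 + \<bar>t\<bar>))"
          using M by (intro mult_left_mono)
        thus ?thesis using M(2)[of u] S[OF that] A by simp
      qed
      show "Complex A t \<in> S" "of_real A \<in> S" by (auto simp: S_def)
    qed
    also have "Complex A t - of_real A = \<i> * of_real t" by (simp add: complex_eq_iff)
    also have "norm (\<i> * of_real t) = \<bar>t\<bar>" by (simp add: norm_mult)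
    also have "M * ((1 + A) * (1 + \<bar>t\<bar>)) * \<bar>t\<bar> \<le> M * ((1 + A) * (1 + \<bar>t\<bar>)) * (1 + \<bar>t\<bar>)"
      using M A by (intro mult_left_mono) auto
    finally have "norm (logLambda (Complex A t) - logLambda (of_real A)) \<le> M * (1 + A) * (1 + \<bar>t\<bar>)\<^sup>2"
      by (simp add: power2_eq_square mult_ac)
    moreover have "norm (logLambda (of_real A)) * 1 \<le> norm (logLambda (of_real A)) * (1 + \<bar>t\<bar>)\<^sup>2"
      by (intro mult_left_mono) (auto simp: power2_eq_square algebra_simps)
    moreover have "norm (logLambda (Complex A t)) \<le> norm (logLambda (Complex A t) - logLambda (of_real A)) + norm (logLambda (of_real A))"
      by (metis diff_add_cancel norm_triangle_ineq)
    ultimately have "norm (logLambda (Complex A t)) \<le> K * (1 + \<bar>t\<bar>)\<^sup>2" by (simp add: K_def distrib_right)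
    thus ?thesis using abs_Re_le_cmod[of "logLambda (Complex A t)"] by simp
  qed
  moreover have "K \<ge> 0" using M A by (simp add: K_def)
  ultimately show ?thesis by blast
qed

text \<open>A lower bound for |Lambda| down to Re s = 1/2 + r, as the quotient in the proof of
  positivity requires. If U bounds ln |Lambda| from above, p = U - ln |Lambda| is nonnegative on
  discs of radius r, and Schwarz--Pick gives |p'| \<le> 2 p / r. So p exp (2 v / r) is nondecreasing
  in v, and the bound is carried from Re s = A to the left, as in Harnack's inequality.\<close>

lemma Re_logLambda_lower:
  assumes A: "A \<ge> 2" and r: "0 < r" "r \<le> 1"
  shows "\<exists>C\<ge>0. \<forall>x t. 1 / 2 + r \<le> x \<longrightarrow> x \<le> A \<longrightarrow> Re (logLambda (Complex x t)) \<ge> - C * (1 + \<bar>t\<bar>)\<^sup>2"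
proof -
  obtain M where M: "M \<ge> 0" "\<And>t. Re (logLambda (Complex A t)) \<ge> - M * (1 + \<bar>t\<bar>)\<^sup>2"
    using Re_logLambda_vertical[OF A] by blast
  have "growth_order (Lambda f) = 1" using L unfolding is_L_function_def by blast
  then obtain K where K: "K > 0" "\<And>z. norm (Lambda f z) \<le> exp (K + (norm z)\<^sup>2)"
    using entire_growth[OF holomorphic_Lambda] by blast
  have up: "Re (logLambda u) \<le> K + (norm u)\<^sup>2" if "Re u > 1 / 2" for u
    using K(2)[of u] norm_Lambda[OF that] by simp
  define C where "C = exp (2 * A / r) * (K + (A + 2)\<^sup>2 + M)"
  have low: "Re (logLambda (Complex x t)) \<ge> - C * (1 + \<bar>t\<bar>)\<^sup>2" if x: "1 / 2 + r \<le> x" "x \<le> A" for x t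
  proof -
    \<comment> \<open>Discs of radius r \<le> 1 about points of abscissa at most A reach up to A +
      1, and their ordinates up to |t| + 1; this accounts for A + 2.\<close>
    define U where "U = K + (A + 2)\<^sup>2 * (1 + \<bar>t\<bar>)\<^sup>2"
    define p where "p v = U - Re (logLambda (Complex v t))" for v
    have up2: "Re (logLambda u) \<le> U" if u: "Re u > 1 / 2" "Re u \<le> A + 1" "\<bar>Im u\<bar> \<le> \<bar>t\<bar> + 1" for u
    proof -
      have "norm u \<le> \<bar>Re u\<bar> + \<bar>Im u\<bar>" by (rule cmod_le)
      also have "\<dots> \<le> (A + 1) + (1 + \<bar>t\<bar>)" using u by linarith
      also have "\<dots> \<le> (A + 2) * (1 + \<bar>t\<bar>)" using A by (simp add: algebra_simps)
      finally have "(norm u)\<^sup>2 \<le> ((A + 2) * (1 + \<bar>t\<bar>))\<^sup>2" by (intro power_mono) auto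
      thus ?thesis using up[OF u(1)] by (simp add: U_def power_mult_distrib)
    qed
    have der: "\<exists>y. ((\<lambda>v. p v * exp (2 * v / r)) has_real_derivative y) (at v) \<and> 0 \<le> y" if v: "x \<le> v" "v \<le> A" for v
    proof -
      have v2: "v > 1 / 2" "1 / 2 + r \<le> v" using v x r by auto
      define z where "z = Complex v t"
      have ball: "Re u > 1 / 2 \<and> Re u \<le> A + 1 \<and> \<bar>Im u\<bar> \<le> \<bar>t\<bar> + 1" if "u \<in> ball z r" for u
      proof -
        have "\<bar>Re (z - u)\<bar> < r" "\<bar>Im (z - u)\<bar> < r"
          using that abs_Re_le_cmod[of "z - u"] abs_Im_le_cmod[of "z - u"] by (auto simp: dist_norm simp del: minus_complex.sel)
        thus ?thesis using v v2 r by (auto simp: z_def abs_less_iff)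
      qed
      define H where "H u = of_real U - logLambda u" for u
      have Hh: "H holomorphic_on ball z r"
        unfolding H_def using ball by (intro holomorphic_intros holomorphic_on_subset[OF logLambda(1)]) auto
      have "norm (deriv H z) \<le> 2 * Re (H z) / r"
        by (rule Schwarz_Pick_ball[OF Hh _ r(1)]) (use ball up2 in \<open>auto simp: H_def\<close>)
      moreover have "deriv H z = - g z"
      proof (rule DERIV_imp_deriv)
        have "Re z > 1 / 2" using v2 by (simp add: z_def)
        thus "(H has_field_derivative - g z) (at z)"
          unfolding H_def by (auto intro!: derivative_eq_intros g_deriv)
      qed
      ultimately have "Re (g z) \<le> 2 * p v / r"
        using complex_Re_le_cmod[of "g z"] by (simp add: H_def p_def z_def)
      hence ge: "- Re (g z) + p v * (2 / r) \<ge> 0" by (simp add: mult_ac)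
      have "((\<lambda>v. p v * exp (2 * v / r)) has_real_derivative (- Re (g z) + p v * (2 / r)) * exp (2 * v / r)) (at v)"
      proof -
        define R where "R = (\<lambda>x. Re (logLambda (Complex x t)))"
        have "(R has_real_derivative Re (g z)) (at v)"
          unfolding R_def z_def by (rule Re_logLambda_derivative[OF v2(1)])
        moreover have "p = (\<lambda>v. U - R v)" by (simp add: p_def[abs_def] R_def)
        ultimately show ?thesis using r by (auto intro!: derivative_eq_intros simp: field_simps)
      qed
      thus ?thesis using ge by (intro exI conjI mult_nonneg_nonneg) auto
    qed
    have "p x * exp (2 * x / r) \<le> p A * exp (2 * A / r)"
      by (rule DERIV_nonneg_imp_nondecreasing[OF x(2) der])
    moreover have px: "p x \<ge> 0" using up2[of "Complex x t"] x r by (simp add: p_def)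
    have "p x * 1 \<le> p x * exp (2 * x / r)" using px x r by (intro mult_left_mono) auto
    ultimately have "p x \<le> p A * exp (2 * A / r)" by simp
    also have "p A \<le> (K + (A + 2)\<^sup>2 + M) * (1 + \<bar>t\<bar>)\<^sup>2"
    proof -
      have "K * 1 \<le> K * (1 + \<bar>t\<bar>)\<^sup>2" using K by (intro mult_left_mono) (auto simp: power2_eq_square algebra_simps)
      thus ?thesis using M(2)[of t] by (simp add: p_def U_def algebra_simps)
    qed
    finally have "p x \<le> C * (1 + \<bar>t\<bar>)\<^sup>2" by (simp add: C_def mult_ac)
    moreover have "U \<ge> 0" using K by (simp add: U_def)
    ultimately show ?thesis by (simp add: p_def)
  qed
  moreover have "C \<ge> 0" using K M by (simp add: C_def)
  ultimately show ?thesis by blast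
qed

text \<open>It is shown that |Lambda (s)| \<le> |Lambda (s + h)| for small h > 0; a negative
  derivative of ln |Lambda| along the horizontal line would contradict this.\<close>

theorem Re_g_nonneg:
  assumes s: "Re s > 1 / 2"
  shows "Re (g s) \<ge> 0"
proof -
  obtain A0 where A0: "A0 \<ge> 2" "\<forall>u. Re u \<ge> A0 \<longrightarrow> Re (g u) \<ge> 0" using g_nonneg_right by blast
  define A where "A = max A0 (Re s)"
  have A: "A \<ge> 2" "A \<ge> Re s" "\<forall>u. Re u \<ge> A \<longrightarrow> Re (g u) \<ge> 0" using A0 by (auto simp: A_def)
  have "growth_order (Lambda f) = 1" using L unfolding is_L_function_def by blast
  then obtain K where K: "K > 0" "\<And>z. norm (Lambda f z) \<le> exp (K + (norm z)\<^sup>2)"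
    using entire_growth[OF holomorphic_Lambda] by blast
  have mono: "Re (logLambda s) \<le> Re (logLambda (s + of_real h))" if h: "0 < h" "h < 1 / 2" for h
  proof -
    have "\<exists>C\<ge>0. \<forall>x t. 1 / 2 + h / 2 \<le> x \<longrightarrow> x \<le> A + 1 \<longrightarrow> Re (logLambda (Complex x t)) \<ge> - C * (1 + \<bar>t\<bar>)\<^sup>2"
      using Re_logLambda_lower[of "A + 1" "h / 2"] A h by auto
    then obtain C where C: "C \<ge> 0" "\<And>x t. 1 / 2 + h / 2 \<le> x \<Longrightarrow> x \<le> A + 1 \<Longrightarrow> Re (logLambda (Complex x t)) \<ge> - C * (1 + \<bar>t\<bar>)\<^sup>2"
      by blast
    define Q where "Q u = Lambda f u / Lambda f (u + of_real h)" for u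
    \<comment> \<open>On this line \<open>1 - cnj u = u + of_real h\<close>, so by the functional
      equation numerator and denominator of \<open>Q\<close> have the same modulus. Zeros of the
      denominator lie further left, on Re u = 1/2 - h.\<close>
    define a where "a = 1 / 2 - h / 2"
    have nz: "Lambda f (u + of_real h) \<noteq> 0" if "Re u > 1 / 2 - h" for u
      using that by (intro Lambda_nonzero) auto
    have "norm (Q s) \<le> 1"
    proof (rule strip_maximum_principle[where Q = Q and z = s and a = a and b = A and U = "{u. Re u > 1 / 2 - h}" and C = "K + A\<^sup>2 + 1 + 2 * C"])
      show "{u. a \<le> Re u \<and> Re u \<le> A} \<subseteq> {u. Re u > 1 / 2 - h}" using h by (auto simp: a_def)
      have "(\<lambda>u. Lambda f (u + of_real h)) holomorphic_on {u. Re u > 1 / 2 - h}"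
        by (rule holomorphic_on_compose_gen[OF _ holomorphic_Lambda[of UNIV], unfolded o_def]) (auto intro!: holomorphic_intros)
      thus "Q holomorphic_on {u. Re u > 1 / 2 - h}"
        unfolding Q_def using nz by (intro holomorphic_intros holomorphic_Lambda) auto
      show "a \<le> Re s" "Re s \<le> A" using s h A by (auto simp: a_def)
    next
      fix u assume u: "a \<le> Re u" "Re u \<le> A"
      have ua: "(Re u)\<^sup>2 \<le> A\<^sup>2" using u h by (intro power_mono) (auto simp: a_def)
      have "norm (Q u) = norm (Lambda f u) / exp (Re (logLambda (u + of_real h)))"
        unfolding Q_def norm_divide using u h by (subst (2) norm_Lambda) (auto simp: a_def)
      also have "\<dots> = norm (Lambda f u) * exp (- Re (logLambda (u + of_real h)))"
        by (simp add: exp_minus divide_inverse)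
      also have "\<dots> \<le> exp (K + (norm u)\<^sup>2) * exp (C * (1 + \<bar>Im u\<bar>)\<^sup>2)"
      proof (intro mult_mono K)
        have "u + of_real h = Complex (Re u + h) (Im u)" by (simp add: complex_eq_iff)
        moreover have "Re (logLambda (Complex (Re u + h) (Im u))) \<ge> - C * (1 + \<bar>Im u\<bar>)\<^sup>2"
          using u h by (intro C) (auto simp: a_def)
        ultimately show "exp (- Re (logLambda (u + of_real h))) \<le> exp (C * (1 + \<bar>Im u\<bar>)\<^sup>2)" by simp
      qed auto
      also have "\<dots> = exp (K + (norm u)\<^sup>2 + C * (1 + \<bar>Im u\<bar>)\<^sup>2)" by (rule exp_add[symmetric])
      also have "K + (norm u)\<^sup>2 + C * (1 + \<bar>Im u\<bar>)\<^sup>2 \<le> (K + A\<^sup>2 + 1 + 2 * C) * (1 + (Im u)\<^sup>2)"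
      proof -
        have "0 \<le> (1 - \<bar>Im u\<bar>)\<^sup>2" by simp
        hence "(1 + \<bar>Im u\<bar>)\<^sup>2 \<le> 2 * (1 + (Im u)\<^sup>2)" by (simp add: power2_eq_square algebra_simps)
        hence "C * (1 + \<bar>Im u\<bar>)\<^sup>2 \<le> C * (2 * (1 + (Im u)\<^sup>2))" using C by (intro mult_left_mono)
        moreover have "(norm u)\<^sup>2 \<le> A\<^sup>2 + (Im u)\<^sup>2" using ua by (simp add: cmod_power2)
        moreover have "0 \<le> (K + A\<^sup>2) * (Im u)\<^sup>2" using K by (intro mult_nonneg_nonneg) auto
        ultimately show ?thesis by (simp add: algebra_simps)
      qed
      finally show "norm (Q u) \<le> exp ((K + A\<^sup>2 + 1 + 2 * C) * (1 + (Im u)\<^sup>2))" by simp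
    next
      fix u assume u: "Re u = a"
      have "norm (Lambda f u) = norm (Lambda f (1 - cnj u))"
        by (rule norm_functional_equation) (use u h in \<open>auto simp: a_def\<close>)
      also have "1 - cnj u = u + of_real h" using u by (simp add: complex_eq_iff a_def)
      finally show "norm (Q u) \<le> 1" by (simp add: Q_def norm_divide)
    next
      fix u assume u: "Re u = A"
      have "Re (logLambda (Complex A (Im u))) \<le> Re (logLambda (Complex (A + h) (Im u)))"
        by (rule Re_logLambda_mono_right[OF A(3) A(1)]) (use h in auto)
      moreover have "Complex A (Im u) = u" "Complex (A + h) (Im u) = u + of_real h"
        using u by (auto simp: complex_eq_iff)
      ultimately have "Re (logLambda u) \<le> Re (logLambda (u + of_real h))" by simp
      moreover have "Re u > 1 / 2" "Re (u + of_real h) > 1 / 2" using u A h by auto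
      ultimately show "norm (Q u) \<le> 1" by (simp add: Q_def norm_divide norm_Lambda)
    qed
    moreover have "Re (s + of_real h) > 1 / 2" using s h by simp
    ultimately show ?thesis using s by (simp add: Q_def norm_divide norm_Lambda)
  qed
  show ?thesis
  proof (rule ccontr)
    assume "\<not> Re (g s) \<ge> 0"
    hence neg: "Re (g s) < 0" by simp
    have "((\<lambda>x. Re (logLambda (Complex x (Im s)))) has_field_derivative Re (g (Complex (Re s) (Im s)))) (at (Re s))"
      by (rule Re_logLambda_derivative[OF s])
    hence "((\<lambda>x. Re (logLambda (Complex x (Im s)))) has_field_derivative Re (g s)) (at (Re s))" by simp
    from has_real_derivative_neg_dec_right[OF this neg] obtain d where d: "d > 0"
      "\<And>h. h > 0 \<Longrightarrow> h < d \<Longrightarrow> Re (logLambda (Complex (Re s) (Im s))) > Re (logLambda (Complex (Re s + h) (Im s)))"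
      by auto
    define h where "h = min (d / 2) (1 / 4)"
    have h: "h > 0" "h < d" "h < 1 / 2" using d by (auto simp: h_def min_def)
    have "Complex (Re s + h) (Im s) = s + of_real h" by (simp add: complex_eq_iff)
    thus False using d(2)[OF h(1,2)] mono[OF h(1,3)] by simp
  qed
qed

text \<open>\<open>half_plane_norm_growth\<close> carries the bound from Re u = 2 to the left at the
  price of the factor (3/2) / (c - 1/2).\<close>

lemma g_growth:
  assumes c: "c > 1 / 2"
  shows "\<exists>M. \<forall>u. Re u \<ge> c \<longrightarrow> norm (g u) \<le> M * (1 + norm u) powr (1 / 2)"
proof -
  obtain M where M: "M \<ge> 0" "\<And>u. Re u \<ge> 2 \<Longrightarrow> norm (g u) \<le> M * (1 + norm u) powr (1 / 2)"
    using g_growth_right by blast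
  define k where "k = max 1 (3 / 2 / (c - 1 / 2)) * 2"
  have k: "k \<ge> 2" "3 / 2 / (c - 1 / 2) * 2 \<le> k" by (auto simp: k_def)
  have "norm (g u) \<le> (M * k) * (1 + norm u) powr (1 / 2)" if u: "Re u \<ge> c" for u
  proof (cases "Re u \<ge> 2")
    case True
    have "M * (1 + norm u) powr (1 / 2) * 1 \<le> M * (1 + norm u) powr (1 / 2) * k"
      using M k by (intro mult_left_mono) auto
    thus ?thesis using M(2)[OF True] by (simp add: mult_ac)
  next
    case False
    have "norm (g (Complex (Re u) (Im u))) * (Re u - 1 / 2) \<le> norm (g (Complex 2 (Im u))) * (2 - 1 / 2)"
      by (rule half_plane_norm_growth[OF g_holomorphic Re_g_nonneg]) (use u c False in auto)
    hence "norm (g u) * (c - 1 / 2) \<le> norm (g (Complex 2 (Im u))) * (3 / 2)"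
      using u mult_left_mono[of "c - 1 / 2" "Re u - 1 / 2" "norm (g u)"] by simp
    hence "norm (g u) \<le> norm (g (Complex 2 (Im u))) * (3 / 2 / (c - 1 / 2))"
      using c by (simp add: field_simps)
    also have "\<dots> \<le> (M * (2 * (1 + norm u) powr (1 / 2))) * (3 / 2 / (c - 1 / 2))"
    proof (intro mult_right_mono)
      have n: "norm (Complex 2 (Im u)) \<le> 2 + norm u"
        using cmod_le[of "Complex 2 (Im u)"] abs_Im_le_cmod[of u] by simp
      have "(1 + norm (Complex 2 (Im u))) powr (1 / 2) \<le> (4 * (1 + norm u)) powr (1 / 2)"
      proof (intro powr_mono2)
        have "1 + q \<le> 4 * (1 + w)" if "q \<le> 2 + w" "0 \<le> w" for q w :: real
          using that by simp
        from this[OF n norm_ge_zero] show "1 + norm (Complex 2 (Im u)) \<le> 4 * (1 + norm u)" .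
      qed auto
      also have "\<dots> = 2 * (1 + norm u) powr (1 / 2)" by (subst powr_mult) (auto simp: powr_half_sqrt)
      finally have "M * (1 + norm (Complex 2 (Im u))) powr (1 / 2) \<le> M * (2 * (1 + norm u) powr (1 / 2))"
        using M by (intro mult_left_mono)
      thus "norm (g (Complex 2 (Im u))) \<le> M * (2 * (1 + norm u) powr (1 / 2))" using M(2)[of "Complex 2 (Im u)"] by simp
    qed (use c in auto)
    also have "\<dots> = M * (1 + norm u) powr (1 / 2) * (3 / 2 / (c - 1 / 2) * 2)" by simp
    also have "\<dots> \<le> M * (1 + norm u) powr (1 / 2) * k" using M k by (intro mult_left_mono) auto
    finally show ?thesis by (simp add: mult_ac)
  qed
  thus ?thesis by blast
qed

section \<open>The explicit formula\<close>

text \<open>The explicit formula is written in terms of y = log x; this is the integer part of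
  x.\<close>

definition N0 :: "real \<Rightarrow> nat" where "N0 y = nat \<lfloor>exp y\<rfloor>"

definition lsum :: "real \<Rightarrow> complex \<Rightarrow> complex" where
  "lsum y s = (\<Sum>n=1..N0 y. lcoeff f n * of_nat n powr (- s) * of_real (y - ln (real n)))"

text \<open>An antiderivative of \<open>- lsum\<close> in s, hence the sum that appears once the
  explicit formula is integrated over \<sigma>.\<close>

definition logsum :: "real \<Rightarrow> complex \<Rightarrow> complex" where
  "logsum y s = (\<Sum>n=1..N0 y. logcoeff f n * of_nat n powr (- s) * of_real (y - ln (real n)))"

lemma le_N0_iff: "n \<ge> 1 \<Longrightarrow> n \<le> N0 y \<longleftrightarrow> ln (real n) \<le> y"
proof -
  assume n: "n \<ge> 1"
  have "n \<le> N0 y \<longleftrightarrow> real n \<le> exp y" unfolding N0_def by (simp add: le_nat_iff le_floor_iff)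
  also have "\<dots> \<longleftrightarrow> ln (real n) \<le> y" using n by (metis exp_le_cancel_iff exp_ln of_nat_0_less_iff less_le_trans zero_less_one)
  finally show ?thesis .
qed

text \<open>On Re w = 1 the point \<sigma> + w lies in the region of absolute convergence. The n-th
  term has modulus \<open>a n * (exp y / (1 + t\<^sup>2))\<close> with a summable \<open>a\<close>,
  so series and integral may be exchanged, and by \<open>perron_kernel\<close> only n \<le> x
  survive.\<close>

lemma perron_D:
  assumes s: "\<sigma> > 1 / 2" and y: "y > 0"
  defines "F \<equiv> \<lambda>w. D (of_real \<sigma> + w) * exp (of_real y * w) / w\<^sup>2"
  shows "vint F 1 = 2 * pi * lsum y (of_real \<sigma>)"
proof -
  define c where "c n = lcoeff f (Suc n) * of_nat (Suc n) powr (- of_real \<sigma>)" for n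
  define h where "h n = (\<lambda>w::complex. exp (of_real (y - ln (real (Suc n))) * w) / w\<^sup>2)" for n
  define a where "a n = norm (lcoeff f (Suc n) * of_nat (Suc n) powr (- (of_real (\<sigma> + 1))))" for n
  have a: "summable a" unfolding a_def by (rule D_abs_summable) (use s in simp)
  have hi: "integrable lborel (\<lambda>t. h n (Complex 1 t))" "vint (h n) 1 = 2 * pi * max (y - ln (real (Suc n))) 0" for n
    unfolding h_def by (rule perron_kernel; simp)+
  have nh: "norm (h n (Complex 1 t)) = exp y / real (Suc n) / (1 + t\<^sup>2)" for n t
  proof -
    have "norm ((Complex 1 t)\<^sup>2) = 1 + t\<^sup>2" by (simp add: norm_power cmod_power2)
    moreover have "norm (exp (of_real (y - ln (real (Suc n))) * Complex 1 t)) = exp y / real (Suc n)"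
      by (simp add: exp_diff del: of_nat_Suc)
    ultimately show ?thesis by (simp add: h_def norm_divide)
  qed
  have nc: "norm (c n) = a n * real (Suc n)" for n
  proof -
    have "norm (c n) = norm (lcoeff f (Suc n)) * real (Suc n) powr (- \<sigma>)"
      unfolding c_def norm_mult norm_Suc_powr by simp
    also have "real (Suc n) powr (- \<sigma>) = real (Suc n) powr (- (\<sigma> + 1)) * real (Suc n) powr 1"
      unfolding powr_add[symmetric] by simp
    also have "norm (lcoeff f (Suc n)) * \<dots> = a n * real (Suc n)"
      unfolding a_def norm_mult norm_Suc_powr by simp
    finally show ?thesis .
  qed
  have na: "norm (c n * h n (Complex 1 t)) = a n * (exp y / (1 + t\<^sup>2))" for n t
    unfolding norm_mult nh nc by simp
  have F: "F (Complex 1 t) = (\<Sum>n. c n * h n (Complex 1 t))" for t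
  proof -
    define w where "w = Complex 1 t"
    have sm: "summable (\<lambda>n. lcoeff f (Suc n) * of_nat (Suc n) powr (- (of_real \<sigma> + w)))"
      by (rule summable_norm_cancel[OF D_abs_summable]) (use s in \<open>simp add: w_def\<close>)
    have t: "c n * h n w = (exp (of_real y * w) / w\<^sup>2) * (lcoeff f (Suc n) * of_nat (Suc n) powr (- (of_real \<sigma> + w)))" for n
    proof -
      have "of_nat (Suc n) powr z = exp (z * of_real (ln (real (Suc n))))" for z :: complex
        by (simp add: powr_def Ln_of_nat del: of_nat_Suc)
      hence "of_nat (Suc n) powr (- of_real \<sigma>) * exp (of_real (y - ln (real (Suc n))) * w) =
          exp (of_real y * w) * of_nat (Suc n) powr (- (of_real \<sigma> + w))"
        by (simp add: exp_add[symmetric] algebra_simps del: of_nat_Suc)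
      thus ?thesis by (simp add: c_def h_def del: of_nat_Suc)
    qed
    have "(\<Sum>n. c n * h n w) = (exp (of_real y * w) / w\<^sup>2) * D (of_real \<sigma> + w)"
      unfolding t D_def dseries_def by (rule suminf_mult[OF sm])
    thus ?thesis by (simp add: F_def w_def)
  qed
  have "vint F 1 = (LINT t|lborel. (\<Sum>n. c n * h n (Complex 1 t)))" unfolding vint_def F ..
  also have "\<dots> = (\<Sum>n. (LINT t|lborel. c n * h n (Complex 1 t)))"
  proof (rule integral_suminf)
    show "integrable lborel (\<lambda>t. c n * h n (Complex 1 t))" for n using hi by simp
    show "AE t in lborel. summable (\<lambda>n. norm (c n * h n (Complex 1 t)))"
      unfolding na by (intro AE_I2 summable_mult2 a)
    have "(LINT t|lborel. norm (c n * h n (Complex 1 t))) = a n * (LINT t|lborel. exp y / (1 + t\<^sup>2))" for n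
      unfolding na by (rule integral_mult_right_zero)
    thus "summable (\<lambda>n. LINT t|lborel. norm (c n * h n (Complex 1 t)))"
      using summable_mult2[OF a] by simp
  qed
  also have "\<dots> = (\<Sum>n. c n * (2 * pi * max (y - ln (real (Suc n))) 0))"
    using hi(2) by (simp add: vint_def del: of_nat_Suc)
  also have "\<dots> = (\<Sum>n<N0 y. c n * (2 * pi * max (y - ln (real (Suc n))) 0))"
  proof (rule suminf_finite)
    fix n assume "n \<notin> {..<N0 y}"
    hence "\<not> Suc n \<le> N0 y" by simp
    hence "y - ln (real (Suc n)) < 0" using le_N0_iff[of "Suc n" y] by simp
    thus "c n * (2 * pi * max (y - ln (real (Suc n))) 0) = 0" by (simp add: max_def)
  qed auto
  also have "\<dots> = (\<Sum>n<N0 y. 2 * pi * (c n * (y - ln (real (Suc n)))))"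
  proof (intro sum.cong refl)
    fix n assume "n \<in> {..<N0 y}"
    hence "y - ln (real (Suc n)) \<ge> 0" using le_N0_iff[of "Suc n" y] by simp
    thus "c n * (2 * pi * max (y - ln (real (Suc n))) 0) = 2 * pi * (c n * (y - ln (real (Suc n))))"
      by (simp add: max_def mult_ac del: of_nat_Suc)
  qed
  also have "\<dots> = 2 * pi * (\<Sum>n<N0 y. c n * (y - ln (real (Suc n))))" by (rule sum_distrib_left[symmetric])
  also have "(\<Sum>n<N0 y. c n * (y - ln (real (Suc n)))) = lsum y (of_real \<sigma>)"
    unfolding lsum_def c_def
    by (rule sum.reindex_bij_witness[where i = "\<lambda>n. n - 1" and j = Suc]) auto
  finally show ?thesis .
qed

text \<open>This is L'/L, continued to Re s > 1/2.\<close>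

definition M :: "complex \<Rightarrow> complex" where "M s = g s - E s"

lemma M_deriv: "Re s > 1 / 2 \<Longrightarrow> (M has_field_derivative deriv M s) (at s)"
proof (rule holomorphic_derivI[where S = "{s. Re s > 1 / 2}"])
  show "M holomorphic_on {s. Re s > 1 / 2}"
    unfolding M_def[abs_def]
    by (intro holomorphic_intros g_holomorphic holomorphic_on_subset[OF E_holomorphic]) auto
  show "open {s. Re s > 1 / 2}" by (rule open_halfspace_Re_gt)
qed auto

text \<open>On Re w = 1 one has -D = g - E, and each part is moved to the left as far as it allows:
  \<open>g\<close> up to the critical line, where positivity controls it, and \<open>E\<close> to Re
  s = 1/4, where its Hoelder bound still holds. This gives the two error terms; the constant of the
  second comes from 48 * 50 \<le> 2 pi * 400.\<close>

lemma explicit_formula: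
  assumes s: "\<sigma> > 1 / 2" and y: "y > 0"
  shows "norm (lsum y (of_real \<sigma>) + deriv M (of_real \<sigma>) + of_real y * M (of_real \<sigma>)) \<le>
    exp (- y * (\<sigma> - 1 / 2)) * Re (g (of_real \<sigma>)) / (\<sigma> - 1 / 2) + 400 * real (deg f) * exp (- y * (\<sigma> - 1 / 4))"
proof -
  define gs where "gs w = g (of_real \<sigma> + w)" for w
  define Es where "Es w = E (of_real \<sigma> + w)" for w
  define Fg where "Fg = (\<lambda>w. gs w * exp (of_real y * w) / w\<^sup>2)"
  define FE where "FE = (\<lambda>w. Es w * exp (of_real y * w) / w\<^sup>2)"
  define FD where "FD = (\<lambda>w. D (of_real \<sigma> + w) * exp (of_real y * w) / w\<^sup>2)"
  have gh: "gs holomorphic_on {w. Re w > - (\<sigma> - 1 / 2)}"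
    unfolding gs_def[abs_def]
    by (rule holomorphic_on_compose_gen[OF _ g_holomorphic, unfolded o_def]) (auto intro!: holomorphic_intros)
  have Eh: "Es holomorphic_on {w. Re w > - \<sigma>}"
    unfolding Es_def[abs_def]
    by (rule holomorphic_on_compose_gen[OF _ E_holomorphic, unfolded o_def]) (auto intro!: holomorphic_intros)
  have growth: "\<exists>M. \<forall>w. Re w \<ge> - b \<longrightarrow> norm (gs w) \<le> M * (1 + norm w) powr (1 / 2)"
    if b: "0 < b" "b < \<sigma> - 1 / 2" for b
  proof -
    obtain M where M: "\<And>u. Re u \<ge> \<sigma> - b \<Longrightarrow> norm (g u) \<le> M * (1 + norm u) powr (1 / 2)"
      using g_growth[of "\<sigma> - b"] b by force
    have M0: "M \<ge> 0" using order_trans[OF norm_ge_zero M[of "of_real \<sigma>"]] b s by (simp add: zero_le_mult_iff)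
    have "norm (gs w) \<le> (M * (1 + \<sigma>) powr (1 / 2)) * (1 + norm w) powr (1 / 2)" if w: "Re w \<ge> - b" for w
    proof -
      have "norm (gs w) \<le> M * (1 + norm (of_real \<sigma> + w)) powr (1 / 2)"
        unfolding gs_def using w by (intro M) auto
      also have "\<dots> \<le> M * ((1 + \<sigma>) powr (1 / 2) * (1 + norm w) powr (1 / 2))"
      proof (intro mult_left_mono powr_half_le)
        have "norm (of_real \<sigma> + w) \<le> \<sigma> + norm w" using norm_triangle_ineq[of "of_real \<sigma>" w] s by simp
        moreover have "0 \<le> \<sigma> * norm w" using s by simp
        ultimately show "1 + norm (of_real \<sigma> + w) \<le> (1 + \<sigma>) * (1 + norm w)" by (simp add: algebra_simps)
      qed (use s M0 in auto)
      finally show ?thesis by (simp add: mult_ac)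
    qed
    thus ?thesis by blast
  qed
  have dg: "\<sigma> - 1 / 2 > 0" using s by simp
  have pos: "Re (gs w) \<ge> 0" if "Re w > - (\<sigma> - 1 / 2)" for w
    unfolding gs_def using that by (intro Re_g_nonneg) auto
  have y0: "y \<ge> 0" using y by simp
  have c1: "(1::real) > 0" by simp
  have Fg: "integrable lborel (\<lambda>t. Fg (Complex 1 t))"
    "norm (vint Fg 1 - 2 * pi * (deriv gs 0 + y * gs 0)) \<le> 2 * pi * (exp (- y * (\<sigma> - 1 / 2)) * Re (gs 0) / (\<sigma> - 1 / 2))"
    unfolding Fg_def by (rule half_plane_explicit_formula[OF dg c1 y0 gh pos growth]; assumption)+
  have hoelder: "norm (Es w - Es 0) \<le> 50 * real (deg f) * sqrt (norm w)" if "Re w \<ge> - (\<sigma> - 1 / 4)" for w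
    using E_Hoelder[of "of_real \<sigma> + w" "of_real \<sigma>"] that s by (simp add: Es_def)
  have FE: "integrable lborel (\<lambda>t. FE (Complex 1 t))"
    "norm (vint FE 1 - 2 * pi * (deriv Es 0 + y * Es 0)) \<le> 48 * (50 * real (deg f)) * exp (- y * (\<sigma> - 1 / 4))"
    unfolding FE_def by (rule smooth_explicit_formula[where b = "\<sigma> - 1 / 4", OF _ _ c1 y0 _ Eh hoelder]; use s in auto)+
  have "Fg (Complex 1 t) - FE (Complex 1 t) = - FD (Complex 1 t)" for t
  proof -
    have "gs (Complex 1 t) = Es (Complex 1 t) - D (of_real \<sigma> + Complex 1 t)"
      unfolding gs_def Es_def using s by (intro g_eq) auto
    thus ?thesis by (simp add: Fg_def FE_def FD_def left_diff_distrib diff_divide_distrib)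
  qed
  hence "vint Fg 1 - vint FE 1 = - vint FD 1"
    unfolding vint_def using Fg(1) FE(1) by (simp flip: Bochner_Integration.integral_diff)
  also have "vint FD 1 = 2 * pi * lsum y (of_real \<sigma>)" unfolding FD_def by (rule perron_D[OF s y])
  finally have vd: "vint Fg 1 - vint FE 1 = - (2 * pi * lsum y (of_real \<sigma>))" .
  have dM: "deriv M (of_real \<sigma>) = deriv gs 0 - deriv Es 0"
  proof (rule DERIV_imp_deriv)
    have 1: "(gs has_field_derivative deriv gs 0) (at 0)"
      by (rule holomorphic_derivI[OF gh open_halfspace_Re_gt]) (use s in auto)
    have 2: "(Es has_field_derivative deriv Es 0) (at 0)"
      by (rule holomorphic_derivI[OF Eh open_halfspace_Re_gt]) (use s in auto)
    have "((\<lambda>u. gs (u - of_real \<sigma>) - Es (u - of_real \<sigma>)) has_field_derivative deriv gs 0 - deriv Es 0) (at (of_real \<sigma>))"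
      using 1 2 by (auto intro!: derivative_eq_intros DERIV_chain2[where f = gs] DERIV_chain2[where f = Es])
    moreover have "(\<lambda>u. gs (u - of_real \<sigma>) - Es (u - of_real \<sigma>)) = M"
      by (auto simp: gs_def Es_def M_def fun_eq_iff)
    ultimately show "(M has_field_derivative deriv gs 0 - deriv Es 0) (at (of_real \<sigma>))" by simp
  qed
  have "2 * pi * (lsum y (of_real \<sigma>) + deriv M (of_real \<sigma>) + of_real y * M (of_real \<sigma>)) =
     (vint FE 1 - 2 * pi * (deriv Es 0 + y * Es 0)) - (vint Fg 1 - 2 * pi * (deriv gs 0 + y * gs 0))"
    using vd unfolding dM by (simp add: M_def gs_def Es_def algebra_simps)
  hence "norm (2 * pi * (lsum y (of_real \<sigma>) + deriv M (of_real \<sigma>) + of_real y * M (of_real \<sigma>))) \<le>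
     48 * (50 * real (deg f)) * exp (- y * (\<sigma> - 1 / 4)) + 2 * pi * (exp (- y * (\<sigma> - 1 / 2)) * Re (gs 0) / (\<sigma> - 1 / 2))"
    using norm_triangle_ineq4 Fg(2) FE(2) by (smt (verit))
  also have "norm (2 * pi * (lsum y (of_real \<sigma>) + deriv M (of_real \<sigma>) + of_real y * M (of_real \<sigma>))) =
     2 * pi * norm (lsum y (of_real \<sigma>) + deriv M (of_real \<sigma>) + of_real y * M (of_real \<sigma>))"
    by (simp add: norm_mult)
  also have "48 * (50 * real (deg f)) * exp (- y * (\<sigma> - 1 / 4)) \<le> 2 * pi * (400 * real (deg f) * exp (- y * (\<sigma> - 1 / 4)))"
  proof -
    have "2400 * (real (deg f) * exp (- y * (\<sigma> - 1 / 4))) \<le> (2 * pi * 400) * (real (deg f) * exp (- y * (\<sigma> - 1 / 4)))"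
      using pi_gt3 by (intro mult_right_mono) auto
    thus ?thesis by (simp add: mult_ac)
  qed
  finally have "2 * pi * norm (lsum y (of_real \<sigma>) + deriv M (of_real \<sigma>) + of_real y * M (of_real \<sigma>)) \<le>
     2 * pi * (exp (- y * (\<sigma> - 1 / 2)) * Re (gs 0) / (\<sigma> - 1 / 2) + 400 * real (deg f) * exp (- y * (\<sigma> - 1 / 4)))"
    by (simp add: distrib_left)
  hence "norm (lsum y (of_real \<sigma>) + deriv M (of_real \<sigma>) + of_real y * M (of_real \<sigma>)) \<le>
     exp (- y * (\<sigma> - 1 / 2)) * Re (gs 0) / (\<sigma> - 1 / 2) + 400 * real (deg f) * exp (- y * (\<sigma> - 1 / 4))"
    by (rule mult_left_le_imp_le) simp
  thus ?thesis by (simp add: gs_def)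
qed

section \<open>Integration of the explicit formula and passage to the central point\<close>

lemma logcoeff_1 [simp]: "logcoeff f (Suc 0) = 0"
  by (simp add: logcoeff_def)

lemma logsum_deriv: "(logsum y has_field_derivative - lsum y s) (at s)"
proof -
  have "((\<lambda>s. logcoeff f n * of_nat n powr (- s) * of_real (y - ln (real n))) has_field_derivative
      - (lcoeff f n * of_nat n powr (- s) * of_real (y - ln (real n)))) (at s)" if "n \<ge> 1" for n
  proof -
    have e: "of_nat n powr (- s) = exp (- s * of_real (ln (real n)))" for s :: complex
      using that by (auto simp: powr_def Ln_of_nat)
    have l: "lcoeff f n = logcoeff f n * of_real (ln (real n))" using logcoeff_ln[of f n] by simp
    show ?thesis unfolding e l by (auto intro!: derivative_eq_intros)
  qed
  thus ?thesis unfolding logsum_def[abs_def] lsum_def sum_negf[symmetric]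
    by (intro DERIV_sum) auto
qed

lemma logsum_tendsto_0: "((\<lambda>x::real. logsum y (of_real x)) \<longlongrightarrow> 0) at_top"
proof -
  have "((\<lambda>x::real. logcoeff f n * of_nat n powr (- of_real x) * of_real (y - ln (real n))) \<longlongrightarrow> 0) at_top"
    if "n \<in> {1..N0 y}" for n
  proof (cases "n = 1")
    case False
    hence n: "real n > 1" using that by auto
    have "((\<lambda>x::real. norm (of_nat n powr (- of_real x) :: complex)) \<longlongrightarrow> 0) at_top"
    proof -
      have "norm (of_nat n powr (- of_real x) :: complex) = real n powr (- x)" for x :: real
        using norm_powr_real_powr[of "of_nat n" "- of_real x"] n by simp
      moreover have "((\<lambda>x. real n powr (- x)) \<longlongrightarrow> 0) at_top" using n by real_asymp
      ultimately show ?thesis by simp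
    qed
    hence "((\<lambda>x::real. of_nat n powr (- of_real x) :: complex) \<longlongrightarrow> 0) at_top" by (rule tendsto_norm_zero_cancel)
    hence "((\<lambda>x::real. logcoeff f n * of_nat n powr (- of_real x) * of_real (y - ln (real n))) \<longlongrightarrow> logcoeff f n * 0 * of_real (y - ln (real n))) at_top"
      by (intro tendsto_intros)
    thus ?thesis by simp
  qed simp
  hence "((\<lambda>x::real. logsum y (of_real x)) \<longlongrightarrow> (\<Sum>n=1..N0 y. 0)) at_top"
    unfolding logsum_def by (intro tendsto_sum)
  thus ?thesis by simp
qed

text \<open>The branch is inherited from \<open>logLambda\<close> and may differ from the series for
  log L by a multiple of 2 pi i, so it is the real part ln |L| that is used below.\<close>

definition logL :: "complex \<Rightarrow> complex" where "logL s = logLambda s - Gexp s"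

lemma logL_deriv: "Re s > 1 / 2 \<Longrightarrow> (logL has_field_derivative M s) (at s)"
  unfolding logL_def[abs_def] M_def by (intro derivative_intros g_deriv Gexp(2)) auto

lemma Re_logL_tendsto_0: "((\<lambda>x::real. Re (logL (of_real x))) \<longlongrightarrow> 0) at_top"
proof -
  have "((\<lambda>x::real. dseries (logcoeff f) (of_real x)) \<longlongrightarrow> 0) at_top"
  proof (rule dseries_tendsto_0)
    fix n :: nat assume n: "n \<ge> 1"
    have "norm (logcoeff f n) \<le> real (deg f) * 1" using norm_logcoeff_le[OF ram n] by simp
    also have "\<dots> \<le> real (deg f) * real n" using n by (intro mult_left_mono) auto
    finally show "norm (logcoeff f n) \<le> real (deg f) * real n" .
  qed simp
  hence "((\<lambda>x::real. Re (dseries (logcoeff f) (of_real x))) \<longlongrightarrow> Re 0) at_top" by (rule tendsto_Re)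
  moreover have "\<forall>\<^sub>F x in at_top. Re (dseries (logcoeff f) (of_real x)) = Re (logL (of_real x))"
    using eventually_gt_at_top[of 1]
  proof eventually_elim
    fix x :: real assume x: "x > 1"
    have "norm (Lambda f (of_real x)) = exp (Re (Gexp (of_real x) + dseries (logcoeff f) (of_real x)))"
      by (subst L_exp) (use x in auto)
    moreover have "norm (Lambda f (of_real x)) = exp (Re (logLambda (of_real x)))"
      by (rule norm_Lambda) (use x in auto)
    ultimately show "Re (dseries (logcoeff f) (of_real x)) = Re (logL (of_real x))" by (simp add: logL_def)
  qed
  ultimately show ?thesis using Lim_transform_eventually by fastforce
qed

lemma Re_M_tendsto_0: "((\<lambda>x::real. Re (M (of_real x))) \<longlongrightarrow> 0) at_top"
proof -
  have "((\<lambda>x::real. D (of_real x)) \<longlongrightarrow> 0) at_top"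
    unfolding D_def
  proof (rule dseries_tendsto_0)
    fix n :: nat assume n: "n \<ge> 1"
    have "ln (real n) \<le> real n" using n by (intro order.trans[OF ln_le_minus_one]) auto
    hence "mangoldt n \<le> real n" using mangoldt_le[of n] n by linarith
    hence "real (deg f) * mangoldt n \<le> real (deg f) * real n" by (intro mult_left_mono) auto
    thus "norm (lcoeff f n) \<le> real (deg f) * real n" using norm_lcoeff_le[OF ram, of n] by linarith
  qed (simp add: lcoeff_def)
  hence "((\<lambda>x::real. - Re (D (of_real x))) \<longlongrightarrow> - Re 0) at_top" by (intro tendsto_intros)
  moreover have "\<forall>\<^sub>F x in at_top. - Re (D (of_real x)) = Re (M (of_real x))"
    using eventually_gt_at_top[of 1]
    by eventually_elim (simp add: M_def g_eq)
  ultimately show ?thesis using Lim_transform_eventually by fastforce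
qed

text \<open>Integration over x \<ge> 1/2 + \<delta> takes the form that \<open>P\<close> is
  nondecreasing and tends to 0 at infinity, whence its value at the left end is at most 0. As Re g
  (x) / (x - 1/2) is largest at the left end, it is replaced by its value k there, and the remaining
  exponential has an elementary primitive.\<close>

lemma log_L_right_bound:
  assumes d: "\<delta> > 0" and y: "y > 0"
  defines "s0 \<equiv> complex_of_real (1 / 2 + \<delta>)"
  shows "y * Re (logL s0) \<le> Re (logsum y s0) - Re (M s0) + Re (g s0) * exp (- y * \<delta>) / (\<delta> * y)
           + 400 * real (deg f) * exp (- y * (1 / 4 + \<delta>)) / y"
proof -
  define k where "k = Re (g s0) / \<delta>"
  define K where "K = 400 * real (deg f)"
  define P where "P x = y * Re (logL (Complex x 0)) + Re (M (Complex x 0)) - Re (logsum y (Complex x 0))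
     - k / y * exp (- y * (x - 1 / 2)) - K / y * exp (- y * (x - 1 / 4))" for x
  have der: "\<exists>z. (P has_real_derivative z) (at x) \<and> 0 \<le> z" if x: "x \<ge> 1 / 2 + \<delta>" for x
  proof -
    define u where "u = Complex x 0"
    have u: "Re u > 1 / 2" "u = of_real x" using x d by (auto simp: u_def complex_eq_iff)
    have d1: "((\<lambda>x. Re (logL (Complex x 0))) has_field_derivative Re (M u)) (at x)"
      unfolding u_def by (rule horizontal_derivative(1)[OF logL_deriv]) (use u in \<open>auto simp: u_def\<close>)
    have d2: "((\<lambda>x. Re (M (Complex x 0))) has_field_derivative Re (deriv M u)) (at x)"
      unfolding u_def by (rule horizontal_derivative(1)[OF M_deriv]) (use u in \<open>auto simp: u_def\<close>)
    have d3: "((\<lambda>x. Re (logsum y (Complex x 0))) has_field_derivative Re (- lsum y u)) (at x)"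
      unfolding u_def by (rule horizontal_derivative(1)[OF logsum_deriv])
    define z where "z = y * Re (M u) + Re (deriv M u) - Re (- lsum y u) + k * exp (- y * (x - 1 / 2)) + K * exp (- y * (x - 1 / 4))"
    have d4: "((\<lambda>x. k / y * exp (- y * (x - 1 / 2))) has_field_derivative - k * exp (- y * (x - 1 / 2))) (at x)"
      "((\<lambda>x. K / y * exp (- y * (x - 1 / 4))) has_field_derivative - K * exp (- y * (x - 1 / 4))) (at x)"
      using y by (auto intro!: derivative_eq_intros)
    have "(P has_real_derivative y * Re (M u) + Re (deriv M u) - Re (- lsum y u) - (- k * exp (- y * (x - 1 / 2))) - (- K * exp (- y * (x - 1 / 4)))) (at x)"
      unfolding P_def by (intro DERIV_diff DERIV_add DERIV_cmult d1 d2 d3 d4)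
    hence "(P has_real_derivative z) (at x)" by (simp add: z_def)
    moreover have "z \<ge> 0"
    proof -
      have "Re (lsum y u + deriv M u + of_real y * M u) \<ge>
          - (exp (- y * (x - 1 / 2)) * Re (g u) / (x - 1 / 2) + K * exp (- y * (x - 1 / 4)))"
        using explicit_formula[of x y] abs_Re_le_cmod[of "lsum y u + deriv M u + of_real y * M u"] x d y
        unfolding u(2) K_def by linarith
      moreover have "exp (- y * (x - 1 / 2)) * Re (g u) / (x - 1 / 2) \<le> exp (- y * (x - 1 / 2)) * k"
      proof -
        have "Re (g (Complex x 0)) / (x - 1 / 2) \<le> Re (g (Complex (1 / 2 + \<delta>) 0)) / (1 / 2 + \<delta> - 1 / 2)"
          by (rule Re_over_dist_antimono[OF g_holomorphic Re_g_nonneg]) (use x d in auto)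
        moreover have "Complex (1 / 2 + \<delta>) 0 = s0" by (simp add: s0_def complex_eq_iff)
        ultimately have "Re (g u) / (x - 1 / 2) \<le> k" by (simp add: k_def u_def)
        hence "exp (- y * (x - 1 / 2)) * (Re (g u) / (x - 1 / 2)) \<le> exp (- y * (x - 1 / 2)) * k"
          by (intro mult_left_mono) auto
        thus ?thesis by simp
      qed
      ultimately show ?thesis unfolding z_def by (simp add: mult.commute)
    qed
    ultimately show ?thesis by blast
  qed
  have mono: "P (1 / 2 + \<delta>) \<le> P x" if "x \<ge> 1 / 2 + \<delta>" for x
    by (rule DERIV_nonneg_imp_nondecreasing[OF that]) (use der in auto)
  have "((\<lambda>x. y * Re (logL (of_real x)) + Re (M (of_real x)) - Re (logsum y (of_real x))
     - k / y * exp (- y * (x - 1 / 2)) - K / y * exp (- y * (x - 1 / 4))) \<longlongrightarrow> y * 0 + 0 - Re 0 - k / y * 0 - K / y * 0) at_top"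
  proof (intro tendsto_intros Re_logL_tendsto_0 Re_M_tendsto_0 logsum_tendsto_0)
    show "((\<lambda>x. exp (- y * (x - 1 / 2))) \<longlongrightarrow> 0) at_top" using y by real_asymp
    show "((\<lambda>x. exp (- y * (x - 1 / 4))) \<longlongrightarrow> 0) at_top" using y by real_asymp
  qed
  moreover have "(\<lambda>x. y * Re (logL (of_real x)) + Re (M (of_real x)) - Re (logsum y (of_real x))
     - k / y * exp (- y * (x - 1 / 2)) - K / y * exp (- y * (x - 1 / 4))) = P"
  proof -
    have "Complex x 0 = of_real x" for x by (simp add: complex_eq_iff)
    thus ?thesis by (simp add: P_def[abs_def])
  qed
  ultimately have "(P \<longlongrightarrow> 0) at_top" by simp
  moreover have "\<forall>\<^sub>F x in at_top. P (1 / 2 + \<delta>) \<le> P x"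
    using eventually_ge_at_top[of "1 / 2 + \<delta>"] by eventually_elim (rule mono)
  ultimately have "P (1 / 2 + \<delta>) \<le> 0" by (intro tendsto_lowerbound) auto
  moreover have "Complex (1 / 2 + \<delta>) 0 = s0" by (simp add: s0_def complex_eq_iff)
  moreover have "1 / 2 + \<delta> - 1 / 4 = 1 / 4 + \<delta>" "1 / 2 + \<delta> - 1 / 2 = \<delta>" by simp_all
  ultimately show ?thesis unfolding P_def K_def k_def by (simp add: mult_ac)
qed

text \<open>The gamma factor has neither poles nor zeros for Re s > 0, so
  \<open>remove_sings\<close> does not alter the quotient at 1/2.\<close>

lemma L_fun_half: "L_fun f (1 / 2) = Lambda f (1 / 2) / exp (Gexp (1 / 2))"
proof -
  let ?q = "\<lambda>s. Lambda f s / (of_nat (cond f) powr (s / 2) * gamma_factor f s)"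
  have "Gexp holomorphic_on {s. Re s > 0}"
    unfolding holomorphic_on_open[OF open_halfspace_Re_gt] using Gexp(2) by blast
  hence "(\<lambda>s. Lambda f s / exp (Gexp s)) holomorphic_on {s. Re s > 0}"
    by (intro holomorphic_intros holomorphic_Lambda) auto
  hence "?q holomorphic_on {s. Re s > 0}"
    by (rule holomorphic_cong[THEN iffD1, rotated 2]) (auto simp: Gexp)
  hence "?q analytic_on {1 / 2}"
    unfolding analytic_at by (intro exI[of _ "{s. Re s > 0}"]) (auto simp: open_halfspace_Re_gt)
  hence "L_fun f (1 / 2) = ?q (1 / 2)" unfolding L_fun_def by (rule remove_sings_at_analytic)
  thus ?thesis using Gexp(1)[of "1 / 2"] by simp
qed

text \<open>On (1/2, 1/2 + \<delta>] the quotient Re g / (x - 1/2) is at least its value F /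
  \<delta> at the right end, so Re (L'/L) = Re g - Re E \<ge> (F / \<delta>) (x - 1/2) - e.
  Integrated over the interval, the linear term contributes \<delta> F / 2.\<close>

lemma log_L_half_bound:
  assumes d: "\<delta> > 0" and nz: "Lambda f (1 / 2) \<noteq> 0"
    and Em: "\<And>x. 1 / 2 \<le> x \<Longrightarrow> x \<le> 1 / 2 + \<delta> \<Longrightarrow> Re (E (of_real x)) \<le> e"
  defines "s0 \<equiv> complex_of_real (1 / 2 + \<delta>)"
  shows "ln (norm (L_fun f (1 / 2))) \<le> Re (logL s0) - \<delta> / 2 * Re (g s0) + \<delta> * e"
proof -
  define F where "F = Re (g s0)"
  define H where "H x = Re (logL (Complex x 0)) - F / (2 * \<delta>) * (x - 1 / 2)\<^sup>2 + e * (x - 1 / 2)" for x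
  have mono: "H x \<le> H (1 / 2 + \<delta>)" if x: "1 / 2 < x" "x \<le> 1 / 2 + \<delta>" for x
  proof (rule DERIV_nonneg_imp_nondecreasing[OF x(2)])
    fix v assume v: "x \<le> v" "v \<le> 1 / 2 + \<delta>"
    define u where "u = Complex v 0"
    have u: "Re u > 1 / 2" "u = of_real v" using x v by (auto simp: u_def complex_eq_iff)
    have d1: "((\<lambda>x. Re (logL (Complex x 0))) has_field_derivative Re (M u)) (at v)"
      unfolding u_def by (rule horizontal_derivative(1)[OF logL_deriv]) (use u in \<open>auto simp: u_def\<close>)
    have d2: "((\<lambda>x. F / (2 * \<delta>) * (x - 1 / 2)\<^sup>2) has_field_derivative F / \<delta> * (v - 1 / 2)) (at v)"
      "((\<lambda>x. e * (x - 1 / 2)) has_field_derivative e) (at v)"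
      using d by (auto intro!: derivative_eq_intros simp: field_simps)
    have "(H has_real_derivative Re (M u) - F / \<delta> * (v - 1 / 2) + e) (at v)"
      unfolding H_def by (intro DERIV_diff DERIV_add d1 d2)
    moreover have "Re (M u) - F / \<delta> * (v - 1 / 2) + e \<ge> 0"
    proof -
      have "Re (g (Complex (1 / 2 + \<delta>) 0)) / (1 / 2 + \<delta> - 1 / 2) \<le> Re (g (Complex v 0)) / (v - 1 / 2)"
        by (rule Re_over_dist_antimono[OF g_holomorphic Re_g_nonneg]) (use x v in auto)
      moreover have "Complex (1 / 2 + \<delta>) 0 = s0" by (simp add: s0_def complex_eq_iff)
      ultimately have "F / \<delta> \<le> Re (g u) / (v - 1 / 2)" by (simp add: F_def u_def)
      hence "F / \<delta> * (v - 1 / 2) \<le> Re (g u)" using x v by (simp add: pos_le_divide_eq)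
      moreover have "Re (E u) \<le> e" unfolding u(2) using x v by (intro Em) auto
      ultimately show ?thesis by (simp add: M_def)
    qed
    ultimately show "\<exists>y. (H has_real_derivative y) (at v) \<and> 0 \<le> y" by blast
  qed
  \<comment> \<open>\<open>logLambda\<close> gives no information at 1/2 itself. \<open>R\<close>
    agrees with \<open>H\<close> to the right of 1/2 and is continuous at 1/2 because
    \<open>Lambda f\<close> does not vanish there.\<close>
  define R where "R x = ln (norm (Lambda f (Complex x 0) / exp (Gexp (Complex x 0))))
      - F / (2 * \<delta>) * (x - 1 / 2)\<^sup>2 + e * (x - 1 / 2)" for x
  have RH: "R x = H x" if "x > 1 / 2" for x
  proof -
    have "norm (Lambda f (Complex x 0) / exp (Gexp (Complex x 0))) = exp (Re (logL (Complex x 0)))"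
      using that by (simp add: norm_divide norm_Lambda logL_def exp_diff)
    thus ?thesis by (simp add: R_def H_def)
  qed
  have c: "isCont (\<lambda>s. Lambda f s / exp (Gexp s)) (Complex (1 / 2) 0)"
  proof -
    have "isCont (Lambda f) (Complex (1 / 2) 0)"
      using holomorphic_on_imp_continuous_on[OF holomorphic_Lambda[of UNIV]] by (simp add: continuous_on_eq_continuous_at)
    moreover have "isCont Gexp (Complex (1 / 2) 0)" by (rule DERIV_isCont[OF Gexp(2)]) simp
    ultimately show ?thesis by (intro continuous_intros) auto
  qed
  have c2: "isCont (\<lambda>x. Complex x 0) (1 / 2)"
  proof -
    have "(\<lambda>x. Complex x 0) = of_real" by (auto simp: complex_eq_iff)
    thus ?thesis by simp
  qed
  have half: "Complex (1 / 2) 0 = 1 / 2" by (simp add: complex_eq_iff)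
  define q where "q = (\<lambda>x. Lambda f (Complex x 0) / exp (Gexp (Complex x 0)))"
  have "isCont q (1 / 2)" unfolding q_def by (rule isCont_o2[OF c2 c])
  moreover have "q (1 / 2) \<noteq> 0" using nz by (simp add: q_def half)
  moreover have "R = (\<lambda>x. ln (norm (q x)) - F / (2 * \<delta>) * (x - 1 / 2)\<^sup>2 + e * (x - 1 / 2))"
    by (simp add: R_def[abs_def] q_def)
  ultimately have "isCont R (1 / 2)" using d by (auto intro!: continuous_intros)
  hence "(R \<longlongrightarrow> R (1 / 2)) (at_right (1 / 2))" by (simp add: isCont_def filterlim_at_split)
  moreover have "\<forall>\<^sub>F x in at_right (1 / 2). R x \<le> H (1 / 2 + \<delta>)"
  proof -
    have "\<forall>\<^sub>F x in at_right (1 / 2). x \<in> {1 / 2<..<1 / 2 + \<delta>}"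
      by (rule eventually_at_right_real) (use d in auto)
    thus ?thesis by eventually_elim (use RH mono in auto)
  qed
  ultimately have "R (1 / 2) \<le> H (1 / 2 + \<delta>)" by (intro tendsto_upperbound) auto
  moreover have "R (1 / 2) = ln (norm (L_fun f (1 / 2)))" by (simp add: R_def half L_fun_half)
  moreover have "H (1 / 2 + \<delta>) = Re (logL s0) - \<delta> / 2 * F + \<delta> * e"
  proof -
    have "Complex (1 / 2 + \<delta>) 0 = s0" by (simp add: s0_def complex_eq_iff)
    thus ?thesis using d by (simp add: H_def power2_eq_square mult.commute)
  qed
  ultimately show ?thesis by (simp add: F_def)
qed

text \<open>With \<delta> = l / y the terms in F = Re (g s0) add up to (F / y) (exp (-l) / l - 1 - l
  / 2), where the three parts stem from the contribution of the zeros, from M = g - E and from the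
  passage to 1/2. The assumption on l makes the bracket nonpositive. The term e enters with weight 1
  / y on the right of s0 and l / y on its left.\<close>

theorem log_L_bound:
  assumes lam: "l > 0" "exp (- l) \<le> l + l\<^sup>2 / 2" and y: "y > 0" and nz: "Lambda f (1 / 2) \<noteq> 0"
    and Em: "\<And>x. 1 / 2 \<le> x \<Longrightarrow> x \<le> 1 / 2 + l / y \<Longrightarrow> Re (E (of_real x)) \<le> e"
  shows "ln (norm (L_fun f (1 / 2))) \<le>
     norm (logsum y (of_real (1 / 2 + l / y))) / y + (1 + l) / y * e + 400 * real (deg f) * exp (- y / 4) / y\<^sup>2"
proof -
  define s0 where "s0 = complex_of_real (1 / 2 + l / y)"
  define F where "F = Re (g s0)"
  have d: "l / y > 0" using lam y by simp
  have F: "F \<ge> 0" unfolding F_def by (rule Re_g_nonneg) (use d in \<open>simp add: s0_def\<close>)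
  have "y * Re (logL s0) \<le> Re (logsum y s0) - Re (M s0) + Re (g s0) * exp (- y * (l / y)) / ((l / y) * y)
           + 400 * real (deg f) * exp (- y * (1 / 4 + l / y)) / y"
    unfolding s0_def by (rule log_L_right_bound[OF d y])
  also have "Re (logsum y s0) \<le> norm (logsum y s0)" by (rule complex_Re_le_cmod)
  also have "- y * (l / y) = - l" using y by simp
  also have "(l / y) * y = l" using y by simp
  also have "exp (- y * (1 / 4 + l / y)) \<le> exp (- y / 4)" using lam y by (simp add: field_simps)
  finally have "y * Re (logL s0) \<le> norm (logsum y s0) - Re (M s0) + F * exp (- l) / l + 400 * real (deg f) * exp (- y / 4) / y"
    using y by (simp add: F_def divide_right_mono mult_left_mono)
  moreover have "Re (M s0) = F - Re (E s0)" by (simp add: M_def F_def)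
  moreover have "Re (E s0) \<le> e" unfolding s0_def using d by (intro Em) auto
  ultimately have 1: "y * Re (logL s0) \<le> norm (logsum y s0) + e + F * (exp (- l) / l - 1) + 400 * real (deg f) * exp (- y / 4) / y"
    by (simp add: algebra_simps)
  have 2: "ln (norm (L_fun f (1 / 2))) \<le> Re (logL s0) - (l / y) / 2 * F + (l / y) * e"
    unfolding s0_def F_def by (rule log_L_half_bound[OF d nz Em])
  have "exp (- l) / l \<le> 1 + l / 2" using lam by (simp add: divide_le_eq power2_eq_square algebra_simps)
  hence "exp (- l) / l - 1 \<le> l / 2" by linarith
  hence "F * (exp (- l) / l - 1) \<le> F * (l / 2)" using F by (rule mult_left_mono)
  hence "y * Re (logL s0) \<le> norm (logsum y s0) + e + F * (l / 2) + 400 * real (deg f) * exp (- y / 4) / y"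
    using 1 by linarith
  hence "Re (logL s0) \<le> (norm (logsum y s0) + e + F * (l / 2) + 400 * real (deg f) * exp (- y / 4) / y) / y"
    using y by (simp add: pos_le_divide_eq mult.commute)
  also have "\<dots> = norm (logsum y s0) / y + e / y + (l / y) / 2 * F + 400 * real (deg f) * exp (- y / 4) / y\<^sup>2"
    using y by (simp add: field_simps power2_eq_square)
  finally have "ln (norm (L_fun f (1 / 2))) \<le> norm (logsum y s0) / y + (e / y + (l / y) * e) + 400 * real (deg f) * exp (- y / 4) / y\<^sup>2"
    using 2 by linarith
  moreover have "e / y + (l / y) * e = (1 + l) / y * e" by (simp add: distrib_right add_divide_distrib)
  ultimately show ?thesis by (simp add: s0_def)
qed

end

section \<open>A Chebyshev bound\<close>

definition chebyshev_psi :: "nat \<Rightarrow> real" where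
  "chebyshev_psi n = (\<Sum>d=1..n. mangoldt d)"

text \<open>The range 1..N is common to all n \<le> N, with vanishing terms for d > n, so that
  identities for n, n div 2, n div 3 and so on can be combined term by term.\<close>

lemma ln_fact_mangoldt:
  assumes "n \<le> N"
  shows "ln (fact n) = (\<Sum>d=1..N. mangoldt d * real (n div d))"
  using assms
proof (induction n)
  case (Suc n)
  have "ln (fact (Suc n) :: real) = ln (real (Suc n)) + ln (fact n)"
    unfolding fact_Suc of_nat_mult by (subst ln_mult_pos) auto
  also have "ln (real (Suc n)) = (\<Sum>d | d dvd Suc n. mangoldt d)"
    using mangoldt_sum[of "Suc n", where ?'a = real] by simp
  also have "\<dots> = (\<Sum>d=1..N. if d dvd Suc n then mangoldt d else 0)"
  proof -
    have "(\<Sum>d=1..N. if d dvd Suc n then mangoldt d else 0) = sum mangoldt ({1..N} \<inter> {d. d dvd Suc n})"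
      by (subst sum.inter_restrict) auto
    also have "{1..N} \<inter> {d. d dvd Suc n} = {d. d dvd Suc n}"
    proof -
      have "d \<in> {1..N}" if "d dvd Suc n" for d
        using dvd_imp_le[OF that] that Suc.prems by (cases "d = 0") auto
      thus ?thesis by blast
    qed
    finally show ?thesis by (rule sym)
  qed
  also have "ln (fact n) = (\<Sum>d=1..N. mangoldt d * real (n div d))" using Suc by simp
  also have "(\<Sum>d=1..N. if d dvd Suc n then mangoldt d else 0) + (\<Sum>d=1..N. mangoldt d * real (n div d)) =
      (\<Sum>d=1..N. mangoldt d * real (Suc n div d))"
    unfolding sum.distrib[symmetric]
    by (intro sum.cong refl) (auto simp: div_Suc dvd_eq_mod_eq_0 algebra_simps)
  finally show ?case .
qed simp

text \<open>Since 1 - 1/2 - 1/3 - 1/5 + 1/30 = 0, Chebyshev's combination of integer parts has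
  period 30, and the first claim is checked on residues.\<close>

lemma chebyshev_kernel:
  fixes m :: nat
  shows "m div 2 + m div 3 + m div 5 \<le> m + m div 30"
    and "1 \<le> m \<Longrightarrow> m \<le> 5 \<Longrightarrow> m div 2 + m div 3 + m div 5 + 1 \<le> m + m div 30"
proof -
  define q r where "q = m div 30" and "r = m mod 30"
  have m: "m = 30 * q + r" "r < 30" by (simp_all add: q_def r_def)
  have d: "m div 2 = 15 * q + r div 2" "m div 3 = 10 * q + r div 3" "m div 5 = 6 * q + r div 5" "m div 30 = q"
    using div_mult_self2[of 2 r "15 * q"] div_mult_self2[of 3 r "10 * q"] div_mult_self2[of 5 r "6 * q"] m
    by (simp_all add: add.commute)
  have "\<forall>r\<in>set [0..<30]. r div 2 + r div 3 + r div 5 \<le> r" by code_simp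
  thus "m div 2 + m div 3 + m div 5 \<le> m + m div 30" unfolding d using m by simp
  have "\<forall>m\<in>set [1..<6]. m div 2 + m div 3 + m div 5 + 1 \<le> m + m div 30" by code_simp
  thus "1 \<le> m \<Longrightarrow> m \<le> 5 \<Longrightarrow> m div 2 + m div 3 + m div 5 + 1 \<le> m + m div 30" by simp
qed

text \<open>For n div 6 < d \<le> n the quotient n div d lies between 1 and 5, where the kernel is
  at least 1; for the other d it is nonnegative.\<close>

lemma chebyshev_psi_step:
  "chebyshev_psi n \<le> chebyshev_psi (n div 6) +
     (ln (fact n) + ln (fact (n div 30)) - ln (fact (n div 2)) - ln (fact (n div 3)) - ln (fact (n div 5)))"
proof -
  define k where "k m = real m + real (m div 30) - real (m div 2) - real (m div 3) - real (m div 5)" for m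
  have k0: "k m \<ge> 0" for m
    using of_nat_mono[OF chebyshev_kernel(1)[of m], where ?'a = real] by (simp add: k_def)
  have k1: "k m \<ge> 1" if "1 \<le> m" "m \<le> 5" for m
    using of_nat_mono[OF chebyshev_kernel(2)[OF that], where ?'a = real] by (simp add: k_def)
  have T: "ln (fact (n div j)) = (\<Sum>d=1..n. mangoldt d * real (n div d div j))" for j
    using ln_fact_mangoldt[of "n div j" n] by (simp add: div_mult2_eq[symmetric] mult.commute)
  have "ln (fact n) + ln (fact (n div 30)) - ln (fact (n div 2)) - ln (fact (n div 3)) - ln (fact (n div 5)) =
     (\<Sum>d=1..n. mangoldt d * k (n div d))"
    unfolding T ln_fact_mangoldt[of n n, OF order_refl] k_def
    by (simp add: sum.distrib sum_subtractf ring_distribs)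
  also have "\<dots> \<ge> (\<Sum>d=1..n. if d \<le> n div 6 then 0 else mangoldt d)"
  proof (rule sum_mono)
    fix d assume d: "d \<in> {1..n}"
    show "(if d \<le> n div 6 then 0 else mangoldt d) \<le> mangoldt d * k (n div d)"
    proof (cases "d \<le> n div 6")
      case False
      have "n div d < 6"
      proof (rule ccontr)
        assume "\<not> n div d < 6"
        hence "6 * d \<le> n div d * d" by simp
        also have "\<dots> \<le> n" by (rule div_times_less_eq_dividend)
        finally show False using False by (simp add: less_eq_div_iff_mult_less_eq mult.commute)
      qed
      moreover have "n div d \<ge> 1" using d by (simp add: div_greater_zero_iff Suc_le_eq)
      ultimately have "k (n div d) \<ge> 1" by (intro k1) auto
      thus ?thesis using False mult_left_mono[of 1 "k (n div d)" "mangoldt d"] mangoldt_nonneg[of d] by simp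
    qed (simp add: k0 mangoldt_nonneg)
  qed
  moreover have "(\<Sum>d=1..n. if d \<le> n div 6 then 0 else mangoldt d) + chebyshev_psi (n div 6) = chebyshev_psi n"
  proof -
    have "chebyshev_psi (n div 6) = (\<Sum>d=1..n. if d \<le> n div 6 then mangoldt d else 0)"
      unfolding chebyshev_psi_def
      by (rule sum.mono_neutral_cong_left) (auto intro: order.trans[OF _ div_le_dividend])
    thus ?thesis unfolding chebyshev_psi_def by (simp add: sum.distrib[symmetric] if_distrib cong: if_cong sum.cong)
  qed
  ultimately show ?thesis by linarith
qed

lemma exp_ge_Taylor: "x \<ge> 0 \<Longrightarrow> (\<Sum>k<n. x ^ k / fact k) \<le> exp (x :: real)"
  using Maclaurin_exp_le[of x n] by (auto intro!: mult_nonneg_nonneg)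

lemma ln_le_if_Taylor:
  assumes "c > 0" "x \<ge> 0" "c \<le> (\<Sum>k<n. x ^ k / fact k)"
  shows "ln c \<le> (x :: real)"
proof -
  have "c \<le> exp x" using exp_ge_Taylor[OF assms(2), of n] assms(3) by linarith
  thus ?thesis using assms(1) by (metis exp_gt_zero ln_exp ln_le_cancel_iff)
qed

lemma ln_numeral_bounds:
  "ln (2 :: real) \<le> 6945 / 10000" "ln (3 :: real) \<le> 11 / 10" "ln (5 :: real) \<le> 161 / 100"
  "ln (5 / 2 :: real) \<le> 92 / 100" "ln (30 :: real) \<ge> 3"
proof -
  show "ln (2 :: real) \<le> 6945 / 10000" using ln2_le_25_over_36 by linarith
  show "ln (3 :: real) \<le> 11 / 10"
    by (rule ln_le_if_Taylor[where n = 7]) (simp_all add: eval_nat_numeral fact_numeral)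
  show "ln (5 :: real) \<le> 161 / 100"
    by (rule ln_le_if_Taylor[where n = 10]) (simp_all add: eval_nat_numeral fact_numeral)
  show "ln (5 / 2 :: real) \<le> 92 / 100"
    by (rule ln_le_if_Taylor[where n = 6]) (simp_all add: eval_nat_numeral fact_numeral)
  have "exp (3 :: real) = exp 1 ^ 3" by (simp add: exp_of_nat_mult[symmetric])
  also have "\<dots> \<le> 3 ^ 3" by (intro power_mono exp_le) auto
  also have "\<dots> \<le> 30" by simp
  finally show "ln (30 :: real) \<ge> 3" by (subst ln_ge_iff) auto
qed

lemma ln_fact_Suc: "ln (fact (Suc n) :: real) = ln (real n + 1) + ln (fact n)"
  unfolding fact_Suc of_nat_mult by (subst ln_mult_pos) (auto simp: add.commute)

text \<open>Stirling's formula up to a constant: the induction step is the midpoint inequality (n +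
  1/2) (ln (n + 1) - ln n) \<ge> 1.\<close>

lemma ln_fact_upper: "n \<ge> 1 \<Longrightarrow> ln (fact n) \<le> (real n + 1 / 2) * ln (real n) - real n + 1"
proof (induction n rule: nat_induct_at_least)
  case (Suc n)
  have n: "real n \<ge> 1" using Suc by simp
  have "ln (real n + 1) - ln (real n) \<ge> 2 * (real n + 1 - real n) / (real n + (real n + 1))"
    using n by (intro ln_inverse_approx_ge) auto
  hence "(real n + 1 / 2) * (ln (real n + 1) - ln (real n)) \<ge> (real n + 1 / 2) * (2 / (2 * real n + 1))"
    using n by (intro mult_left_mono) auto
  also have "(real n + 1 / 2) * (2 / (2 * real n + 1)) = 1" using n by (simp add: field_simps)
  finally show ?case using Suc.IH unfolding ln_fact_Suc by (simp add: algebra_simps)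
qed auto

lemma ln_fact_lower: "n \<ge> 1 \<Longrightarrow> ln (fact n) \<ge> (real n + 1 / 2) * ln (real n) - real n + 1 / 2"
proof -
  \<comment> \<open>Strengthened by 1 / (2 n): the trapezoidal bound exceeds 1 by 1 / (4 n (n + 1)),
    which the difference of successive extra terms covers.\<close>
  have "n \<ge> 1 \<Longrightarrow> ln (fact n) \<ge> (real n + 1 / 2) * ln (real n) - real n + 1 / 2 + 1 / (2 * real n)"
  proof (induction n rule: nat_induct_at_least)
    case (Suc n)
    have n: "real n \<ge> 1" using Suc by simp
    have "ln (real n + 1) - ln (real n) \<le> 1 * (inverse (real n) + inverse (real n + 1)) / 2"
      using n by (intro ln_inverse_approx_le) auto
    hence "(real n + 1 / 2) * (ln (real n + 1) - ln (real n)) \<le> (real n + 1 / 2) * (1 * (inverse (real n) + inverse (real n + 1)) / 2)"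
      using n by (intro mult_left_mono) auto
    also have "\<dots> = 1 + 1 / (4 * (real n * (real n + 1)))"
      using n by (simp add: divide_simps) (simp add: algebra_simps)
    also have "\<dots> \<le> 1 + 1 / (2 * (real n * (real n + 1)))" using n by (intro add_left_mono divide_left_mono) auto
    also have "1 / (2 * (real n * (real n + 1))) = 1 / (2 * real n) - 1 / (2 * (real n + 1))" using n by (simp add: field_simps)
    finally show ?case using Suc.IH unfolding ln_fact_Suc by (simp add: algebra_simps)
  qed auto
  moreover assume "n \<ge> 1"
  moreover have "1 / (2 * real n) \<ge> 0" by simp
  ultimately show ?thesis by linarith
qed

text \<open>The tangent at m of the convex function v ln v - v, whose derivative is ln v.\<close>

lemma entropy_tangent:
  assumes "m > 0" "v > 0"
  shows "v * ln v - v \<ge> m * ln m - m + (v - m) * ln (m :: real)"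
proof -
  have "ln (m / v) \<le> m / v - 1" using assms by (intro ln_le_minus_one) auto
  hence "v * ln (m / v) \<le> v * (m / v - 1)" using assms by (intro mult_left_mono) auto
  thus ?thesis using assms by (simp add: ln_div algebra_simps)
qed

text \<open>The integer m = n div k is compared with the real quotient v by convexity, with the
  tangent at m for the upper and at v for the lower bound. Since v < 1 occurs when n < k, ln v
  enters through its positive part.\<close>

lemma ln_fact_div_bounds:
  fixes n k :: nat
  assumes "n \<ge> 1" "k \<ge> 1"
  defines "v \<equiv> real n / real k"
  shows "ln (fact (n div k)) \<le> v * ln v - v + max 0 (ln v) / 2 + 1"
    "ln (fact (n div k)) \<ge> v * ln v - v - max 0 (ln v) / 2"
proof -
  define m where "m = n div k"
  have v0: "v > 0" using assms by (simp add: v_def)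
  have mv: "real m \<le> v" "v \<le> real m + 1"
  proof -
    have "real m = of_int \<lfloor>v\<rfloor>" unfolding m_def v_def by (simp add: floor_divide_of_nat_eq)
    thus "real m \<le> v" "v \<le> real m + 1" by linarith+
  qed
  have "ln (fact m) \<le> v * ln v - v + max 0 (ln v) / 2 + 1 \<and> ln (fact m) \<ge> v * ln v - v - max 0 (ln v) / 2"
  proof (cases "m = 0")
    case True
    have l: "v * ln v - v \<ge> 1 * ln 1 - 1 + (v - 1) * ln 1" using v0 by (intro entropy_tangent) auto
    have "v \<le> 1" using mv True by simp
    hence lv: "ln v \<le> 0" using v0 by simp
    hence "v * ln v \<le> 0" using v0 by (intro mult_nonneg_nonpos) auto
    moreover have mx: "max 0 (ln v) = 0" using lv by (rule max_absorb1)
    moreover have lf: "ln (fact m) = (0 :: real)" using True by simp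
    moreover have "v * ln v - v \<ge> - 1" using l by simp
    ultimately show ?thesis unfolding mx lf using v0 by (intro conjI; linarith)
  next
    case False
    hence m1: "m \<ge> 1" "real m \<ge> 1" by auto
    have lm: "0 \<le> ln (real m)" "ln (real m) \<le> ln v" using m1 mv by auto
    have "real m * ln (real m) - real m + (v - real m) * ln (real m) \<le> v * ln v - v"
      using m1 v0 by (intro entropy_tangent) auto
    moreover have "(v - real m) * ln (real m) \<ge> 0" using mv lm by simp
    moreover have "ln (fact m) \<le> (real m + 1 / 2) * ln (real m) - real m + 1" by (rule ln_fact_upper[OF m1(1)])
    ultimately have u: "ln (fact m) \<le> v * ln v - v + ln v / 2 + 1" using lm by (simp add: distrib_right)
    have "v * ln v - v + (real m - v) * ln v \<le> real m * ln (real m) - real m"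
      using m1 v0 by (intro entropy_tangent) auto
    moreover have "(v - real m) * ln v \<le> 1 * ln v" using mv lm by (intro mult_right_mono) auto
    moreover have "ln v \<le> ln (2 * real m)" using mv m1 v0 by simp
    moreover have "ln (2 * real m) = ln 2 + ln (real m)" using m1 by (subst ln_mult_pos) auto
    moreover have "ln (2 :: real) \<le> 1" using ln_numeral_bounds by simp
    moreover have "ln (fact m) \<ge> (real m + 1 / 2) * ln (real m) - real m + 1 / 2" by (rule ln_fact_lower[OF m1(1)])
    ultimately have "ln (fact m) \<ge> v * ln v - v - ln v / 2" by (simp add: algebra_simps)
    thus ?thesis using u lm by simp
  qed
  thus "ln (fact (n div k)) \<le> v * ln v - v + max 0 (ln v) / 2 + 1"
    "ln (fact (n div k)) \<ge> v * ln v - v - max 0 (ln v) / 2" by (simp_all add: m_def)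
qed

lemma ln_30: "ln (30::real) = ln 2 + ln 3 + ln 5"
proof -
  have "ln (2 * 3 * 5 :: real) = ln (2 * 3) + ln 5" by (rule ln_mult_pos) auto
  also have "ln (2 * 3 :: real) = ln 2 + ln 3" by (rule ln_mult_pos) auto
  finally show ?thesis by simp
qed

lemma ln_le_sqrt:
  assumes "x > 0" "p > 0"
  shows "ln x \<le> 2 * (sqrt x / p - 1 + ln (p :: real))"
proof -
  have "ln (sqrt x / p) \<le> sqrt x / p - 1" using assms by (intro ln_le_minus_one) auto
  thus ?thesis using assms by (simp add: ln_div ln_sqrt)
qed

text \<open>37/40 lies just above Chebyshev's constant (14 ln 2 + 9 ln 3 + 5 ln 5) / 30, about
  0.9213. The logarithmic terms are put below 1.77 sqrt x by a tangent of the logarithm, taken at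
  sqrt x = 5/2 for x < 30 and at sqrt x = 5 for x \<ge> 30, where the term with x / 30 takes
  part.\<close>

lemma chebyshev_psi_recursion:
  assumes n: "n \<ge> 6"
  shows "chebyshev_psi n \<le> chebyshev_psi (n div 6) + 37 / 40 * real n + 177 / 100 * sqrt (real n)"
proof -
  define x where "x = real n"
  have x: "x \<ge> 6" using n by (simp add: x_def)
  define F where "F v = v * ln v - v" for v :: real
  define p where "p v = max 0 (ln v) / 2" for v :: real
  have U: "ln (fact (n div k)) \<le> F (x / real k) + p (x / real k) + 1"
    and W: "ln (fact (n div k)) \<ge> F (x / real k) - p (x / real k)" if "k \<ge> 1" for k
    using ln_fact_div_bounds[of n k] that n by (simp_all add: F_def p_def x_def)
  have lnd: "ln (x / k) = ln x - ln k" if "k > 0" for k using x that by (simp add: ln_div)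
  have main: "F x + F (x / 30) - F (x / 2) - F (x / 3) - F (x / 5) = x * ((14 * ln 2 + 9 * ln 3 + 5 * ln 5) / 30)"
  proof -
    have "ln (30::real) = ln 2 + ln 3 + ln 5" by (rule ln_30)
    thus ?thesis unfolding F_def by (simp add: lnd field_simps)
  qed
  have "(14 * ln 2 + 9 * ln 3 + 5 * ln 5) / 30 \<le> (37 / 40 :: real)" using ln_numeral_bounds by simp
  hence "x * ((14 * ln 2 + 9 * ln 3 + 5 * ln 5) / 30) \<le> x * (37 / 40)" using x by (intro mult_left_mono) auto
  hence 1: "ln (fact n) + ln (fact (n div 30)) - ln (fact (n div 2)) - ln (fact (n div 3)) - ln (fact (n div 5)) \<le>
      37 / 40 * x + (p x + p (x / 30) + p (x / 2) + p (x / 3) + p (x / 5)) + 2"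
    using U[of 1] U[of 30] W[of 2] W[of 3] W[of 5] main by simp
  have "p x + p (x / 30) + p (x / 2) + p (x / 3) + p (x / 5) + 2 \<le> 177 / 100 * sqrt x"
  proof -
    have pos: "ln (x / k) \<ge> 0" if "k > 0" "k \<le> 6" for k using x that by simp
    note l30 = ln_30
    have s: "p x + p (x / 2) + p (x / 3) + p (x / 5) = 2 * ln x - ln 30 / 2"
      using pos[of 1] pos[of 2] pos[of 3] pos[of 5] unfolding p_def l30 by (simp add: lnd field_simps)
    show ?thesis
    proof (cases "x \<ge> 30")
      case False
      hence "x / 30 \<le> 1" by simp
      hence "p (x / 30) = 0" using x by (simp add: p_def)
      moreover have "ln x \<le> 2 * (sqrt x / (5 / 2) - 1 + ln (5 / 2))" using x by (intro ln_le_sqrt) auto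
      moreover have "sqrt x \<ge> 2" using x by (intro real_le_rsqrt) auto
      ultimately show ?thesis using s ln_numeral_bounds by simp
    next
      case True
      have "p (x / 30) = (ln x - ln 30) / 2" using True x by (simp add: p_def lnd[symmetric])
      moreover have "ln x \<le> 2 * (sqrt x / 5 - 1 + ln 5)" using x by (intro ln_le_sqrt) auto
      moreover have "sqrt x \<ge> 5" using True by (intro real_le_rsqrt) auto
      ultimately show ?thesis using s ln_numeral_bounds by simp
    qed
  qed
  thus ?thesis using 1 chebyshev_psi_step[of n] by (simp add: x_def)
qed

text \<open>The constants close the induction from n div 6 to n: 37/40 + 111/600 = 111/100 and
  177/100 + 3 * 41/100 = 3, where 1 / sqrt 6 \<le> 41/100. The -4 is passed on unchanged; it is
  limited by the initial value n = 1.\<close>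

theorem chebyshev_psi_le:
  "n \<ge> 1 \<Longrightarrow> chebyshev_psi n \<le> 111 / 100 * real n + 3 * sqrt (real n) - 4"
proof (induction n rule: less_induct)
  case (less n)
  show ?case
  proof (cases "n \<ge> 6")
    case True
    have m: "n div 6 \<ge> 1" "n div 6 < n" using True by (auto simp: div_greater_zero_iff Suc_le_eq)
    have le: "real (n div 6) \<le> real n / 6" 
    proof -
      have "real (6 * (n div 6)) \<le> real n" by (rule of_nat_mono) simp
      thus ?thesis by simp
    qed
    have "sqrt (real (n div 6)) \<le> sqrt (real n / 6)" using le by (rule real_sqrt_le_mono)
    also have "\<dots> = sqrt (real n) / sqrt 6" by (rule real_sqrt_divide)
    also have "\<dots> \<le> sqrt (real n) * (41 / 100)"
    proof -
      have "sqrt 6 \<ge> (100 / 41 :: real)" by (intro real_le_rsqrt) (simp add: power2_eq_square)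
      hence "sqrt (real n) / sqrt 6 \<le> sqrt (real n) / (100 / 41)" by (intro divide_left_mono) auto
      thus ?thesis by simp
    qed
    finally have "sqrt (real (n div 6)) \<le> sqrt (real n) * (41 / 100)" .
    moreover have "chebyshev_psi (n div 6) \<le> 111 / 100 * real (n div 6) + 3 * sqrt (real (n div 6)) - 4"
      using less.IH[OF m(2,1)] .
    ultimately show ?thesis using chebyshev_psi_recursion[OF True] le by simp
  next
    case False
    with less.prems have n: "n \<in> {1, 2, 3, 4, 5}" by auto
    have m: "mangoldt (Suc 0) = (0 :: real)" "mangoldt 2 \<le> (7 / 10 :: real)" "mangoldt 3 \<le> (11 / 10 :: real)"
      "mangoldt 4 \<le> (14 / 10 :: real)" "mangoldt 5 \<le> (17 / 10 :: real)"
    proof -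
      have "ln (4::real) = 2 * ln 2" using ln_realpow[of 2 2] by simp
      thus "mangoldt 2 \<le> (7 / 10 :: real)" "mangoldt 3 \<le> (11 / 10 :: real)"
        "mangoldt 4 \<le> (14 / 10 :: real)" "mangoldt 5 \<le> (17 / 10 :: real)"
        using mangoldt_le[of 2] mangoldt_le[of 3] mangoldt_le[of 4] mangoldt_le[of 5] ln_numeral_bounds by auto
    qed simp
    define t where "t = sqrt (real n)"
    have s: "t \<ge> 1" using less.prems by (simp add: t_def)
    have s4: "t \<ge> 2" if "n \<ge> 4"
      unfolding t_def using that by (intro real_le_rsqrt) auto
    show ?thesis unfolding t_def[symmetric] using n m s s4
      by (auto simp: chebyshev_psi_def eval_nat_numeral sum.atLeast_Suc_atMost simp del: sum.cl_ivl_Suc)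
  qed
qed

text \<open>Abel summation with psi replaced by its majorant B, which is legitimate as \<phi>
  decreases; the induction carries the nonpositive term (psi - B) \<phi>. The function G stands for
  the integral of \<phi> against dB.\<close>

lemma mangoldt_summation_bound:
  fixes \<phi> B G :: "real \<Rightarrow> real"
  assumes N: "N \<ge> 2"
    and psi: "\<And>n. 2 \<le> n \<Longrightarrow> n \<le> N \<Longrightarrow> chebyshev_psi n \<le> B (real n)"
    and phi: "\<And>n. 2 \<le> n \<Longrightarrow> n \<le> N \<Longrightarrow> \<phi> (real n) \<ge> 0"
    and anti: "\<And>n. 2 \<le> n \<Longrightarrow> n < N \<Longrightarrow> \<phi> (real (Suc n)) \<le> \<phi> (real n)"
    and G: "\<And>n. 2 \<le> n \<Longrightarrow> n < N \<Longrightarrow> (B (real (Suc n)) - B (real n)) * \<phi> (real (Suc n)) \<le> G (real (Suc n)) - G (real n)"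
  shows "(\<Sum>n=2..N. mangoldt n * \<phi> (real n)) \<le> B 2 * \<phi> 2 + G (real N) - G 2"
proof -
  have "(\<Sum>k=2..n. mangoldt k * \<phi> (real k)) \<le> (chebyshev_psi n - B (real n)) * \<phi> (real n) + B 2 * \<phi> 2 + G (real n) - G 2"
    if "2 \<le> n" "n \<le> N" for n
    using that
  proof (induction n rule: nat_induct_at_least)
    case base
    have "chebyshev_psi 2 = mangoldt 2" by (simp add: chebyshev_psi_def numeral_2_eq_2)
    thus ?case by (simp add: left_diff_distrib)
  next
    case (Suc n)
    have n: "2 \<le> n" "n < N" using Suc by auto
    have "(\<Sum>k=2..Suc n. mangoldt k * \<phi> (real k)) = (\<Sum>k=2..n. mangoldt k * \<phi> (real k)) + mangoldt (Suc n) * \<phi> (real (Suc n))"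
      using n by (simp add: sum.cl_ivl_Suc)
    moreover have "mangoldt (Suc n) = chebyshev_psi (Suc n) - chebyshev_psi n" by (simp add: chebyshev_psi_def)
    moreover have "(chebyshev_psi n - B (real n)) * \<phi> (real n) \<le> (chebyshev_psi n - B (real n)) * \<phi> (real (Suc n))"
      using anti[OF n] psi[of n] n by (intro mult_left_mono_neg) auto
    moreover have "(\<Sum>k=2..n. mangoldt k * \<phi> (real k)) \<le> (chebyshev_psi n - B (real n)) * \<phi> (real n) + B 2 * \<phi> 2 + G (real n) - G 2"
      using Suc n by auto
    ultimately show ?case using G[OF n] by (simp add: algebra_simps)
  qed
  from this[OF N order_refl] have "(\<Sum>n=2..N. mangoldt n * \<phi> (real n)) \<le> (chebyshev_psi N - B (real N)) * \<phi> (real N) + B 2 * \<phi> 2 + G (real N) - G 2" .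
  moreover have "(chebyshev_psi N - B (real N)) * \<phi> (real N) \<le> 0"
    using psi[of N] phi[of N] N by (intro mult_nonpos_nonneg) auto
  ultimately show ?thesis by linarith
qed

section \<open>The weighted sum over prime powers\<close>

text \<open>With \<sigma> = 1 - b this is t^(-\<sigma>) log (x / t) / log t, the factor of
  \<open>mangoldt n\<close> in the majorant of \<open>logsum\<close>. The parameter b is that of the
  substitution z = b ln t.\<close>

definition weight :: "real \<Rightarrow> real \<Rightarrow> real \<Rightarrow> real" where
  "weight b y t = t powr (b - 1) * (y / ln t - 1)"

definition psi_bound :: "real \<Rightarrow> real" where "psi_bound t = 111 / 100 * t + 3 * sqrt t - 4"

text \<open>
  \<open>ei_primitive\<close> is a primitive of a majorant of \<open>weight\<close> times the derivative of \<open>psi_bound\<close>,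
  when \<open>Q' z \<ge> exp z / z\<close>.
\<close>

definition ei_primitive :: "(real \<Rightarrow> real) \<Rightarrow> real \<Rightarrow> real \<Rightarrow> real \<Rightarrow> real" where
  "ei_primitive Q b y t = 111 / 100 * (y * Q (b * ln t) - t powr b / b) + 3 / 2 * (y * ln (ln t) - ln t)"

lemma weight_nonneg: "2 \<le> t \<Longrightarrow> t \<le> exp y \<Longrightarrow> weight b y t \<ge> 0"
proof -
  assume t: "2 \<le> t" "t \<le> exp y"
  hence "ln t > 0" "ln t \<le> y" using ln_le_cancel_iff[of t "exp y"] by auto
  thus ?thesis unfolding weight_def by (intro mult_nonneg_nonneg) auto
qed

lemma weight_antimono:
  assumes "2 \<le> s" "s \<le> t" "t \<le> exp y" "b \<le> 1"
  shows "weight b y t \<le> weight b y s"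
proof -
  have "ln t > 0" "ln s > 0" "ln s \<le> ln t" "ln t \<le> y" using assms ln_le_cancel_iff[of t "exp y"] by auto
  hence "y / ln t - 1 \<le> y / ln s - 1" "y / ln t - 1 \<ge> 0" by (auto intro!: divide_left_mono)
  moreover have "t powr (b - 1) \<le> s powr (b - 1)" using assms by (intro powr_mono2') auto
  ultimately show ?thesis unfolding weight_def by (intro mult_mono) auto
qed

text \<open>Freezing the weight at its smallest value w, the one at t, reduces the claim to
  monotonicity of \<open>h\<close>. Under z = b ln x the main part x^(b - 1) / ln x dx becomes exp z
  / z dz, and in the part coming from the square root b \<le> 1/2 bounds the power of x by 1 /
  x.\<close>

lemma ei_primitive_increment:
  assumes st: "2 \<le> s" "s \<le> t" "t \<le> exp y" and b: "0 < b" "b \<le> 1 / 2"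
    and Q: "\<And>z. b * ln s \<le> z \<Longrightarrow> z \<le> b * ln t \<Longrightarrow> (Q has_real_derivative Q' z) (at z)"
    and Q': "\<And>z. b * ln s \<le> z \<Longrightarrow> z \<le> b * ln t \<Longrightarrow> Q' z \<ge> exp z / z"
  shows "(psi_bound t - psi_bound s) * weight b y t \<le> ei_primitive Q b y t - ei_primitive Q b y s"
proof -
  define w where "w = weight b y t"
  define h where "h x = ei_primitive Q b y x - w * psi_bound x" for x
  have "h s \<le> h t"
  proof (rule DERIV_nonneg_imp_nondecreasing[OF st(2)])
    fix x assume x: "s \<le> x" "x \<le> t"
    have x2: "x \<ge> 2" "x \<le> exp y" using x st by auto
    have lx: "ln x > 0" "ln x \<le> y" using x2 ln_le_cancel_iff[of x "exp y"] by auto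
    have z: "b * ln s \<le> b * ln x" "b * ln x \<le> b * ln t" using x st b by auto
    have y0: "y > 0" using lx by linarith
    define D where "D = 111 / 100 * (y * (Q' (b * ln x) * (b / x)) - x powr (b - 1)) + 3 / 2 * (y * (1 / (x * ln x)) - 1 / x)"
    define Bd where "Bd = 111 / 100 + 3 / (2 * sqrt x)"
    have dQ: "((\<lambda>x. Q (b * ln x)) has_real_derivative Q' (b * ln x) * (b / x)) (at x)"
      using x2 by (intro DERIV_chain2[where f = Q and g = "\<lambda>x. b * ln x", OF Q[OF z]]) (auto intro!: derivative_eq_intros)
    have dp: "((\<lambda>x. x powr b / b) has_real_derivative x powr (b - 1)) (at x)"
      using x2 b by (auto intro!: derivative_eq_intros)
    have dl: "((\<lambda>x. ln (ln x)) has_real_derivative 1 / (x * ln x)) (at x)" "(ln has_real_derivative 1 / x) (at x)"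
      using x2 lx by (auto intro!: derivative_eq_intros simp: field_simps)
    have dB: "(psi_bound has_real_derivative Bd) (at x)"
      unfolding psi_bound_def[abs_def] Bd_def using x2 by (auto intro!: derivative_eq_intros simp: field_simps)
    have "(ei_primitive Q b y has_real_derivative D) (at x)"
      unfolding ei_primitive_def[abs_def] D_def
      by (intro DERIV_add DERIV_cmult DERIV_diff dQ dp dl)
    hence "(h has_real_derivative D - w * Bd) (at x)"
      unfolding h_def by (intro DERIV_diff DERIV_cmult dB)
    moreover have "D - w * Bd \<ge> 0"
    proof -
      have "w \<le> weight b y x" unfolding w_def using x st b by (intro weight_antimono) auto
      hence "w * Bd \<le> weight b y x * Bd" using x2 by (intro mult_right_mono) (auto simp: Bd_def)
      also have "\<dots> = 111 / 100 * weight b y x + 3 / 2 * (weight b y x / sqrt x)" by (simp add: Bd_def distrib_left)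
      also have "weight b y x / sqrt x \<le> 1 / x * (y / ln x - 1)"
      proof -
        have "x powr (b - 1) / sqrt x = x powr (b - 1 - 1 / 2)" using x2 powr_diff[of x "b - 1" "1 / 2"] powr_half_sqrt[of x] by simp
        also have "\<dots> \<le> x powr (- 1)" using x2 b by (intro powr_mono) auto
        also have "\<dots> = 1 / x" using x2 by (simp add: powr_minus divide_inverse)
        finally have "x powr (b - 1) / sqrt x * (y / ln x - 1) \<le> 1 / x * (y / ln x - 1)"
          using lx by (intro mult_right_mono) auto
        thus ?thesis by (simp add: weight_def)
      qed
      also have "1 / x * (y / ln x - 1) = y * (1 / (x * ln x)) - 1 / x" using x2 lx by (simp add: field_simps)
      finally have 1: "w * Bd \<le> 111 / 100 * weight b y x + 3 / 2 * (y * (1 / (x * ln x)) - 1 / x)" by simp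
      have "exp (b * ln x) / (b * ln x) * (b / x) \<le> Q' (b * ln x) * (b / x)"
        using x2 b by (intro mult_right_mono Q' z) auto
      moreover have "exp (b * ln x) / (b * ln x) * (b / x) = x powr (b - 1) / ln x"
        using x2 b lx by (simp add: powr_def exp_diff left_diff_distrib)
      ultimately have "y * (x powr (b - 1) / ln x) \<le> y * (Q' (b * ln x) * (b / x))"
        using y0 by (intro mult_left_mono) auto
      hence 2: "weight b y x \<le> y * (Q' (b * ln x) * (b / x)) - x powr (b - 1)"
        by (simp add: weight_def algebra_simps)
      show ?thesis unfolding D_def diff_ge_0_iff_ge
        by (rule order.trans[OF 1 add_right_mono[OF mult_left_mono[OF 2]]]) simp
    qed
    ultimately show "\<exists>d. (h has_real_derivative d) (at x) \<and> 0 \<le> d" by blast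
  qed
  thus ?thesis by (simp add: h_def w_def algebra_simps)
qed

text \<open>
  Primitives of majorants of \<open>exp z / z\<close>: \<open>ei_small\<close> is for \<open>0 < z \<le> 8\<close>, where the Taylor remainder of
  \<open>exp\<close> is estimated with \<open>exp 8 \<le> 3\<^sup>8 = 6561\<close>, and \<open>ei_large\<close> is for \<open>z \<ge> 8\<close>.
\<close>

definition ei_small :: "real \<Rightarrow> real" where
  "ei_small z = ln z + (\<Sum>k<31. z ^ Suc k / (real (Suc k) * fact (Suc k))) + 6561 * z ^ 32 / (32 * fact 32)"

definition ei_large :: "real \<Rightarrow> real" where
  "ei_large z = exp z * (1 / z + 1 / z ^ 2 + 2 / z ^ 3 + 12 / z ^ 4)"

lemma ei_small_deriv:
  assumes "z > 0"
  shows "(ei_small has_real_derivative (1 / z + (\<Sum>k<31. z ^ k / fact (Suc k)) + 6561 * z ^ 31 / fact 32)) (at z)"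
proof -
  have "((\<lambda>z. z ^ Suc k / (real (Suc k) * fact (Suc k))) has_real_derivative z ^ k / fact (Suc k)) (at z)" for k
  proof -
    have "((\<lambda>z. z ^ Suc k / (real (Suc k) * fact (Suc k))) has_real_derivative (real (Suc k) * z ^ k) / (real (Suc k) * fact (Suc k))) (at z)"
      by (intro DERIV_cdivide) (auto intro!: derivative_eq_intros simp del: of_nat_Suc fact_Suc power_Suc)
    thus ?thesis by (simp del: of_nat_Suc fact_Suc power_Suc)
  qed
  moreover have "((\<lambda>z. 6561 * z ^ 32 / (32 * fact 32)) has_real_derivative 6561 * z ^ 31 / fact 32) (at z)"
    by (auto intro!: derivative_eq_intros)
  moreover have "(ln has_real_derivative 1 / z) (at z)" using assms by (auto intro!: derivative_eq_intros)
  ultimately show ?thesis unfolding ei_small_def[abs_def]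
    by (intro DERIV_add DERIV_sum)
qed

lemma ei_small_deriv_ge:
  fixes z :: real
  assumes "0 < z" "z \<le> 8"
  shows "exp z / z \<le> 1 / z + (\<Sum>k<31. z ^ k / fact (Suc k)) + 6561 * z ^ 31 / fact 32"
proof -
  obtain t where t: "\<bar>t\<bar> \<le> \<bar>z\<bar>" "exp z = (\<Sum>m<32. z ^ m / fact m) + exp t / fact 32 * z ^ 32"
    using Maclaurin_exp_le[of z 32] by blast
  have "exp t \<le> exp 8" using t assms by simp
  also have "exp (8::real) = exp 1 ^ 8" by (simp add: exp_of_nat_mult[symmetric])
  also have "\<dots> \<le> 3 ^ 8" by (intro power_mono exp_le) auto
  finally have "exp t / fact 32 * z ^ 32 \<le> 3 ^ 8 / fact 32 * z ^ 32"
    using assms by (intro mult_right_mono divide_right_mono) auto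
  also have "3 ^ 8 / fact 32 * z ^ 32 = z * (6561 * z ^ 31 / fact 32)" by (simp add: eval_nat_numeral)
  finally have 1: "exp t / fact 32 * z ^ 32 \<le> z * (6561 * z ^ 31 / fact 32)" .
  have "(\<Sum>m<32. z ^ m / fact m) = (\<Sum>m<Suc 31. z ^ m / fact m)" by simp
  also have "\<dots> = 1 + (\<Sum>k<31. z ^ Suc k / fact (Suc k))" unfolding sum.lessThan_Suc_shift by simp
  also have "\<dots> = z * (1 / z + (\<Sum>k<31. z ^ k / fact (Suc k)))"
    using assms by (simp add: distrib_left sum_distrib_left)
  finally have "exp z \<le> z * (1 / z + (\<Sum>k<31. z ^ k / fact (Suc k)) + 6561 * z ^ 31 / fact 32)"
    using t 1 by (simp add: distrib_left)
  thus ?thesis using assms by (simp add: divide_le_eq mult.commute)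
qed

lemma ei_large_deriv:
  assumes "z > 0"
  shows "(ei_large has_real_derivative exp z * (1 / z + 6 / z ^ 4 - 48 / z ^ 5)) (at z)"
proof -
  have p: "((\<lambda>z. c / z ^ Suc n) has_real_derivative - (c * real (Suc n) / z ^ Suc (Suc n))) (at z)" for c :: real and n
  proof -
    have "((\<lambda>z. c * inverse (z ^ Suc n)) has_real_derivative c * - (real (Suc n) * z ^ n * inverse ((z ^ Suc n) ^ Suc (Suc 0)))) (at z)"
      using assms by (intro DERIV_cmult DERIV_inverse_fun) (auto intro!: derivative_eq_intros simp del: power_Suc)
    moreover have "z ^ n * inverse ((z ^ Suc n) ^ Suc (Suc 0)) = inverse (z ^ Suc (Suc n))"
      using assms by (simp add: field_simps)
    ultimately show ?thesis by (simp only: divide_inverse mult.assoc mult_minus_right)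
  qed
  have "((\<lambda>z. 1 / z ^ Suc 0 + 1 / z ^ Suc 1 + 2 / z ^ Suc 2 + 12 / z ^ Suc 3) has_real_derivative
      - (1 * real (Suc 0) / z ^ Suc (Suc 0)) + - (1 * real (Suc 1) / z ^ Suc (Suc 1)) +
      - (2 * real (Suc 2) / z ^ Suc (Suc 2)) + - (12 * real (Suc 3) / z ^ Suc (Suc 3))) (at z)"
    by (intro DERIV_add p)
  hence "((\<lambda>z. 1 / z + 1 / z ^ 2 + 2 / z ^ 3 + 12 / z ^ 4) has_real_derivative
      - 1 / z ^ 2 - 2 / z ^ 3 - 6 / z ^ 4 - 48 / z ^ 5) (at z)"
    by (simp add: eval_nat_numeral)
  from DERIV_mult[OF DERIV_exp this] show ?thesis
    unfolding ei_large_def[abs_def] by (simp add: algebra_simps)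
qed

text \<open>The coefficient 3! = 6 of 1 / z^4 in the asymptotic expansion is doubled to 12; the
  surplus 6 / z^4 in the derivative pays for -48 / z^5 exactly when z \<ge> 8, which is why the two
  majorants meet at 8.\<close>

lemma ei_large_deriv_ge:
  fixes z :: real
  assumes "z \<ge> 8"
  shows "exp z / z \<le> exp z * (1 / z + 6 / z ^ 4 - 48 / z ^ 5)"
proof -
  have "48 / z ^ 5 \<le> 6 / z ^ 4" using assms by (simp add: divide_simps eval_nat_numeral)
  hence "exp z * (1 / z) \<le> exp z * (1 / z + 6 / z ^ 4 - 48 / z ^ 5)" by (intro mult_left_mono) auto
  thus ?thesis by simp
qed

text \<open>The primitives built from \<open>ei_small\<close> and \<open>ei_large\<close> are glued
  continuously at m = exp (8 / b), where b ln m = 8.\<close>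

lemma weighted_mangoldt_sum:
  assumes b: "0 < b" "b \<le> 1 / 2" and by8: "8 \<le> b * y" and N: "2 \<le> N" "real N \<le> exp y"
  shows "(\<Sum>n=2..N. mangoldt n * weight b y (real n)) \<le>
     psi_bound 2 * weight b y 2 +
     111 / 100 * (y * (ei_large (b * y) + ei_small 8 - ei_large 8 - ei_small (b * ln 2)) - (exp (b * y) - 2 powr b) / b) +
     3 / 2 * (y * (ln y - ln (ln 2)) - (y - ln 2))"
proof -
  define m where "m = exp (8 / b)"
  define G1 where "G1 = ei_primitive ei_small b y"
  define G2 where "G2 = ei_primitive ei_large b y"
  define G where "G t = (if t \<le> m then G1 t else G1 m + G2 t - G2 m)" for t
  have my: "m \<le> exp y" unfolding m_def using b by8 by (simp add: field_simps)
  have m2: "m \<ge> 2"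
  proof -
    have "8 / b \<ge> 1" using b by (simp add: field_simps)
    thus ?thesis unfolding m_def using exp_ge_add_one_self[of "8 / b"] by linarith
  qed
  have blm: "b * ln m = 8" using b by (simp add: m_def)
  have i1: "(psi_bound t - psi_bound s) * weight b y t \<le> G1 t - G1 s" if "2 \<le> s" "s \<le> t" "t \<le> m" for s t
    unfolding G1_def
  proof (rule ei_primitive_increment[OF that(1,2) _ b])
    show "t \<le> exp y" using that my by linarith
    have ls: "ln s > 0" using that by simp
    have "ln t \<le> ln m" using that m2 by simp
    hence lt: "b * ln t \<le> 8" using b blm by (metis mult_le_cancel_left_pos)
    show "(ei_small has_real_derivative (1 / z + (\<Sum>k<31. z ^ k / fact (Suc k)) + 6561 * z ^ 31 / fact 32)) (at z)"
      if "b * ln s \<le> z" for z using that ls b by (intro ei_small_deriv) (auto intro: less_le_trans[OF mult_pos_pos])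
    show "exp z / z \<le> 1 / z + (\<Sum>k<31. z ^ k / fact (Suc k)) + 6561 * z ^ 31 / fact 32"
      if "b * ln s \<le> z" "z \<le> b * ln t" for z
      using that ls lt b by (intro ei_small_deriv_ge) (auto intro: less_le_trans[OF mult_pos_pos])
  qed
  have i2: "(psi_bound t - psi_bound s) * weight b y t \<le> G2 t - G2 s" if "m \<le> s" "s \<le> t" "t \<le> exp y" for s t
    unfolding G2_def
  proof (rule ei_primitive_increment[OF _ that(2,3) b])
    show "2 \<le> s" using that m2 by linarith
    have "ln m \<le> ln s" using that m2 by simp
    hence ls: "8 \<le> b * ln s" using b blm by (metis mult_le_cancel_left_pos)
    show "(ei_large has_real_derivative exp z * (1 / z + 6 / z ^ 4 - 48 / z ^ 5)) (at z)"
      if "b * ln s \<le> z" for z using that ls by (intro ei_large_deriv) auto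
    show "exp z / z \<le> exp z * (1 / z + 6 / z ^ 4 - 48 / z ^ 5)"
      if "b * ln s \<le> z" for z using that ls by (intro ei_large_deriv_ge) auto
  qed
  have mono: "psi_bound s \<le> psi_bound t" if "0 \<le> s" "s \<le> t" for s t
    using that real_sqrt_le_mono[OF that(2)] unfolding psi_bound_def by linarith
  have i: "(psi_bound t - psi_bound s) * weight b y t \<le> G t - G s" if "2 \<le> s" "s \<le> t" "t \<le> exp y" for s t
  proof (cases "t \<le> m \<or> m < s")
    case True
    thus ?thesis using i1[of s t] i2[of s t] that by (auto simp: G_def)
  next
    \<comment> \<open>The interval contains the junction m and is split there; on its left part the
      weight at t is replaced by the larger weight at m.\<close>
    case False
    hence st: "s \<le> m" "m < t" by auto
    have "(psi_bound m - psi_bound s) * weight b y t \<le> (psi_bound m - psi_bound s) * weight b y m"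
      using st that m2 b mono[of s m] by (intro mult_left_mono weight_antimono) auto
    also have "\<dots> \<le> G1 m - G1 s" using i1[of s m] st that by simp
    finally have "(psi_bound m - psi_bound s) * weight b y t \<le> G1 m - G1 s" .
    moreover have "(psi_bound t - psi_bound m) * weight b y t \<le> G2 t - G2 m" using i2[of m t] st that by simp
    moreover have "G t - G s = (G1 m - G1 s) + (G2 t - G2 m)" using st by (simp add: G_def)
    ultimately show ?thesis by (simp add: left_diff_distrib)
  qed
  have "(\<Sum>n=2..N. mangoldt n * weight b y (real n)) \<le> psi_bound 2 * weight b y 2 + G (real N) - G 2"
  proof (rule mangoldt_summation_bound[OF N(1)])
    fix n :: nat assume "2 \<le> n"
    thus "chebyshev_psi n \<le> psi_bound (real n)" using chebyshev_psi_le[of n] by (simp add: psi_bound_def)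
  next
    fix n :: nat assume "2 \<le> n" "n \<le> N"
    thus "weight b y (real n) \<ge> 0" using N by (intro weight_nonneg) auto
  next
    fix n :: nat assume n: "2 \<le> n" "n < N"
    hence "real (Suc n) \<le> real N" by simp
    hence le: "real (Suc n) \<le> exp y" using N by linarith
    thus "weight b y (real (Suc n)) \<le> weight b y (real n)" using n b by (intro weight_antimono) auto
    show "(psi_bound (real (Suc n)) - psi_bound (real n)) * weight b y (real (Suc n)) \<le> G (real (Suc n)) - G (real n)"
      using n le by (intro i) auto
  qed
  \<comment> \<open>As the weight vanishes at exp y, the right end can be moved from the integer N
    to exp y.\<close>
  moreover have "G (real N) \<le> G (exp y)"
  proof -
    have "(psi_bound (exp y) - psi_bound (real N)) * weight b y (exp y) \<le> G (exp y) - G (real N)"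
      using N by (intro i) auto
    moreover have "y \<noteq> 0" using by8 by auto
    hence "weight b y (exp y) = 0" by (simp add: weight_def)
    ultimately show ?thesis by simp
  qed
  moreover have "G (exp y) - G 2 = G1 m - G1 2 + (G2 (exp y) - G2 m)"
    using m2 my by (auto simp: G_def)
  moreover have "G1 m - G1 2 + (G2 (exp y) - G2 m) =
     111 / 100 * (y * (ei_large (b * y) + ei_small 8 - ei_large 8 - ei_small (b * ln 2)) - (exp (b * y) - 2 powr b) / b) +
     3 / 2 * (y * (ln y - ln (ln 2)) - (y - ln 2))"
    unfolding G1_def G2_def ei_primitive_def blm
    by (simp add: powr_def diff_divide_distrib algebra_simps)
  ultimately show ?thesis by linarith
qed

section \<open>Numerical evaluation of the prime sum and of the leading term\<close>

lemma exp_ge_if_Taylor: "x \<ge> 0 \<Longrightarrow> c \<le> (\<Sum>k<n. x ^ k / fact k) \<Longrightarrow> c \<le> exp (x :: real)"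
  using exp_ge_Taylor[of x n] by linarith

lemma exp_numeral_bounds:
  "exp (8::real) \<ge> 29809 / 10" "exp (10::real) \<ge> 22000" "exp (5 / 4 :: real) \<ge> 34881 / 10000"
  "exp (4915 / 10000 :: real) \<ge> 16346 / 10000"
  by (rule exp_ge_if_Taylor[where n = 26]; simp add: eval_nat_numeral fact_numeral)+

lemma ei_small_8: "ei_small 8 \<le> 43982 / 100"
proof -
  have "ln (8::real) = 3 * ln 2" using ln_realpow[of 2 3] by simp
  hence "ln (8::real) \<le> 209 / 100" using ln_numeral_bounds by simp
  moreover have "(\<Sum>k<31. 8 ^ Suc k / (real (Suc k) * fact (Suc k))) + 6561 * 8 ^ 32 / (32 * fact 32) \<le> (43773 / 100 :: real)"
    by (simp add: eval_nat_numeral fact_numeral)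
  ultimately show ?thesis unfolding ei_small_def by linarith
qed

lemma ei_large_8: "ei_large 8 \<ge> 43956 / 100"
proof -
  have "29809 / 10 * (1 / 8 + 1 / 8 ^ 2 + 2 / 8 ^ 3 + 12 / 8 ^ 4) \<le> exp 8 * (1 / 8 + 1 / 8 ^ 2 + 2 / 8 ^ 3 + 12 / 8 ^ 4 :: real)"
    using exp_numeral_bounds by (intro mult_right_mono) auto
  thus ?thesis by (simp add: ei_large_def)
qed

lemma ei_small_ge: "z > 0 \<Longrightarrow> ei_small z \<ge> ln z"
  unfolding ei_small_def by (simp add: sum_nonneg)

text \<open>All terms but the exponential integral are bounded separately: 2.7 for the start at 2,
  1.11 times 0.26 + 1.2 + 0.23 for the junction at 8 and the lower limits, and 1.5 times L / 9 +
  1.26 for the square-root part of \<open>psi_bound\<close>. Together they stay below 6.5 + L /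
  6.\<close>

lemma prime_sum_bound:
  assumes L: "L \<ge> 10"
  defines "y \<equiv> 2 * L - 1517 / 1000"
  defines "b \<equiv> 1 / 2 - 4915 / 10000 / y"
  assumes N: "2 \<le> N" "real N \<le> exp y"
  shows "(\<Sum>n=2..N. mangoldt n * weight b y (real n)) / y \<le>
    111 / 100 * (ei_large (L - 5 / 4) - exp (L - 5 / 4) / (L - 5 / 4)) + 65 / 10 + L / 6"
proof -
  define z where "z = L - 5 / 4"
  have y: "y \<ge> 18483 / 1000" using L by (simp add: y_def)
  have ly: "4915 / 10000 / y \<le> 3 / 100" "4915 / 10000 / y > 0" using y by (simp_all add: field_simps)
  have b: "0 < b" "b \<le> 1 / 2" "47 / 100 \<le> b" using ly unfolding b_def by linarith+
  \<comment> \<open>This is y / 2 - 0.4915 = L - 0.7585 - 0.4915 = L - 5/4.\<close>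
  have z: "b * y = z" using y by (simp add: b_def z_def y_def field_simps)
  have z8: "z \<ge> 875 / 100" using L by (simp add: z_def)
  have ln2: "ln (2::real) \<ge> 2 / 3" "ln (2::real) \<le> 7 / 10"
    using ln2_ge_two_thirds ln_numeral_bounds by auto
  have "(\<Sum>n=2..N. mangoldt n * weight b y (real n)) \<le>
     psi_bound 2 * weight b y 2 +
     111 / 100 * (y * (ei_large (b * y) + ei_small 8 - ei_large 8 - ei_small (b * ln 2)) - (exp (b * y) - 2 powr b) / b) +
     3 / 2 * (y * (ln y - ln (ln 2)) - (y - ln 2))"
    by (rule weighted_mangoldt_sum[OF b(1,2) _ N]) (use z z8 in simp)
  hence "(\<Sum>n=2..N. mangoldt n * weight b y (real n)) / y \<le>
     (psi_bound 2 * weight b y 2 +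
     111 / 100 * (y * (ei_large z + ei_small 8 - ei_large 8 - ei_small (b * ln 2)) - (exp z - 2 powr b) / b) +
     3 / 2 * (y * (ln y - ln (ln 2)) - (y - ln 2))) / y"
    unfolding z using y by (intro divide_right_mono) auto
  also have "\<dots> = psi_bound 2 * weight b y 2 / y +
     111 / 100 * (ei_large z + ei_small 8 - ei_large 8 - ei_small (b * ln 2) - (exp z - 2 powr b) / z) +
     3 / 2 * (ln y - ln (ln 2) - 1 + ln 2 / y)"
  proof -
    have gen: "(X + 111 / 100 * (y * P - Q / b) + 3 / 2 * (y * R - S)) / y =
        X / y + 111 / 100 * (P - Q / (b * y)) + 3 / 2 * (R - S / y)" for X P Q R S :: real
      using y b by (simp add: field_simps)
    have yl: "(y - ln 2) / y = 1 - ln 2 / y" using y by (simp add: field_simps)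
    show ?thesis unfolding gen z yl by simp
  qed
  finally have main: "(\<Sum>n=2..N. mangoldt n * weight b y (real n)) / y \<le> \<dots>" .
  have h1: "psi_bound 2 * weight b y 2 / y \<le> 27 / 10"
  proof -
    have s2: "sqrt 2 \<le> (1415 / 1000 :: real)" by (rule real_le_lsqrt) (simp_all add: power2_eq_square)
    have s3: "sqrt 2 \<ge> (141 / 100 :: real)" by (rule real_le_rsqrt) (simp add: power2_eq_square)
    have p: "psi_bound 2 \<le> 25 / 10" "psi_bound 2 \<ge> 0"
      unfolding psi_bound_def using s2 s3 by linarith+
    have "2 powr (b - 1) \<le> 2 powr (- (1 / 2))" using b by (intro powr_mono) auto
    also have "\<dots> = 1 / sqrt (2 :: real)" unfolding powr_minus using powr_half_sqrt[of 2] by (simp only: inverse_eq_divide)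
    also have "\<dots> \<le> 1 / (141 / 100)" using s3 by (intro divide_left_mono) auto
    finally have q: "2 powr (b - 1) \<le> 71 / 100" by simp
    have "y / ln 2 \<le> y / (2 / 3)" using ln2 y by (intro divide_left_mono) auto
    hence r: "y / ln 2 - 1 \<le> 3 / 2 * y" by simp
    have r0: "y / ln 2 - 1 \<ge> 0" using ln2 y by (simp add: field_simps)
    have "weight b y 2 \<le> 71 / 100 * (3 / 2 * y)" unfolding weight_def by (intro mult_mono q r r0) auto
    moreover have "weight b y 2 \<ge> 0" unfolding weight_def using r0 by simp
    ultimately have "psi_bound 2 * weight b y 2 \<le> 25 / 10 * (71 / 100 * (3 / 2 * y))"
      using p by (intro mult_mono) auto
    also have "\<dots> \<le> 27 / 10 * y" using y by simp
    finally show ?thesis using y by (simp add: pos_divide_le_eq)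
  qed
  have h4: "- ei_small (b * ln 2) \<le> 12 / 10"
  proof -
    have "47 / 100 * (2 / 3) \<le> b * ln 2" using b ln2 by (intro mult_mono) auto
    hence "ln (47 / 100 * (2 / 3)) \<le> ln (b * ln 2)" by (subst ln_le_cancel_iff) auto
    moreover have "ln (47 / 100 * (2 / 3)) = - ln (150 / 47 :: real)" by (simp add: ln_div)
    moreover have "ln (150 / 47 :: real) \<le> 12 / 10"
      by (rule ln_le_if_Taylor[where n = 7]) (simp_all add: eval_nat_numeral fact_numeral)
    moreover have "ei_small (b * ln 2) \<ge> ln (b * ln 2)" using b ln2 by (intro ei_small_ge) auto
    ultimately show ?thesis by linarith
  qed
  have h5: "2 powr b / z \<le> 23 / 100"
  proof -
    have "2 powr b \<le> 2 powr (1 :: real)" using b by (intro powr_mono) auto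
    hence "2 powr b / z \<le> 2 / (875 / 100)" using z8 by (intro frac_le) auto
    thus ?thesis by simp
  qed
  have h6: "ln y - ln (ln 2) - 1 + ln 2 / y \<le> L / 9 + 126 / 100"
  proof -
    \<comment> \<open>The tangent of the logarithm at 18, close to the least value 18.483 of y,
      produces L / 9.\<close>
    have "ln (y / 18) \<le> y / 18 - 1" using y by (intro ln_le_minus_one) auto
    moreover have "ln (y / 18) = ln y - ln 18" using y by (simp add: ln_div)
    moreover have "ln (18::real) = ln 2 + 2 * ln 3"
      using ln_mult_pos[of 2 "3 ^ 2"] ln_realpow[of 3 2] by simp
    moreover have "- ln (ln 2) \<le> (41 / 100 :: real)"
    proof -
      have "ln (2 / 3) \<le> ln (ln (2::real))" using ln2 by (subst ln_le_cancel_iff) auto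
      moreover have "ln (2 / 3 :: real) = - ln (3 / 2)" by (simp add: ln_div)
      moreover have "ln (3 / 2 :: real) \<le> 41 / 100"
        by (rule ln_le_if_Taylor[where n = 5]) (simp_all add: eval_nat_numeral fact_numeral)
      ultimately show ?thesis by linarith
    qed
    moreover have "ln 2 / y \<le> 379 / 10000"
    proof -
      have "ln 2 / y \<le> (7 / 10) / (18483 / 1000)" using ln2 y by (intro frac_le) auto
      also have "\<dots> \<le> 379 / 10000" by simp
      finally show ?thesis .
    qed
    moreover have "y / 18 = L / 9 - 1517 / 18000" by (simp add: y_def)
    moreover note ln_numeral_bounds(1,2)
    ultimately show ?thesis by linarith
  qed
  have "(\<Sum>n=2..N. mangoldt n * weight b y (real n)) / y \<le> 27 / 10 +
     111 / 100 * (ei_large z - exp z / z) + 111 / 100 * (26 / 100 + 12 / 10 + 23 / 100) + 3 / 2 * (L / 9 + 126 / 100)"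
  proof -
    have *: "P + 111 / 100 * (u + s8 - l8 - sb - (v - w)) + 3 / 2 * R \<le>
        27 / 10 + 111 / 100 * (u - v) + 111 / 100 * (26 / 100 + 12 / 10 + 23 / 100) + 3 / 2 * (L / 9 + 126 / 100)"
      if "P \<le> 27 / 10" "- sb \<le> 12 / 10" "w \<le> 23 / 100" "R \<le> L / 9 + 126 / 100" "s8 - l8 \<le> 26 / 100"
      for P u s8 l8 sb v w R :: real
      unfolding distrib_left right_diff_distrib using that by linarith
    have s: "ei_small 8 - ei_large 8 \<le> 26 / 100" using ei_small_8 ei_large_8 by linarith
    show ?thesis
      by (rule order.trans[OF main[unfolded diff_divide_distrib[of "exp z" "2 powr b" z]] *[OF h1 h4 h5 h6 s]])
  qed
  also have "\<dots> \<le> 111 / 100 * (ei_large z - exp z / z) + 65 / 10 + L / 6"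
    unfolding distrib_left by linarith
  finally show ?thesis unfolding z_def .
qed

text \<open>The terms exp z / z cancel, so the prime sum has only the order exp L / L^2, that is log
  C / (log log C)^2. The factor exp (-5/4) \<le> 0.2867 and the values at L = 10, z = 8.75 give 1.11
  * 0.2867 * 1.8094 \<le> 0.576.\<close>

lemma ei_large_asymptotic:
  assumes L: "L \<ge> 10"
  defines "z \<equiv> L - 5 / 4"
  shows "111 / 100 * (ei_large z - exp z / z) \<le> 576 / 1000 * (exp L / L\<^sup>2)"
proof -
  have z: "z \<ge> 875 / 100" "L = z + 5 / 4" using L by (auto simp: z_def)
  have "exp L = exp (5 / 4) * exp z" unfolding exp_add[symmetric] by (simp add: z_def)
  hence "34881 / 10000 * exp z \<le> exp L" using exp_numeral_bounds(3) by simp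
  hence "exp z \<le> 10000 / 34881 * exp L" by simp
  also have "\<dots> \<le> 2867 / 10000 * exp L" by (intro mult_right_mono) auto
  finally have ez: "exp z \<le> 2867 / 10000 * exp L" .
  have "L\<^sup>2 * (1 / z ^ 2 + 2 / z ^ 3 + 12 / z ^ 4) = (L / z)\<^sup>2 * (1 + 2 * (1 / z) + 12 * (1 / z)\<^sup>2)"
    using z by (simp add: power_divide field_simps eval_nat_numeral)
  also have "\<dots> \<le> (8 / 7)\<^sup>2 * (1 + 2 * (8 / 70) + 12 * (8 / 70)\<^sup>2)"
  proof (intro mult_mono add_mono power_mono order_refl)
    show "L / z \<le> 8 / 7" using z by (simp add: pos_divide_le_eq)
    show "1 / z \<le> 8 / 70" "1 / z \<le> 8 / 70" using frac_le[of 1 1 "875 / 100" z] z by simp_all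
  qed (use z in auto)
  also have "\<dots> \<le> 18094 / 10000" by (simp add: power2_eq_square)
  finally have p: "L\<^sup>2 * (1 / z ^ 2 + 2 / z ^ 3 + 12 / z ^ 4) \<le> 18094 / 10000" .
  have "(ei_large z - exp z / z) * L\<^sup>2 = exp z * (L\<^sup>2 * (1 / z ^ 2 + 2 / z ^ 3 + 12 / z ^ 4))"
    by (simp add: ei_large_def algebra_simps)
  also have "\<dots> \<le> (2867 / 10000 * exp L) * (18094 / 10000)"
    using z by (intro mult_mono ez p) auto
  finally have h: "(ei_large z - exp z / z) * L\<^sup>2 \<le> 2867 / 10000 * exp L * (18094 / 10000)" .
  have "111 / 100 * ((ei_large z - exp z / z) * L\<^sup>2) \<le> 111 / 100 * (2867 / 10000 * exp L * (18094 / 10000))"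
    by (rule mult_left_mono[OF h]) simp
  also have "\<dots> = (111 / 100 * (2867 / 10000) * (18094 / 10000)) * exp L" by simp
  also have "\<dots> \<le> 576 / 1000 * exp L" by (intro mult_right_mono) auto
  finally have "111 / 100 * ((ei_large z - exp z / z) * L\<^sup>2) \<le> 576 / 1000 * exp L" .
  hence "(111 / 100 * (ei_large z - exp z / z)) * L\<^sup>2 \<le> 576 / 1000 * exp L" by (simp only: mult.assoc)
  hence "111 / 100 * (ei_large z - exp z / z) \<le> 576 / 1000 * exp L / L\<^sup>2"
    using L by (subst pos_le_divide_eq) auto
  thus ?thesis by (simp only: times_divide_eq_right)
qed

text \<open>Expansion in s = L - 10 with exp 10 \<ge> 22000; the coefficients of the two cubic
  polynomials are compared one by one.\<close>

lemma lower_order_terms: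
  assumes L: "L \<ge> (10 :: real)"
  shows "7 + L / 6 \<le> 59 / 1000 * (exp L / L\<^sup>2)"
proof -
  define s where "s = L - 10"
  have s: "s \<ge> 0" "L = 10 + s" using L by (auto simp: s_def)
  have "(\<Sum>k<4. s ^ k / fact k) \<le> exp s" by (rule exp_ge_Taylor[OF s(1)])
  hence "1 + s + s\<^sup>2 / 2 + s ^ 3 / 6 \<le> exp s" by (simp add: eval_nat_numeral)
  hence "22000 * (1 + s + s\<^sup>2 / 2 + s ^ 3 / 6) \<le> exp 10 * exp s"
    using exp_numeral_bounds(2) s by (intro mult_mono) auto
  hence e: "22000 * (1 + s + s\<^sup>2 / 2 + s ^ 3 / 6) \<le> exp L" by (simp add: s exp_add)
  have "(7 + L / 6) * L\<^sup>2 = 5200 / 6 + 190 * s + 12 * s\<^sup>2 + s ^ 3 / 6"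
    unfolding s by (simp add: algebra_simps eval_nat_numeral add_divide_distrib)
  also have "\<dots> \<le> 59 / 1000 * (22000 * (1 + s + s\<^sup>2 / 2 + s ^ 3 / 6))"
  proof -
    have *: "5200 / 6 + 190 * s + 12 * q + r / 6 \<le> 59 / 1000 * (22000 * (1 + s + q / 2 + r / 6))"
      if "q \<ge> 0" "r \<ge> 0" for q r :: real
      using that s(1) by simp
    show ?thesis by (rule *) (use s in auto)
  qed
  also have "\<dots> \<le> 59 / 1000 * exp L" using e by simp
  finally have "(7 + L / 6) * L\<^sup>2 \<le> 59 / 1000 * exp L" .
  thus ?thesis using L by (simp add: pos_le_divide_eq)
qed

text \<open>In the product of 0.285 + 3/8 L with y the linear terms nearly cancel, 0.57 against
  0.568875. The constant -0.432345 is covered for L \<ge> 10 by the gap between 0.75 and 0.74575 in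
  the quadratic terms together with the linear rest.\<close>

lemma leading_term:
  assumes L: "L \<ge> (10 :: real)"
  defines "y \<equiv> 2 * L - 1517 / 1000"
  shows "(1 + 4915 / 10000) / y * (exp L / 2) \<le> 285 / 1000 * (exp L / L\<^sup>2) + 3 / 8 * (exp L / L)"
proof -
  have y: "y > 0" using L by (simp add: y_def)
  have "74575 / 100000 * L\<^sup>2 \<le> (285 / 1000 + 3 / 8 * L) * y"
  proof -
    have q: "10 * L \<le> L * L" using L by (intro mult_right_mono) auto
    have eq: "(285 / 1000 + 3 / 8 * L) * y = 3 / 4 * (L * L) + 9 / 8000 * L - 432345 / 1000000"
      by (simp add: y_def algebra_simps)
    show ?thesis unfolding eq power2_eq_square using q L by linarith
  qed
  hence "74575 / 100000 / y \<le> (285 / 1000 + 3 / 8 * L) / L\<^sup>2" using y L by (simp add: field_simps)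
  hence "exp L * (74575 / 100000 / y) \<le> exp L * ((285 / 1000 + 3 / 8 * L) / L\<^sup>2)" by (intro mult_left_mono) auto
  moreover have "exp L * ((285 / 1000 + 3 / 8 * L) / L\<^sup>2) = 285 / 1000 * (exp L / L\<^sup>2) + 3 / 8 * (exp L / L)"
    using L by (simp add: field_simps power2_eq_square)
  moreover have "exp L * (74575 / 100000 / y) = (1 + 4915 / 10000) / y * (exp L / 2)" by simp
  ultimately show ?thesis by simp
qed

section \<open>Assembly of the estimates\<close>

context grh_L_function
begin

lemma norm_logsum_le:
  assumes y: "y > 0"
  shows "norm (logsum y (of_real (1 / 2 + l / y))) \<le>
    real (deg f) * (\<Sum>n=2..N0 y. mangoldt n * weight (1 / 2 - l / y) y (real n))"
proof -
  define s where "s = complex_of_real (1 / 2 + l / y)"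
  have "logsum y s = (\<Sum>n=2..N0 y. logcoeff f n * of_nat n powr (- s) * of_real (y - ln (real n)))"
    unfolding logsum_def
  proof (rule sum.mono_neutral_right)
    show "\<forall>n\<in>{1..N0 y} - {2..N0 y}. logcoeff f n * of_nat n powr (- s) * of_real (y - ln (real n)) = 0"
    proof
      fix n assume "n \<in> {1..N0 y} - {2..N0 y}"
      hence "n = Suc 0" by auto
      thus "logcoeff f n * of_nat n powr (- s) * of_real (y - ln (real n)) = 0" by simp
    qed
  qed auto
  also have "norm \<dots> \<le> (\<Sum>n=2..N0 y. real (deg f) * (mangoldt n * weight (1 / 2 - l / y) y (real n)))"
  proof (rule sum_norm_le)
    fix n assume n: "n \<in> {2..N0 y}"
    hence ln: "ln (real n) > 0" "ln (real n) \<le> y" using le_N0_iff[of n y] by auto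
    have "norm (logcoeff f n) \<le> real (deg f) * mangoldt n / ln (real n)"
      using norm_lcoeff_le[OF ram, of n] ln by (simp add: logcoeff_def norm_divide divide_right_mono)
    moreover have "norm (of_nat n powr (- s) :: complex) = real n powr (- (1 / 2 + l / y))"
      using norm_powr_real_powr[of "of_nat n" "- s"] n by (simp add: s_def)
    ultimately have "norm (logcoeff f n * of_nat n powr (- s) * of_real (y - ln (real n))) \<le>
       real (deg f) * mangoldt n / ln (real n) * real n powr (- (1 / 2 + l / y)) * (y - ln (real n))"
      using ln unfolding norm_mult
      by (intro mult_mono)
         (auto simp del: of_real_diff intro!: mult_nonneg_nonneg divide_nonneg_nonneg mangoldt_nonneg)
    also have "\<dots> = real (deg f) * (mangoldt n * weight (1 / 2 - l / y) y (real n))"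
    proof -
      define p where "p = real n powr (- (1 / 2 + l / y))"
      have "(1 / 2 - l / y) - 1 = - (1 / 2 + l / y)" by simp
      hence w: "weight (1 / 2 - l / y) y (real n) = p * (y / ln (real n) - 1)" by (simp only: weight_def p_def)
      show ?thesis unfolding w p_def[symmetric] using ln by (simp add: field_simps)
    qed
    finally show "norm (logcoeff f n * of_nat n powr (- s) * of_real (y - ln (real n))) \<le>
       real (deg f) * (mangoldt n * weight (1 / 2 - l / y) y (real n))" .
  qed
  finally show ?thesis by (simp add: s_def sum_distrib_left)
qed

text \<open>At x = 1/2 the arguments of the digamma function are 1/4 + k_j / 2, whose moduli make up
  the analytic conductor; up to x = 1 the moduli at most double. The constant per gamma factor is
  therefore 5 + ln 2 \<le> 6, and \<open>E\<close> contains half of it.\<close>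

lemma Re_E_le:
  assumes x: "1 / 2 \<le> x" "x \<le> 1"
  shows "Re (E (of_real x)) \<le> ln (analytic_conductor f) / 2 + 3 * real (deg f)"
proof -
  have nz: "norm (1 / 4 + kpar f j / 2) \<ge> 1 / 4" if "j < deg f" for j
    using data(2)[OF that] abs_Re_le_cmod[of "1 / 4 + kpar f j / 2"] by simp
  have "ln (analytic_conductor f) = ln (cond f) - deg f * ln pi + (\<Sum>j<deg f. ln (norm (1 / 4 + kpar f j / 2)))"
  proof -
    have P: "(\<Prod>j<deg f. norm (1 / 4 + kpar f j / 2)) > 0"
    proof (rule prod_pos)
      fix j assume "j \<in> {..<deg f}"
      hence "norm (1 / 4 + kpar f j / 2) \<ge> 1 / 4" by (intro nz) simp
      thus "norm (1 / 4 + kpar f j / 2) > 0" by linarith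
    qed
    have "ln (\<Prod>j<deg f. norm (1 / 4 + kpar f j / 2)) = (\<Sum>j<deg f. ln (norm (1 / 4 + kpar f j / 2)))"
    proof (rule ln_prod)
      fix j assume "j \<in> {..<deg f}"
      hence "norm (1 / 4 + kpar f j / 2) \<ge> 1 / 4" by (intro nz) simp
      thus "norm (1 / 4 + kpar f j / 2) \<noteq> 0" by linarith
    qed simp
    moreover have "ln (analytic_conductor f) = ln (real (cond f) / pi ^ deg f) + ln (\<Prod>j<deg f. norm (1 / 4 + kpar f j / 2))"
      unfolding analytic_conductor_def using P data(3) by (intro ln_mult_pos) auto
    moreover have "ln (real (cond f) / pi ^ deg f) = ln (cond f) - deg f * ln pi"
      using data(3) by (simp add: ln_div ln_realpow)
    ultimately show ?thesis by simp
  qed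
  moreover have "(\<Sum>j<deg f. Re (Digamma ((of_real x + kpar f j) / 2))) \<le> (\<Sum>j<deg f. ln (norm (1 / 4 + kpar f j / 2)) + 6)"
  proof (rule sum_mono)
    fix j assume "j \<in> {..<deg f}"
    hence j: "j < deg f" by simp
    define w where "w = (of_real x + kpar f j) / 2"
    have w4: "Re w \<ge> 1 / 4" using data(2)[OF j] x by (simp add: w_def)
    have "w = (1 / 4 + kpar f j / 2) + of_real ((x - 1 / 2) / 2)" by (simp add: w_def field_simps)
    hence "norm w \<le> norm (1 / 4 + kpar f j / 2) + norm (of_real ((x - 1 / 2) / 2) :: complex)"
      using norm_triangle_ineq by metis
    also have "norm (of_real ((x - 1 / 2) / 2) :: complex) \<le> 1 / 4" using x unfolding norm_of_real by simp
    also note nz[OF j]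
    finally have "norm w \<le> 2 * norm (1 / 4 + kpar f j / 2)" by simp
    moreover have w0: "norm w > 0" using w4 abs_Re_le_cmod[of w] by linarith
    ultimately have "ln (norm w) \<le> ln (2 * norm (1 / 4 + kpar f j / 2))" by (intro ln_mono) auto
    also have "\<dots> = ln 2 + ln (norm (1 / 4 + kpar f j / 2))" using nz[OF j] by (intro ln_mult_pos) auto
    also have "ln (2 :: real) \<le> 1" using ln_numeral_bounds by simp
    finally show "Re (Digamma ((of_real x + kpar f j) / 2)) \<le> ln (norm (1 / 4 + kpar f j / 2)) + 6"
      using Re_Digamma_le[OF w4] unfolding w_def by linarith
  qed
  ultimately show ?thesis by (simp add: E_def sum.distrib field_simps)
qed

end

theorem corollary1p1:
  fixes f :: L_data and C :: real
  assumes "is_L_function f"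
    and "C = analytic_conductor f"
    and "\<forall>s. Re s = 1 \<longrightarrow> \<not> is_pole (Lambda f) s \<and> \<not> Lambda_zero f s"
    and "GRH f"
    and "ramanujan f"
    and "C > 1"
    and "ln (ln C) \<ge> 10"
  shows "log_ext (norm (L_fun f (1 / 2))) \<le>
           ereal (23 * real (deg f) / 25 * (ln C / (ln (ln C))\<^sup>2) + 3 / 8 * (ln C / ln (ln C)))"
proof -
  interpret grh_L_function f
    using assms by unfold_locales
  define L where "L = ln (ln C)"
  \<comment> \<open>The shift balances the second-order terms: a larger y lowers the leading term
    but raises the prime sum, which has the size exp (y / 2) / y^2.\<close>
  define y where "y = 2 * L - 1517 / 1000"
  \<comment> \<open>Just above the root, near 0.4912, of exp (-l) = l + l^2 / 2; the leading term
    grows with l.\<close>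
  define l where "l = (4915 / 10000 :: real)"
  define d where "d = real (deg f)"
  have L10: "L \<ge> 10" using assms by (simp add: L_def)
  have eL: "exp L = ln C" using assms by (simp add: L_def)
  have y: "y \<ge> 18483 / 1000" "y > 0" using L10 by (simp_all add: y_def)
  have d1: "d \<ge> 1" using data(1) by (simp add: d_def)
  show ?thesis
  proof (cases "Lambda f (1 / 2) = 0")
    \<comment> \<open>Here the convention for the logarithm of 0 gives minus infinity on the
      left.\<close>
    case True
    thus ?thesis by (simp add: L_fun_half log_ext_def)
  next
    case False
    have lam: "l > 0" "exp (- l) \<le> l + l\<^sup>2 / 2"
    proof -
      have "inverse (exp l) \<le> inverse (16346 / 10000)"
        using exp_numeral_bounds(4) by (intro le_imp_inverse_le) (auto simp: l_def)
      also have "\<dots> \<le> l + l\<^sup>2 / 2" by (simp add: l_def power2_eq_square)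
      finally show "exp (- l) \<le> l + l\<^sup>2 / 2" by (simp add: exp_minus)
    qed (simp add: l_def)
    have ly: "l / y \<le> 1 / 2" using y by (simp add: l_def field_simps)
    define e where "e = ln C / 2 + 3 * d"
    have "ln (norm (L_fun f (1 / 2))) \<le>
      norm (logsum y (of_real (1 / 2 + l / y))) / y + (1 + l) / y * e + 400 * d * exp (- y / 4) / y\<^sup>2"
      unfolding d_def
    proof (rule log_L_bound[OF lam y(2) False])
      fix x assume x: "1 / 2 \<le> x" "x \<le> 1 / 2 + l / y"
      have "x \<le> 1" using x ly by linarith
      thus "Re (E (of_real x)) \<le> e"
        using Re_E_le[of x] x(1) assms(2) by (simp add: e_def d_def)
    qed
    also have "norm (logsum y (of_real (1 / 2 + l / y))) / y \<le> d * (576 / 1000 * (exp L / L\<^sup>2) + 65 / 10 + L / 6)"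
    proof -
      define S where "S = (\<Sum>n=2..N0 y. mangoldt n * weight (1 / 2 - l / y) y (real n))"
      have N: "2 \<le> N0 y" "real (N0 y) \<le> exp y"
      proof -
        have "exp y \<ge> 2" using y exp_ge_add_one_self[of y] by linarith
        thus "2 \<le> N0 y" unfolding N0_def by (simp add: le_nat_iff le_floor_iff)
        show "real (N0 y) \<le> exp y" unfolding N0_def by simp
      qed
      have "S / y \<le> 111 / 100 * (ei_large (L - 5 / 4) - exp (L - 5 / 4) / (L - 5 / 4)) + 65 / 10 + L / 6"
        using prime_sum_bound[OF L10] N unfolding S_def l_def y_def by blast
      also have "\<dots> \<le> 576 / 1000 * (exp L / L\<^sup>2) + 65 / 10 + L / 6"
        using ei_large_asymptotic[OF L10] by simp
      finally have "d * (S / y) \<le> d * (576 / 1000 * (exp L / L\<^sup>2) + 65 / 10 + L / 6)"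
        using d1 by (intro mult_left_mono) auto
      moreover have "norm (logsum y (of_real (1 / 2 + l / y))) / y \<le> d * S / y"
        using norm_logsum_le[OF y(2), of l] y unfolding d_def S_def by (intro divide_right_mono) auto
      ultimately show ?thesis by simp
    qed
    also have "(1 + l) / y * e \<le> d * (285 / 1000 * (exp L / L\<^sup>2)) + 3 / 8 * (exp L / L) + d * (25 / 100)"
    proof -
      have "(1 + l) / y * (exp L / 2) \<le> 285 / 1000 * (exp L / L\<^sup>2) + 3 / 8 * (exp L / L)"
        unfolding l_def y_def by (rule leading_term[OF L10])
      moreover have "1 * (285 / 1000 * (exp L / L\<^sup>2)) \<le> d * (285 / 1000 * (exp L / L\<^sup>2))"
        using d1 by (intro mult_right_mono) auto
      moreover have "(1 + l) / y * (3 * d) \<le> d * (25 / 100)"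
      proof -
        have "(1 + l) / y * 3 \<le> 25 / 100" using y by (simp add: l_def field_simps)
        hence "(1 + l) / y * 3 * d \<le> 25 / 100 * d" using d1 by (intro mult_right_mono) auto
        thus ?thesis by (simp add: mult_ac)
      qed
      ultimately show ?thesis unfolding e_def eL[symmetric] distrib_left by simp
    qed
    also have "400 * d * exp (- y / 4) / y\<^sup>2 \<le> d * (25 / 100)"
    proof -
      have "exp (- y / 4) \<le> exp (- 4)" using y by simp
      also have "exp (- 4) \<le> (1 / 16 :: real)"
      proof -
        have "(16::real) \<le> exp 4"
          by (rule exp_ge_if_Taylor[where n = 4]) (simp_all add: eval_nat_numeral)
        thus ?thesis by (simp add: exp_minus field_simps)
      qed
      finally have "400 * d * exp (- y / 4) \<le> 400 * d * (1 / 16)" using d1 by (intro mult_left_mono) auto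
      moreover have "(18483 / 1000)\<^sup>2 \<le> y\<^sup>2" using y by (intro power_mono) auto
      hence "y\<^sup>2 \<ge> 100" by (simp add: power2_eq_square)
      ultimately have "400 * d * exp (- y / 4) / y\<^sup>2 \<le> 400 * d * (1 / 16) / 100"
        using d1 by (intro frac_le) auto
      thus ?thesis by simp
    qed
    finally have "ln (norm (L_fun f (1 / 2))) \<le> d * (576 / 1000 * (exp L / L\<^sup>2) + 65 / 10 + L / 6) +
       (d * (285 / 1000 * (exp L / L\<^sup>2)) + 3 / 8 * (exp L / L) + d * (25 / 100)) + d * (25 / 100)" by simp
    also have "\<dots> = d * (861 / 1000 * (exp L / L\<^sup>2) + (7 + L / 6)) + 3 / 8 * (exp L / L)"
      by (simp add: algebra_simps)
    \<comment> \<open>Of 23/25 = 0.920, the prime sum and the leading term have used 0.576 + 0.285 =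
      0.861. The remaining 0.059 absorbs 7 + L / 6, where 7 is 6.5 from the prime sum and twice 0.25
      from the bounded gamma error and the error at Re s = 1/4.\<close>
    also have "\<dots> \<le> d * (861 / 1000 * (exp L / L\<^sup>2) + 59 / 1000 * (exp L / L\<^sup>2)) + 3 / 8 * (exp L / L)"
      using lower_order_terms[OF L10] d1 by (intro add_right_mono mult_left_mono add_left_mono) auto
    also have "\<dots> = 23 * d / 25 * (ln C / L\<^sup>2) + 3 / 8 * (ln C / L)"
      unfolding eL by (simp add: algebra_simps)
    finally have "ln (norm (L_fun f (1 / 2))) \<le> 23 * d / 25 * (ln C / L\<^sup>2) + 3 / 8 * (ln C / L)" .
    moreover have "norm (L_fun f (1 / 2)) \<noteq> 0" using False by (simp add: L_fun_half)
    ultimately show ?thesis by (simp add: log_ext_def L_def d_def)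
  qed
qed

end
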